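(* Consider a dominated parametric observation-driven model $\{(g^\theta,\psi^\theta):\theta\in\Theta\}$ as described in the context. Assume the following. (a) For all $\theta\in\Theta$, the kernel $K^\theta$ admits a unique stationary distribution $\pi^\theta$ on $\mathsf X\times\mathsf Y$ (with marginals $\pi_1^\theta$ on $\mathsf X$ and $\pi_2^\theta$ on $\mathsf Y$). (b) There is a measurable function $\bar V:\mathsf X\to\mathbb R_+$ such that $\pi_1^\theta(\bar V)<\infty$ for all $\theta\in\Theta$. (c) For all $y\in\mathsf Y$, the functions $(\theta,x)\mapsto g^\theta(x;y)$ and $(\theta,x)\mapsto\psi^\theta_y(x)$ are continuous on $\Theta\times\mathsf X$. (d) There exist $x_1\in\mathsf X$, a closed set $\mathsf X_1\subseteq\mathsf X$, $\varrho\in(0,1)$, $C\ge 0$ and measurable functions $\bar\psi:\mathsf X\to\mathbb R_+$, $H:\mathbb R_+\to\mathbb R_+$ and $\bar\phi:\mathsf Y\to\mathbb R_+$ such that: (i) $\psi^\theta_y(x)\in\mathsf X_1$ for all $\theta\in\Theta$, $(x,y)\in\mathsf X\times\mathsf Y$; (ii) $\sup_{(\theta,x,y)\in\Theta\times\mathsf X_1\times\mathsf Y}g^\theta(x;y)<\infty$; (iii) for all $\theta\in\Theta$, $n\in\mathbb Z_+$, $x\in\mathsf X$, $y_{1:n}\in\mathsf Y^n$, $d\big(\psi^\theta\langle y_{1:n}\rangle(x_1),\psi^\theta\langle y_{1:n}\rangle(x)\big)\le\varrho^n\,\bar\psi(x)$; (iv) $\bar\psi$ is locally bounded; (v) $\bar\psi(\psi^\theta_y(x_1))\le\bar\phi(y)$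 for all $\theta\in\Theta$, $y\in\mathsf Y$; (vi) for all $\theta\in\Theta$ and $(x,x',y)\in\mathsf X_1\times\mathsf X_1\times\mathsf Y$, $$\left|\ln\frac{g^\theta(x;y)}{g^\theta(x';y)}\right|\le H(d(x,x'))\,e^{C\,(d(x_1,x)\vee d(x_1,x'))}\,\bar\phi(y);$$ (vii) $H(u)=O(u)$ as $u\to0$; (viii) if $C=0$, then $G^\theta\ln^+\bar\phi\lesssim\bar V$ for all $\theta\in\Theta$; otherwise $G^\theta\bar\phi\lesssim\bar V$ for all $\theta\in\Theta$. Let $p^\theta(\cdot\mid\cdot)$ be the function defined in the context using the initial point $x=x_1$. Then: (1) For all $\theta,\theta_\star\in\Theta$: if $\theta\ne\theta_\star$, then $y\mapsto p^\theta(y\mid Y_{-\infty:0})$ is a probability density function with respect to $\nu$, $\tilde{\mathbb P}^{\theta_\star}$-a.s.; and, under $\tilde{\mathbb P}^{\theta_\star}$, $y\mapsto p^{\theta_\star}(y\mid Y_{-\infty:0})$ is the conditional density function (with respect to $\nu$) of $Y_1$ given $Y_{-\infty:0}$. (2) For all $\theta_\star\in\Theta$, with $\Theta_\star=\operatorname{argmax}_{\theta\in\Theta}\tilde{\mathbb E}^{\theta_\star}\left[\ln p^\theta(Y_1\mid Y_{-\infty:0})\right]$, $$\lim_{n\to\infty}\Delta(\hat\theta_{x_1,n},\Theta_\star)=0\qquad\tilde{\mathbb P}^{\theta_\star}\text{-a.s.}$$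
   Context: $\mathbb Z_+=\{0,1,2,\dots\}$, $\mathbb R_+=[0,\infty)$, $\ln^+ u=\max(\ln u,0)$ (with $\ln^+0=0$), $a\vee b=\max(a,b)$. Setting. $(\mathsf X,d)$ is a complete separable metric space with Borel $\sigma$-field $\mathcal X$; $(\mathsf Y,\mathcal Y)$ is a (standard) Borel space; $(\Theta,\Delta)$ is a compact metric space. For each $\theta\in\Theta$, $G^\theta$ is a probability kernel on $\mathsf X\times\mathcal Y$ and $(x,y)\mapsto\psi^\theta_y(x)$ is a measurable function from $\mathsf X\times\mathsf Y$ to $\mathsf X$. The model is dominated: there is a $\sigma$-finite measure $\nu$ on $(\mathsf Y,\mathcal Y)$ such that $G^\theta(x;dy)=g^\theta(x;y)\,\nu(dy)$ with $g^\theta(x;y)>0$ for all $(\theta,x,y)\in\Theta\times\mathsf X\times\mathsf Y$. The observation-driven model with parameter $\theta$ is the Markov chain $\{(X_k,Y_k)\}$ on $\mathsf X\times\mathsf Y$ with transition kernel $$K^\theta((x,y);dx'\,dy')=\delta_{\psi^\theta_y(x)}(dx')\,G^\theta(x';dy').$$ For a nonnegative function $f$ on $\mathsf Y$, $G^\theta f(x)=\int f(y)\,G^\theta(x;dy)$. For $y_{s:t}=(y_s,\dots,y_t)$, $\psi^\theta\langle y_{s:t}\rangle=\psi^\theta_{y_t}\circ\psi^\theta_{y_{t-1}}\circ\dots\circ\psi^\theta_{y_s}$, with the convention that it is the identity map when $s>t$. When $K^\theta$ has a unique stationary distribution $\pi^\theta$, $\mathbb P^\theta$ denotes the law on $(\mathsf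 X\times\mathsf Y)^{\mathbb Z}$ of the two-sided stationary Markov chain with kernel $K^\theta$ and marginal $\pi^\theta$, and $\tilde{\mathbb P}^\theta$ denotes its projection on $\mathsf Y^{\mathbb Z}$ (law of $(Y_k)_{k\in\mathbb Z}$), with expectations $\mathbb E^\theta,\tilde{\mathbb E}^\theta$. For $x\in\mathsf X$, the (conditional) maximum likelihood estimator is any $\hat\theta_{x,n}\in\operatorname{argmax}_{\theta\in\Theta}\ n^{-1}\sum_{k=1}^n\ln g^\theta\big(\psi^\theta\langle Y_{1:k-1}\rangle(x);Y_k\big)$. For a given initial point $x\in\mathsf X$, $p^\theta(y_1\mid y_{-\infty:0})=\lim_{m\to\infty}g^\theta\big(\psi^\theta\langle y_{-m:0}\rangle(x);y_1\big)$ if the limit exists, and $=\infty$ otherwise. For a real function $f$ and nonnegative function $V$ on $\mathsf X$, $f\lesssim V$ means there is $c>0$ with $|f(x)|\le cV(x)$ for all $x\in\mathsf X$. For a set $S\subseteq\Theta$, $\Delta(\theta,S)=\inf_{\theta'\in S}\Delta(\theta,\theta')$. *)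

theory Defs
  imports "HOL-Probability.Probability"
begin

definition standard_borel :: "'a measure \<Rightarrow> bool" where
  "standard_borel M \<longleftrightarrow>
     (\<exists>T. completely_metrizable_space T \<and> second_countable T \<and> topspace T = space M \<and>
          sets M = sigma_sets (space M) {U. openin T U})"

text \<open>
  The observation space is carried by the dominating measure \<open>\<nu>\<close>: its points are
  \<open>space \<nu>\<close> and its \<open>\<sigma>\<close>-field is \<open>sets \<nu>\<close>. The state space is the
  type \<open>'x\<close>; the parameter set \<open>\<Theta>\<close> is a compact subset of a metric space.
\<close>

locale dominated_odm =
  fixes \<Theta> :: "'t::metric_space set"
    and \<nu> :: "'y measure"
    and G :: "'t \<Rightarrow> 'x::polish_space \<Rightarrow> 'y measure"
    and g :: "'t \<Rightarrow> 'x \<Rightarrow> 'y \<Rightarrow> real"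
    and \<psi> :: "'t \<Rightarrow> 'y \<Rightarrow> 'x \<Rightarrow> 'x"
  assumes compact_param: "compact \<Theta>"
    and standard_borel_obs: "standard_borel \<nu>"
    and sigma_finite_dom: "sigma_finite_measure \<nu>"
    and kernel: "\<And>\<theta>. \<theta> \<in> \<Theta> \<Longrightarrow> G \<theta> \<in> borel \<rightarrow>\<^sub>M prob_algebra \<nu>"
    and map_measurable: "\<And>\<theta>. \<theta> \<in> \<Theta> \<Longrightarrow> (\<lambda>(x, y). \<psi> \<theta> y x) \<in> borel \<Otimes>\<^sub>M \<nu> \<rightarrow>\<^sub>M borel"
    and dens_measurable: "\<And>\<theta> x. \<theta> \<in> \<Theta> \<Longrightarrow> g \<theta> x \<in> borel_measurable \<nu>"
    and dens_pos: "\<And>\<theta> x y. \<theta> \<in> \<Theta> \<Longrightarrow> y \<in> space \<nu> \<Longrightarrow> g \<theta> x y > 0"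
    and dominated: "\<And>\<theta> x. \<theta> \<in> \<Theta> \<Longrightarrow> G \<theta> x = density \<nu> (\<lambda>y. ennreal (g \<theta> x y))"

text \<open>The kernel \<open>\<delta>\<^bsub>\<psi> y x\<^esub>(dx') G(x'; dy')\<close>, for a single parameter.\<close>

definition odm_kernel ::
  "'y measure \<Rightarrow> ('x::polish_space \<Rightarrow> 'y measure) \<Rightarrow> ('y \<Rightarrow> 'x \<Rightarrow> 'x) \<Rightarrow>
     'x \<times> 'y \<Rightarrow> ('x \<times> 'y) measure" where
  "odm_kernel \<nu> G \<psi> = (\<lambda>(x, y).
     return borel (\<psi> y x) \<bind> (\<lambda>x'. G x' \<bind> (\<lambda>y'. return (borel \<Otimes>\<^sub>M \<nu>) (x', y'))))"

definition stationary_distribution :: "'a measure \<Rightarrow> ('a \<Rightarrow> 'a measure) \<Rightarrow> 'a measure \<Rightarrow> bool" where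
  "stationary_distribution M K \<pi> \<longleftrightarrow> \<pi> \<in> space (prob_algebra M) \<and> \<pi> \<bind> K = \<pi>"

definition unique_stationary_distribution ::
  "'a measure \<Rightarrow> ('a \<Rightarrow> 'a measure) \<Rightarrow> 'a measure \<Rightarrow> bool" where
  "unique_stationary_distribution M K \<pi> \<longleftrightarrow>
     stationary_distribution M K \<pi> \<and> (\<forall>\<pi>'. stationary_distribution M K \<pi>' \<longrightarrow> \<pi>' = \<pi>)"

definition paths :: "'a measure \<Rightarrow> (int \<Rightarrow> 'a) measure" where
  "paths M = PiM UNIV (\<lambda>_. M)"

text \<open>The \<open>\<sigma>\<close>-field on two-sided paths generated by the coordinates up to time \<open>k\<close>.\<close>

definition past :: "'a measure \<Rightarrow> int \<Rightarrow> (int \<Rightarrow> 'a) measure" where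
  "past M k = vimage_algebra (space (paths M)) (\<lambda>\<omega>. restrict \<omega> {..k}) (PiM {..k} (\<lambda>_. M))"

text \<open>
  \<open>P\<close> is the law of the two-sided stationary Markov chain with kernel \<open>K\<close> and marginal
  \<open>\<pi>\<close>. There is at most one such \<open>P\<close>, and for standard Borel \<open>M\<close> and stationary
  \<open>\<pi>\<close> there is one, by Kolmogorov extension.
\<close>

definition stationary_chain_law ::
  "'a measure \<Rightarrow> ('a \<Rightarrow> 'a measure) \<Rightarrow> 'a measure \<Rightarrow> (int \<Rightarrow> 'a) measure \<Rightarrow> bool" where
  "stationary_chain_law M K \<pi> P \<longleftrightarrow>
     P \<in> space (prob_algebra (paths M)) \<and>
     (\<forall>k. distr P M (\<lambda>\<omega>. \<omega> k) = \<pi>) \<and>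
     (\<forall>k. \<forall>A\<in>sets M. AE \<omega> in P.
        nn_cond_exp P (past M k) (indicator {\<omega> \<in> space P. \<omega> (k + 1) \<in> A}) \<omega> =
          emeasure (K (\<omega> k)) A)"

definition obs_law :: "'y measure \<Rightarrow> (int \<Rightarrow> 'x \<times> 'y) measure \<Rightarrow> (int \<Rightarrow> 'y) measure" where
  "obs_law \<nu> P = distr P (paths \<nu>) (\<lambda>\<omega> k. snd (\<omega> k))"

text \<open>\<open>\<psi> y\<^sub>t \<circ> \<dots> \<circ> \<psi> y\<^sub>s\<close>, which is the identity when \<open>s > t\<close>.\<close>

definition iter_map :: "('y \<Rightarrow> 'x \<Rightarrow> 'x) \<Rightarrow> (int \<Rightarrow> 'y) \<Rightarrow> int \<Rightarrow> int \<Rightarrow> 'x \<Rightarrow> 'x" where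
  "iter_map \<psi> y s t = fold \<psi> (map y [s..t])"

definition loglik ::
  "('t \<Rightarrow> 'x \<Rightarrow> 'y \<Rightarrow> real) \<Rightarrow> ('t \<Rightarrow> 'y \<Rightarrow> 'x \<Rightarrow> 'x) \<Rightarrow> 'x \<Rightarrow> nat \<Rightarrow> (int \<Rightarrow> 'y) \<Rightarrow> 't \<Rightarrow> real" where
  "loglik g \<psi> x n y \<theta> =
     (\<Sum>k=1..int n. ln (g \<theta> (iter_map (\<psi> \<theta>) y 1 (k - 1) x) (y k))) / real n"

text \<open>
  \<open>pred_density g \<psi> x \<theta> y z\<close> is \<open>p\<^sup>\<theta>(z | y\<^bsub>-\<infinity>:0\<^esub>)\<close> with initial point
  \<open>x\<close>; it only depends on the coordinates of \<open>y\<close> at times \<open>\<le> 0\<close>.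
\<close>

definition pred_density ::
  "('t \<Rightarrow> 'x \<Rightarrow> 'y \<Rightarrow> real) \<Rightarrow> ('t \<Rightarrow> 'y \<Rightarrow> 'x \<Rightarrow> 'x) \<Rightarrow> 'x \<Rightarrow> 't \<Rightarrow> (int \<Rightarrow> 'y) \<Rightarrow> 'y \<Rightarrow> ennreal" where
  "pred_density g \<psi> x \<theta> y z =
     (let a = (\<lambda>m::nat. g \<theta> (iter_map (\<psi> \<theta>) y (- int m) 0 x) z)
      in if convergent a then ennreal (lim a) else \<infinity>)"

definition prob_density :: "'y measure \<Rightarrow> ('y \<Rightarrow> ennreal) \<Rightarrow> bool" where
  "prob_density \<nu> f \<longleftrightarrow> f \<in> borel_measurable \<nu> \<and> (\<integral>\<^sup>+ z. f z \<partial>\<nu>) = 1"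

text \<open>Under \<open>Q\<close>, \<open>f\<close> is a conditional density of \<open>Z\<close> given \<open>F\<close>, with respect to \<open>\<nu>\<close>.\<close>

definition conditional_density ::
  "'a measure \<Rightarrow> 'a measure \<Rightarrow> 'y measure \<Rightarrow> ('a \<Rightarrow> 'y) \<Rightarrow> ('a \<Rightarrow> 'y \<Rightarrow> ennreal) \<Rightarrow> bool" where
  "conditional_density Q F \<nu> Z f \<longleftrightarrow>
     (\<lambda>(\<omega>, z). f \<omega> z) \<in> borel_measurable (F \<Otimes>\<^sub>M \<nu>) \<and>
     (\<forall>B\<in>sets \<nu>. AE \<omega> in Q.
        nn_cond_exp Q F (indicator {\<omega> \<in> space Q. Z \<omega> \<in> B}) \<omega> = (\<integral>\<^sup>+ z\<in>B. f \<omega> z \<partial>\<nu>))"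

definition ext_ln :: "ennreal \<Rightarrow> ereal" where
  "ext_ln u = (if u = 0 then -\<infinity> else if u = \<infinity> then \<infinity> else ereal (ln (enn2real u)))"

text \<open>
  Expectation of the positive part minus expectation of the negative part. It is meaningful
  when one of the two is finite (\<open>\<infinity> - \<infinity> = \<infinity>\<close> in \<open>ereal\<close>); it may be \<open>-\<infinity>\<close>.
\<close>

definition ext_expectation :: "'a measure \<Rightarrow> ('a \<Rightarrow> ereal) \<Rightarrow> ereal" where
  "ext_expectation Q f =
     enn2ereal (\<integral>\<^sup>+ \<omega>. e2ennreal (f \<omega>) \<partial>Q) - enn2ereal (\<integral>\<^sup>+ \<omega>. e2ennreal (- f \<omega>) \<partial>Q)"

definition argmax_set :: "'t set \<Rightarrow> ('t \<Rightarrow> 'a::linorder) \<Rightarrow> 't set" where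
  "argmax_set S f = {\<theta>. is_arg_max f (\<lambda>\<theta>. \<theta> \<in> S) \<theta>}"

text \<open>For nonnegative arguments; \<open>ln 0 = 0\<close>.\<close>

definition ln_plus :: "real \<Rightarrow> real" where
  "ln_plus u = max (ln u) 0"

text \<open>\<open>f \<lesssim> V\<close>, for \<open>f\<close> that is a priori only known to be \<open>[0, \<infinity>]\<close>-valued.\<close>

definition dominated_by :: "('x \<Rightarrow> ennreal) \<Rightarrow> ('x \<Rightarrow> real) \<Rightarrow> bool" where
  "dominated_by f V \<longleftrightarrow> (\<exists>c>0. \<forall>x. f x \<le> ennreal (c * V x))"

definition locally_bounded :: "('x::metric_space \<Rightarrow> real) \<Rightarrow> bool" where
  "locally_bounded f \<longleftrightarrow> (\<forall>x. \<exists>e>0. bounded (f ` ball x e))"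

end

theory Submission
  imports Defs
begin

text \<open>
  Two facts carry the proof: the state of the model forgets its starting point at a geometric
  rate, uniformly in the parameter, and the observed process is ergodic.

  \<^emph>\<open>Forgetting.\<close> Starting the recursion one observation earlier moves the current state by at
  most \<open>\<rho>\<^sup>n \<phi>bar y\<close>, where \<open>y\<close> is the added observation and \<open>n\<close> its age. Under the stationary law
  \<open>ln\<^sup>+ \<phi>bar\<close> is integrable, so these increments are almost surely summable, and the states started
  from \<open>x1\<close> in the remote past converge to a \<open>limit_state\<close>, uniformly in \<open>\<theta>\<close>
  (\<open>orbit_tendsto_limit_state\<close>, \<open>limit_state_continuous\<close>). Hence \<open>p\<^sup>\<theta>(\<sqdot> | y\<^bsub>-\<infinity>:0\<^esub>)\<close> is
  \<open>g \<theta> x\<close> at \<open>x =\<close> the limiting state, which is a probability density. For the parameter \<open>\<theta>s\<close> that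
  generates the data, the hidden state is itself an iterate of the recursion started from a
  stationary state in the remote past; it therefore equals the limiting state
  (\<open>AE_state_is_limit\<close>), and the Markov property says that \<open>p\<^sup>\<theta>\<^sup>s\<close> is the conditional density. The
  same estimate, together with the log-Lipschitz bound on \<open>g\<close>, shows that the log-likelihood
  started at \<open>x1\<close> and its stationary version differ, but for finitely many terms, by a convergent
  series that does not depend on \<open>\<theta>\<close> (\<open>pred_loglik_approximation\<close>).

  \<^emph>\<open>Ergodicity.\<close> A shift-invariant event can be approximated by events of the arbitrarily remote
  past, so conditioning on it keeps the chain Markovian with the same kernel. The conditioned
  marginal is then stationary for the kernel, and uniqueness of the stationary distribution
  makes the event independent of everything, itself included (\<open>ergodic_shift\<close>).

  Given these, consistency follows Wald's argument. If \<open>\<theta>\<close> is not a maximizer of the expected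
  predictive log-density, then by continuity in \<open>\<theta>\<close> and monotone convergence the supremum of the
  log-densities over a small ball around \<open>\<theta>\<close> still has expectation below the maximum
  (\<open>local_envelope\<close>). The ergodic theorem makes the likelihood on this ball eventually smaller
  than the likelihood at a maximizer, and compactness covers all parameters at distance at least
  \<open>e\<close> from the maximizers by finitely many such balls. The expectation may be \<open>-\<infinity>\<close> for
  some parameters; the ergodic theorem is then applied to a truncated log-density.
\<close>

section \<open>An ergodic theorem\<close>

locale ergodic_map = prob_space M for M :: "'a measure" +
  fixes T :: "'a \<Rightarrow> 'a"
  assumes T_measurable [measurable]: "T \<in> M \<rightarrow>\<^sub>M M"
    and T_preserves: "distr M M T = M"
    and T_ergodic: "\<And>A. A \<in> sets M \<Longrightarrow> T -` A \<inter> space M = A \<Longrightarrow> emeasure M A = 0 \<or> emeasure M A = 1"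
begin

lemma integral_T: "f \<in> borel_measurable M \<Longrightarrow> (\<integral>x. f (T x) \<partial>M) = (\<integral>x. f x \<partial>M)"
  for f :: "'a \<Rightarrow> real"
  using integral_distr[OF T_measurable, of f] by (simp add: T_preserves)

lemma integrable_T: "integrable M f \<Longrightarrow> integrable M (\<lambda>x. f (T x))"
  for f :: "'a \<Rightarrow> real"
  using integrable_distr[OF T_measurable, of f] by (simp add: T_preserves)

text \<open>
  The maximum of the sums of the first \<open>1, \<dots>, n + 1\<close> terms of \<open>f\<close> along the orbit of \<open>x\<close>. Splitting
  off the first term instead of the last one relates the maximum at \<open>x\<close> to the maximum at \<open>T x\<close>.
\<close>

primrec max_sum :: "('a \<Rightarrow> real) \<Rightarrow> nat \<Rightarrow> 'a \<Rightarrow> real" where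
  "max_sum f 0 x = f x"
| "max_sum f (Suc n) x = f x + max 0 (max_sum f n (T x))"

lemma max_sum_mono: "max_sum f n x \<le> max_sum f (Suc n) x"
proof (induction n arbitrary: x)
  case (Suc n)
  have "max_sum f (Suc n) x = f x + max 0 (max_sum f n (T x))" by simp
  also have "\<dots> \<le> f x + max 0 (max_sum f (Suc n) (T x))" using Suc[of "T x"] by linarith
  finally show ?case by simp
qed simp

lemma max_sum_ge_first: "f x \<le> max_sum f n x"
  by (cases n) auto

lemma sum_le_max_sum: "(\<Sum>k<Suc n. f ((T ^^ k) x)) \<le> max_sum f n x"
proof (induction n arbitrary: x)
  case (Suc n)
  have "(\<Sum>k<Suc (Suc n). f ((T ^^ k) x)) = f x + (\<Sum>k<Suc n. f ((T ^^ k) (T x)))"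
    by (subst sum.lessThan_Suc_shift) (simp del: sum.lessThan_Suc funpow.simps add: funpow_Suc_right)
  also have "\<dots> \<le> f x + max 0 (max_sum f n (T x))" using Suc[of "T x"] by linarith
  finally show ?case by simp
qed simp

lemma integrable_max_sum:
  assumes "integrable M f" shows "integrable M (max_sum f n)"
proof (induction n)
  case (Suc n)
  have "integrable M (\<lambda>x. f x + max 0 (max_sum f n (T x)))"
    using assms integrable_T[OF Suc] by (intro Bochner_Integration.integrable_add integrable_max) auto
  then show ?case by simp
qed (use assms in simp)

text \<open>
  The event \<open>A\<close> that the sums are unbounded is invariant, so it has probability 0 or 1. If it had
  probability 1, then \<open>max_sum f (Suc n) x - max_sum f n (T x)\<close> would decrease to \<open>f x\<close> almost surely,
  since the positive part in the recursion is eventually inactive. But its expectation is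
  nonnegative, because \<open>max_sum\<close> increases with \<open>n\<close> and \<open>T\<close> preserves the measure; so the
  expectation of \<open>f\<close> would be nonnegative too.
\<close>

lemma AE_sums_bounded:
  fixes f :: "'a \<Rightarrow> real"
  assumes f: "integrable M f" and neg: "(\<integral>x. f x \<partial>M) < 0"
  shows "AE x in M. \<exists>b. \<forall>n. (\<Sum>k<n. f ((T ^^ k) x)) \<le> b"
proof -
  let ?F = "max_sum f"
  have [measurable]: "f \<in> borel_measurable M" "?F n \<in> borel_measurable M" for n
    using f integrable_max_sum[OF f] by auto
  define A where "A = {x \<in> space M. \<forall>c::nat. \<exists>n. ?F n x > real c}"
  have A [measurable]: "A \<in> sets M" unfolding A_def by measurable
  have A_iff: "x \<in> A \<longleftrightarrow> x \<in> space M \<and> (\<forall>c. \<exists>n. ?F n x > c)" for x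
    unfolding A_def by (auto, meson less_trans reals_Archimedean2)
  have inv: "T -` A \<inter> space M = A"
  proof (intro set_eqI iffI)
    fix x assume x: "x \<in> T -` A \<inter> space M"
    have "\<exists>n. ?F n x > c" for c
    proof -
      from x obtain n where "?F n (T x) > c - f x" by (auto simp: A_iff)
      then have "?F (Suc n) x > c" by simp
      then show ?thesis ..
    qed
    then show "x \<in> A" using x by (auto simp: A_iff)
  next
    fix x assume x: "x \<in> A"
    have "\<exists>n. ?F n (T x) > c" for c
    proof -
      from x obtain n where n: "?F n x > f x + \<bar>c\<bar>" by (auto simp: A_iff)
      then obtain m where "n = Suc m" by (cases n) auto
      with n have "?F m (T x) > c" by simp
      then show ?thesis ..
    qed
    then show "x \<in> T -` A \<inter> space M"
      using x measurable_space[OF T_measurable] by (auto simp: A_iff)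
  qed
  have "emeasure M A \<noteq> 1"
  proof
    assume "emeasure M A = 1"
    then have AE_A: "AE x in M. x \<in> A"
      by (simp add: AE_in_set_eq_1 measure_def)
    define D where "D n x = ?F (Suc n) x - ?F n (T x)" for n x
    have D: "D n x = f x + max 0 (- ?F n (T x))" for n x
      by (auto simp: D_def max_def)
    have [measurable]: "D n \<in> borel_measurable M" for n unfolding D_def by measurable
    have "(\<lambda>n. \<integral>x. D n x \<partial>M) \<longlonglongrightarrow> (\<integral>x. f x \<partial>M)"
    proof (rule integral_dominated_convergence[where w="\<lambda>x. \<bar>f x\<bar> + \<bar>f (T x)\<bar>"])
      show "integrable M (\<lambda>x. \<bar>f x\<bar> + \<bar>f (T x)\<bar>)"
        using f integrable_T[OF f] by auto
      show "AE x in M. (\<lambda>n. D n x) \<longlonglongrightarrow> f x"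
        using AE_A
      proof eventually_elim
        fix x assume "x \<in> A"
        then have "T x \<in> A" using inv by blast
        then obtain n0 where n0: "?F n0 (T x) > 0" unfolding A_iff by blast
        have "?F n0 (T x) \<le> ?F n (T x)" if "n \<ge> n0" for n
          by (rule lift_Suc_mono_le[of "\<lambda>n. ?F n (T x)", OF _ that]) (rule max_sum_mono)
        then have "eventually (\<lambda>n. D n x = f x) sequentially"
          using n0 by (intro eventually_sequentiallyI[of n0]) (fastforce simp: D max_def)
        then show "(\<lambda>n. D n x) \<longlonglongrightarrow> f x" by (rule tendsto_eventually)
      qed
      show "AE x in M. norm (D n x) \<le> \<bar>f x\<bar> + \<bar>f (T x)\<bar>" for n
        using max_sum_ge_first[of f "T _" n] by (intro AE_I2) (auto simp: D max_def, smt (verit))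
    qed measurable
    moreover have "(\<integral>x. D n x \<partial>M) \<ge> 0" for n
    proof -
      have "(\<integral>x. D n x \<partial>M) = (\<integral>x. ?F (Suc n) x \<partial>M) - (\<integral>x. ?F n (T x) \<partial>M)"
        unfolding D_def using integrable_max_sum[OF f] integrable_T[OF integrable_max_sum[OF f]]
        by (intro Bochner_Integration.integral_diff)
      also have "(\<integral>x. ?F n (T x) \<partial>M) = (\<integral>x. ?F n x \<partial>M)" by (intro integral_T) measurable
      finally have "(\<integral>x. D n x \<partial>M) = (\<integral>x. ?F (Suc n) x \<partial>M) - (\<integral>x. ?F n x \<partial>M)" .
      moreover have "(\<integral>x. ?F n x \<partial>M) \<le> (\<integral>x. ?F (Suc n) x \<partial>M)"
        by (intro integral_mono integrable_max_sum f max_sum_mono)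
      ultimately show ?thesis by simp
    qed
    ultimately show False using neg LIMSEQ_le_const[of _ "\<integral>x. f x \<partial>M" 0] by fastforce
  qed
  then have "emeasure M A = 0" using T_ergodic[OF A inv] by auto
  then have "AE x in M. x \<notin> A" using A by (intro AE_not_in) (auto simp: null_sets_def)
  then show ?thesis
    using AE_space
  proof eventually_elim
    fix x assume "x \<notin> A" "x \<in> space M"
    then obtain c where c: "\<And>n. ?F n x \<le> c" by (auto simp: A_iff not_less)
    have "(\<Sum>k<n. f ((T ^^ k) x)) \<le> max 0 c" for n
    proof (cases n)
      case (Suc m)
      then show ?thesis using sum_le_max_sum[of f x m] c[of m] by simp
    qed simp
    then show "\<exists>b. \<forall>n. (\<Sum>k<n. f ((T ^^ k) x)) \<le> b" by blast
  qed
qed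

text \<open>
  The upper half of Birkhoff's theorem in the ergodic case; the lower half is this statement
  for \<open>- f\<close>. It follows by centring \<open>f\<close> at a value strictly between its mean and \<open>c\<close>, which makes
  the sums bounded above.
\<close>

theorem AE_averages_less:
  fixes f :: "'a \<Rightarrow> real"
  assumes f: "integrable M f" and c: "(\<integral>x. f x \<partial>M) < c"
  shows "AE x in M. eventually (\<lambda>n. (\<Sum>k<n. f ((T ^^ k) x)) / real n < c) sequentially"
proof -
  obtain c' where c': "(\<integral>x. f x \<partial>M) < c'" "c' < c" using c dense by blast
  have "AE x in M. \<exists>b. \<forall>n. (\<Sum>k<n. f ((T ^^ k) x) - c') \<le> b"
    using f c' by (intro AE_sums_bounded[of "\<lambda>x. f x - c'"]) (auto simp: prob_space)
  then show ?thesis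
  proof eventually_elim
    fix x assume "\<exists>b. \<forall>n. (\<Sum>k<n. f ((T ^^ k) x) - c') \<le> b"
    then obtain b where b: "\<And>n. (\<Sum>k<n. f ((T ^^ k) x)) \<le> b + n * c'"
      by (auto simp: sum_subtractf algebra_simps)
    show "eventually (\<lambda>n. (\<Sum>k<n. f ((T ^^ k) x)) / real n < c) sequentially"
    proof (rule eventually_sequentiallyI[of "Suc (nat \<lceil>\<bar>b\<bar> / (c - c')\<rceil>)"])
      fix n assume n: "Suc (nat \<lceil>\<bar>b\<bar> / (c - c')\<rceil>) \<le> n"
      then have "real n > \<bar>b\<bar> / (c - c')" by linarith
      then have "\<bar>b\<bar> < real n * (c - c')" using c' by (simp add: pos_divide_less_eq)
      then have "(\<Sum>k<n. f ((T ^^ k) x)) < c * real n"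
        using b[of n] by (simp add: algebra_simps)
      then show "(\<Sum>k<n. f ((T ^^ k) x)) / real n < c"
        using n by (simp add: pos_divide_less_eq)
    qed
  qed
qed

text \<open>
  The \<open>n\<close>-th term is the difference of two consecutive sums, and their averages have the same limit.
\<close>

corollary AE_orbit_sublinear:
  fixes f :: "'a \<Rightarrow> real"
  assumes f: "integrable M f"
  shows "AE x in M. (\<lambda>n. f ((T ^^ n) x) / real n) \<longlonglongrightarrow> 0"
proof -
  let ?I = "\<integral>x. f x \<partial>M"
  let ?S = "\<lambda>x n. (\<Sum>k<n. f ((T ^^ k) x)) / real n"
  have 1: "AE x in M. \<forall>j::nat. eventually (\<lambda>n. ?S x n < ?I + 1 / Suc j) sequentially"
    unfolding AE_all_countable using f by (intro allI AE_averages_less) auto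
  have 2: "AE x in M. \<forall>j::nat. eventually (\<lambda>n. (\<Sum>k<n. - f ((T ^^ k) x)) / real n < - ?I + 1 / Suc j) sequentially"
    unfolding AE_all_countable using f by (intro allI AE_averages_less[of "\<lambda>x. - f x"]) auto
  from 1 2 show ?thesis
  proof eventually_elim
    fix x assume 1: "\<forall>j::nat. eventually (\<lambda>n. ?S x n < ?I + 1 / Suc j) sequentially"
      and 2: "\<forall>j::nat. eventually (\<lambda>n. (\<Sum>k<n. - f ((T ^^ k) x)) / real n < - ?I + 1 / Suc j) sequentially"
    have lim: "?S x \<longlonglongrightarrow> ?I"
    proof (rule tendstoI)
      fix e :: real assume "e > 0"
      then obtain j where j: "1 / Suc j < e" using nat_approx_posE by blast
      show "eventually (\<lambda>n. dist (?S x n) ?I < e) sequentially"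
        using 1[rule_format, of j] 2[rule_format, of j]
        by eventually_elim (use j in \<open>auto simp: dist_real_def sum_negf\<close>)
    qed
    have "(\<lambda>n. ?S x (Suc n) * (real (Suc n) / real n) - ?S x n) \<longlonglongrightarrow> ?I * 1 - ?I"
      by (intro tendsto_intros LIMSEQ_Suc lim LIMSEQ_Suc_n_over_n)
    moreover have "?S x (Suc n) * (real (Suc n) / real n) - ?S x n = f ((T ^^ n) x) / real n" for n
    proof (cases "n = 0")
      case False
      have "?S x (Suc n) * (real (Suc n) / real n) = (\<Sum>k<Suc n. f ((T ^^ k) x)) / real n"
        by (simp del: sum.lessThan_Suc)
      then show ?thesis by (simp add: add_divide_distrib del: of_nat_Suc)
    qed simp
    ultimately show "(\<lambda>n. f ((T ^^ n) x) / real n) \<longlonglongrightarrow> 0" by (simp del: of_nat_Suc)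
  qed
qed

end

section \<open>Two-sided paths\<close>

definition shift_by :: "int \<Rightarrow> (int \<Rightarrow> 'a) \<Rightarrow> int \<Rightarrow> 'a" where
  "shift_by j \<omega> = (\<lambda>k. \<omega> (k + j))"

lemma shift_by_apply [simp]: "shift_by j \<omega> k = \<omega> (k + j)"
  by (simp add: shift_by_def)

lemma shift_by_shift_by [simp]: "shift_by i (shift_by j \<omega>) = shift_by (i + j) \<omega>"
  by (auto simp: shift_by_def algebra_simps)

lemma shift_by_0 [simp]: "shift_by 0 = id"
  by (auto simp: shift_by_def)

lemma funpow_shift_by: "(shift_by j ^^ n) \<omega> = shift_by (int n * j) \<omega>"
  by (induction n) (auto simp: algebra_simps)

lemma space_paths: "space (paths M) = {\<omega>. \<forall>k. \<omega> k \<in> space M}"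
  by (auto simp: paths_def space_PiM)

lemma measurable_coordinate [measurable (raw)]: "(\<lambda>\<omega>. \<omega> k) \<in> paths M \<rightarrow>\<^sub>M M"
  unfolding paths_def by measurable

lemma measurable_pathsI:
  assumes "\<And>k. (\<lambda>x. f x k) \<in> N \<rightarrow>\<^sub>M M"
  shows "f \<in> N \<rightarrow>\<^sub>M paths M"
  unfolding paths_def
proof -
  have "(\<lambda>x k. f x k) \<in> space N \<rightarrow> (\<Pi>\<^sub>E i\<in>UNIV. space M)"
    using assms[THEN measurable_space] by (auto simp del: PiE_UNIV_domain intro!: PiE_I)
  then show "f \<in> N \<rightarrow>\<^sub>M PiM UNIV (\<lambda>_. M)"
    by (rule measurable_PiM_single'[of UNIV "\<lambda>k x. f x k" N "\<lambda>_. M", rotated]) (rule assms)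
qed

lemma measurable_shift_by [measurable]: "shift_by j \<in> paths M \<rightarrow>\<^sub>M paths M"
  by (rule measurable_pathsI) simp

lemma space_past [simp]: "space (past M k) = space (paths M)"
  by (simp add: past_def)

lemma measurable_past_restrict: "(\<lambda>\<omega>. restrict \<omega> {..k}) \<in> past M k \<rightarrow>\<^sub>M PiM {..k} (\<lambda>_. M)"
  unfolding past_def by (rule measurable_vimage_algebra1) (auto simp: space_paths space_PiM)

lemma measurable_past_coordinate:
  assumes "j \<le> k" shows "(\<lambda>\<omega>. \<omega> j) \<in> past M k \<rightarrow>\<^sub>M M"
proof -
  have "(\<lambda>f. f j) \<in> PiM {..k} (\<lambda>_. M) \<rightarrow>\<^sub>M M"
    using assms by (intro measurable_component_singleton) auto
  from measurable_compose[OF measurable_past_restrict this] assms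
  show ?thesis by (simp add: restrict_def)
qed

lemma measurable_to_past:
  assumes "\<And>j. j \<le> k \<Longrightarrow> (\<lambda>x. f x j) \<in> N \<rightarrow>\<^sub>M M" and "\<And>x. x \<in> space N \<Longrightarrow> f x \<in> space (paths M)"
  shows "f \<in> N \<rightarrow>\<^sub>M past M k"
  unfolding past_def using assms
  by (intro measurable_vimage_algebra2 measurable_restrict) auto

lemma sets_subset_if_identity_measurable:
  assumes "(\<lambda>x. x) \<in> M \<rightarrow>\<^sub>M N" and "space N = space M"
  shows "sets N \<subseteq> sets M"
proof
  fix A assume A: "A \<in> sets N"
  with assms(1) have "(\<lambda>x. x) -` A \<inter> space M \<in> sets M" by (rule measurable_sets)
  then show "A \<in> sets M" using sets.sets_into_space[OF A] assms(2) by (simp add: Int_absorb2)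
qed

lemma sets_past_subset: "sets (past M k) \<subseteq> sets (paths M)"
proof -
  have "(\<lambda>\<omega>. \<omega>) \<in> paths M \<rightarrow>\<^sub>M past M k" by (rule measurable_to_past) auto
  then show ?thesis by (rule sets_subset_if_identity_measurable) simp
qed

lemma sets_past_mono:
  assumes "k \<le> l" shows "sets (past M k) \<subseteq> sets (past M l)"
proof -
  have "(\<lambda>\<omega>. \<omega>) \<in> past M l \<rightarrow>\<^sub>M past M k"
    using assms by (intro measurable_to_past measurable_past_coordinate) auto
  then show ?thesis by (rule sets_subset_if_identity_measurable) simp
qed

lemma measurable_shift_by_past: "shift_by j \<in> past M (k + j) \<rightarrow>\<^sub>M past M k"
  by (rule measurable_to_past) (auto intro: measurable_past_coordinate simp: space_paths)

text \<open>
  The indicator of the event that the coordinates at times \<open>m, \<dots>, m + n - 1\<close> lie in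
  \<open>F 0, \<dots>, F (n - 1)\<close>. It is a product, rather than a set, so that its first factor can be split
  off under the integral.
\<close>

definition cylinder :: "(nat \<Rightarrow> 'a set) \<Rightarrow> nat \<Rightarrow> int \<Rightarrow> (int \<Rightarrow> 'a) \<Rightarrow> ennreal" where
  "cylinder F n m \<omega> = (\<Prod>i<n. indicator (F i) (\<omega> (m + int i)))"

lemma cylinder_Suc:
  "cylinder F (Suc n) m \<omega> = indicator (F 0) (\<omega> m) * cylinder (\<lambda>i. F (Suc i)) n (m + 1) \<omega>"
  unfolding cylinder_def by (subst prod.lessThan_Suc_shift) (simp add: algebra_simps)

lemma cylinder_shift_by: "cylinder F n m (shift_by j \<omega>) = cylinder F n (m + j) \<omega>"
  by (simp add: cylinder_def algebra_simps)

lemma measurable_cylinder [measurable]: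
  assumes [measurable]: "\<And>i. F i \<in> sets M"
  shows "cylinder F n m \<in> borel_measurable (paths M)"
  unfolding cylinder_def[abs_def] by measurable

lemma cylinder_le_1: "cylinder F n m \<omega> \<le> 1"
  unfolding cylinder_def by (rule prod_le_1) (auto simp: indicator_def)

text \<open>
  The generators of the product \<open>\<sigma>\<close>-field constrain a finite set of times; the times in between
  are filled with the whole space.
\<close>

lemma box_is_cylinder:
  fixes J :: "int set"
  assumes J: "finite J" and A: "\<And>i. i \<in> J \<Longrightarrow> A i \<in> sets M"
  shows "\<exists>F n m. (\<forall>i. F i \<in> sets M) \<and>
    (\<forall>\<omega>\<in>space (paths M). indicator (prod_emb UNIV (\<lambda>_. M) J (Pi\<^sub>E J A)) \<omega> = cylinder F n m \<omega>)"
proof -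
  \<comment> \<open>The time 0 is inserted so that the extrema also exist for empty \<open>J\<close>.\<close>
  define m where "m = Min (insert 0 J)"
  define n where "n = nat (Max (insert 0 J) - m + 1)"
  have J_sub: "\<exists>i<n. j = m + int i" if "j \<in> J" for j
  proof (intro exI conjI)
    have "m \<le> j" "j \<le> Max (insert 0 J)" using that J by (auto simp: m_def)
    then show "j = m + int (nat (j - m))" "nat (j - m) < n" by (auto simp: n_def)
  qed
  define F where "F i = (if m + int i \<in> J then A (m + int i) else space M)" for i
  have "F i \<in> sets M" for i using A by (auto simp: F_def)
  moreover have "indicator (prod_emb UNIV (\<lambda>_. M) J (Pi\<^sub>E J A)) \<omega> = cylinder F n m \<omega>"
    if "\<omega> \<in> space (paths M)" for \<omega>
  proof -
    have "\<omega> \<in> prod_emb UNIV (\<lambda>_. M) J (Pi\<^sub>E J A) \<longleftrightarrow> (\<forall>j\<in>J. \<omega> j \<in> A j)"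
      using that by (auto simp: prod_emb_def space_paths PiE_iff)
    also have "\<dots> \<longleftrightarrow> (\<forall>i<n. \<omega> (m + int i) \<in> F i)"
      using that J_sub by (fastforce simp: F_def space_paths)
    finally have *: "\<omega> \<in> prod_emb UNIV (\<lambda>_. M) J (Pi\<^sub>E J A) \<longleftrightarrow> (\<forall>i<n. \<omega> (m + int i) \<in> F i)" .
    show ?thesis
    proof (cases "\<forall>i<n. \<omega> (m + int i) \<in> F i")
      case True then show ?thesis using * by (simp add: cylinder_def)
    next
      case False
      then obtain i where "i < n" "\<omega> (m + int i) \<notin> F i" by blast
      then have "cylinder F n m \<omega> = 0"
        unfolding cylinder_def by (intro prod_zero bexI[of _ i]) auto
      then show ?thesis using False * by simp
    qed
  qed
  ultimately show ?thesis by blast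
qed

lemma measure_eq_by_cylinders:
  assumes sets: "sets P1 = sets (paths M)" "sets P2 = sets (paths M)" and fin: "finite_measure P1"
    and eq: "\<And>F n m. (\<And>i. F i \<in> sets M) \<Longrightarrow>
      (\<integral>\<^sup>+\<omega>. cylinder F n m \<omega> \<partial>P1) = (\<integral>\<^sup>+\<omega>. cylinder F n m \<omega> \<partial>P2)"
  shows "P1 = P2"
proof (rule measure_eqI_PiM_infinite)
  show "sets P1 = sets (PiM UNIV (\<lambda>_. M))" "sets P2 = sets (PiM UNIV (\<lambda>_. M))"
    using sets by (auto simp: paths_def)
  fix A and J :: "int set" assume J: "finite J" "\<And>i. i \<in> J \<Longrightarrow> A i \<in> sets M"
  let ?B = "prod_emb UNIV (\<lambda>_. M) J (Pi\<^sub>E J A)"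
  have B: "?B \<in> sets (paths M)" unfolding paths_def by (rule sets_PiM_I) (use J in auto)
  obtain F n m where F: "\<And>i. F i \<in> sets M"
    and B_eq: "\<And>\<omega>. \<omega> \<in> space (paths M) \<Longrightarrow> indicator ?B \<omega> = cylinder F n m \<omega>"
    using box_is_cylinder[of J A M] J by blast
  have "emeasure R ?B = (\<integral>\<^sup>+\<omega>. cylinder F n m \<omega> \<partial>R)" if "sets R = sets (paths M)" for R
  proof -
    have "emeasure R ?B = (\<integral>\<^sup>+\<omega>. indicator ?B \<omega> \<partial>R)"
      using B that by (simp only: nn_integral_indicator)
    also have "\<dots> = (\<integral>\<^sup>+\<omega>. cylinder F n m \<omega> \<partial>R)"
      using sets_eq_imp_space_eq[OF that] by (intro nn_integral_cong B_eq) simp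
    finally show ?thesis .
  qed
  then show "emeasure P1 ?B = emeasure P2 ?B" using sets eq[OF F] by simp
qed fact

section \<open>Ergodicity of the stationary chain\<close>

locale stationary_markov =
  fixes M :: "'a measure" and K :: "'a \<Rightarrow> 'a measure" and \<pi> and P :: "(int \<Rightarrow> 'a) measure"
  assumes K_measurable: "K \<in> M \<rightarrow>\<^sub>M prob_algebra M"
    and chain_law: "stationary_chain_law M K \<pi> P"
begin

lemma K_subprob [measurable]: "K \<in> M \<rightarrow>\<^sub>M subprob_algebra M"
  using K_measurable by (rule measurable_prob_algebraD)

lemma sets_P [simp, measurable_cong]: "sets P = sets (paths M)"
  using chain_law by (simp add: stationary_chain_law_def space_prob_algebra)

lemma space_P [simp]: "space P = space (paths M)"
  by (rule sets_eq_imp_space_eq) simp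

lemma marginal: "distr P M (\<lambda>\<omega>. \<omega> k) = \<pi>"
  using chain_law by (simp add: stationary_chain_law_def)

sublocale prob_space P
  using chain_law by (simp add: stationary_chain_law_def space_prob_algebra)

lemma past_events: "C \<in> sets (past M k) \<Longrightarrow> C \<in> sets (paths M)"
  using sets_past_subset by blast

lemma sigma_finite_past: "sigma_finite_subalgebra P (past M k)"
  by (intro finite_measure_subalgebra_is_sigma_finite
      finite_measure_subalgebra.intro finite_measure_subalgebra_axioms.intro finite_measure_axioms)
    (auto simp: subalgebra_def past_events)

lemma nn_integral_marginal: "f \<in> borel_measurable M \<Longrightarrow> (\<integral>\<^sup>+\<omega>. f (\<omega> k) \<partial>P) = (\<integral>\<^sup>+s. f s \<partial>\<pi>)"
  by (subst marginal[symmetric, of k], subst nn_integral_distr) auto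

lemma markov_event:
  assumes C: "C \<in> sets (past M m)" and A [measurable]: "A \<in> sets M"
  shows "(\<integral>\<^sup>+\<omega>. indicator C \<omega> * indicator A (\<omega> (m + 1)) \<partial>P) =
    (\<integral>\<^sup>+\<omega>. indicator C \<omega> * emeasure (K (\<omega> m)) A \<partial>P)"
proof -
  interpret sigma_finite_subalgebra P "past M m" by (rule sigma_finite_past)
  let ?E = "{\<omega> \<in> space P. \<omega> (m + 1) \<in> A}"
  have "(\<integral>\<^sup>+\<omega>. indicator C \<omega> * indicator A (\<omega> (m + 1)) \<partial>P) = (\<integral>\<^sup>+\<omega>. indicator C \<omega> * indicator ?E \<omega> \<partial>P)"
    by (intro nn_integral_cong) (auto simp: indicator_def)
  also have "\<dots> = (\<integral>\<^sup>+\<omega>. indicator C \<omega> * nn_cond_exp P (past M m) (indicator ?E) \<omega> \<partial>P)"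
    using C by (intro nn_cond_exp_intg[symmetric]) (auto intro!: borel_measurable_indicator)
  also have "\<dots> = (\<integral>\<^sup>+\<omega>. indicator C \<omega> * emeasure (K (\<omega> m)) A \<partial>P)"
  proof (rule nn_integral_cong_AE)
    have "AE \<omega> in P. nn_cond_exp P (past M m) (indicator ?E) \<omega> = emeasure (K (\<omega> m)) A"
      using chain_law A unfolding stationary_chain_law_def by blast
    then show "AE \<omega> in P. indicator C \<omega> * nn_cond_exp P (past M m) (indicator ?E) \<omega>
        = indicator C \<omega> * emeasure (K (\<omega> m)) A"
      by eventually_elim simp
  qed
  finally show ?thesis .
qed

text \<open>
  The Markov property for events says that the law of \<open>\<omega> (m + 1)\<close> on \<open>C\<close> is the law of
  \<open>\<omega> m\<close> on \<open>C\<close> composed with the kernel; integrating \<open>f\<close> against both gives the claim.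
\<close>

lemma markov_fun:
  assumes C: "C \<in> sets (past M m)" and f [measurable]: "f \<in> borel_measurable M"
  shows "(\<integral>\<^sup>+\<omega>. indicator C \<omega> * f (\<omega> (m + 1)) \<partial>P) = (\<integral>\<^sup>+\<omega>. indicator C \<omega> * (\<integral>\<^sup>+s. f s \<partial>K (\<omega> m)) \<partial>P)"
proof -
  have [measurable]: "C \<in> sets (paths M)" using C by (rule past_events)
  define D where "D = density P (indicator C)"
  have D [simp, measurable_cong]: "sets D = sets (paths M)" and [simp]: "space D = space (paths M)"
    by (auto simp: D_def)
  have "distr D M (\<lambda>\<omega>. \<omega> (m + 1)) = distr D M (\<lambda>\<omega>. \<omega> m) \<bind> K"
  proof (rule measure_eqI)
    have ne: "space (distr D M (\<lambda>\<omega>. \<omega> m)) \<noteq> {}"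
      using not_empty by (auto simp: space_paths)
    show "sets (distr D M (\<lambda>\<omega>. \<omega> (m + 1))) = sets (distr D M (\<lambda>\<omega>. \<omega> m) \<bind> K)"
      using ne by (subst sets_bind[where N=M]) (auto simp: sets_kernel[OF K_subprob])
    fix A assume "A \<in> sets (distr D M (\<lambda>\<omega>. \<omega> (m + 1)))"
    then have A [measurable]: "A \<in> sets M" by simp
    have "emeasure (distr D M (\<lambda>\<omega>. \<omega> (m + 1))) A = (\<integral>\<^sup>+s. indicator A s \<partial>distr D M (\<lambda>\<omega>. \<omega> (m + 1)))"
      by simp
    also have "\<dots> = (\<integral>\<^sup>+\<omega>. indicator C \<omega> * indicator A (\<omega> (m + 1)) \<partial>P)"
      by (subst nn_integral_distr) (auto simp: D_def nn_integral_density)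
    also have "\<dots> = (\<integral>\<^sup>+\<omega>. indicator C \<omega> * emeasure (K (\<omega> m)) A \<partial>P)" by (rule markov_event[OF C A])
    also have "\<dots> = (\<integral>\<^sup>+s. emeasure (K s) A \<partial>distr D M (\<lambda>\<omega>. \<omega> m))"
      by (subst nn_integral_distr) (auto simp: D_def nn_integral_density)
    also have "\<dots> = emeasure (distr D M (\<lambda>\<omega>. \<omega> m) \<bind> K) A"
      using ne by (intro emeasure_bind[symmetric, where N=M]) auto
    finally show "emeasure (distr D M (\<lambda>\<omega>. \<omega> (m + 1))) A = emeasure (distr D M (\<lambda>\<omega>. \<omega> m) \<bind> K) A" .
  qed
  then have "(\<integral>\<^sup>+s. f s \<partial>distr D M (\<lambda>\<omega>. \<omega> (m + 1))) = (\<integral>\<^sup>+s. f s \<partial>(distr D M (\<lambda>\<omega>. \<omega> m) \<bind> K))" by simp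
  also have "\<dots> = (\<integral>\<^sup>+s. (\<integral>\<^sup>+t. f t \<partial>K s) \<partial>distr D M (\<lambda>\<omega>. \<omega> m))"
    by (rule nn_integral_bind[where B=M]) auto
  finally show ?thesis
    by (simp add: nn_integral_distr D_def nn_integral_density)
qed

text \<open>
  The probability that the chain started at \<open>s\<close> passes through \<open>F 0, \<dots>, F (n - 1)\<close>, where \<open>F 0\<close>
  constrains the starting point itself.
\<close>

primrec cylinder_prob :: "nat \<Rightarrow> (nat \<Rightarrow> 'a set) \<Rightarrow> 'a \<Rightarrow> ennreal" where
  "cylinder_prob 0 F s = 1"
| "cylinder_prob (Suc n) F s = indicator (F 0) s * (\<integral>\<^sup>+t. cylinder_prob n (\<lambda>i. F (Suc i)) t \<partial>K s)"

lemma measurable_cylinder_prob [measurable]: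
  assumes "\<And>i. F i \<in> sets M" shows "cylinder_prob n F \<in> borel_measurable M"
  using assms
proof (induction n arbitrary: F)
  case (Suc n)
  have [measurable]: "cylinder_prob n (\<lambda>i. F (Suc i)) \<in> borel_measurable M" "F 0 \<in> sets M"
    using Suc by auto
  have "(\<lambda>s. indicator (F 0) s * (\<integral>\<^sup>+t. cylinder_prob n (\<lambda>i. F (Suc i)) t \<partial>K s)) \<in> borel_measurable M"
    by measurable
  then show ?case by simp
next
  case 0
  have "cylinder_prob 0 F = (\<lambda>_. 1)" by auto
  then show ?case by simp
qed

lemma cylinder_prob_le_1: "s \<in> space M \<Longrightarrow> cylinder_prob n F s \<le> 1"
proof (induction n arbitrary: F s)
  case (Suc n)
  have "K s \<in> space (prob_algebra M)" using K_measurable Suc.prems by (rule measurable_space)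
  then interpret Ks: prob_space "K s" by (simp add: space_prob_algebra)
  have "space (K s) = space M"
    using \<open>K s \<in> space (prob_algebra M)\<close> by (intro sets_eq_imp_space_eq) (auto simp: space_prob_algebra)
  then have "(\<integral>\<^sup>+t. cylinder_prob n (\<lambda>i. F (Suc i)) t \<partial>K s) \<le> (\<integral>\<^sup>+t. 1 \<partial>K s)"
    using Suc.IH by (intro nn_integral_mono) auto
  then show ?case by (auto simp: Ks.emeasure_space_1 indicator_def)
qed simp

lemma cylinder_given_past:
  assumes "C \<in> sets (past M m)" and "\<And>i. F i \<in> sets M"
  shows "(\<integral>\<^sup>+\<omega>. indicator C \<omega> * cylinder F n m \<omega> \<partial>P) =
    (\<integral>\<^sup>+\<omega>. indicator C \<omega> * cylinder_prob n F (\<omega> m) \<partial>P)"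
  using assms
proof (induction n arbitrary: F m C)
  case 0 then show ?case by (simp add: cylinder_def)
next
  case (Suc n)
  let ?F = "\<lambda>i. F (Suc i)"
  have F: "\<And>i. ?F i \<in> sets M" and F0: "F 0 \<in> sets M" using Suc.prems by auto
  define C' where "C' = C \<inter> ((\<lambda>\<omega>. \<omega> m) -` F 0 \<inter> space (past M m))"
  have C': "C' \<in> sets (past M m)"
    unfolding C'_def using Suc.prems(1) measurable_sets[OF measurable_past_coordinate[of m m] F0] by auto
  have ind: "indicator C' \<omega> = (indicator C \<omega> * indicator (F 0) (\<omega> m) :: ennreal)" if "\<omega> \<in> space (paths M)" for \<omega>
    using that by (auto simp: indicator_def C'_def)
  have "(\<integral>\<^sup>+\<omega>. indicator C \<omega> * cylinder F (Suc n) m \<omega> \<partial>P)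
      = (\<integral>\<^sup>+\<omega>. indicator C' \<omega> * cylinder ?F n (m + 1) \<omega> \<partial>P)"
    by (intro nn_integral_cong) (simp add: cylinder_Suc ind mult.assoc)
  also have "\<dots> = (\<integral>\<^sup>+\<omega>. indicator C' \<omega> * cylinder_prob n ?F (\<omega> (m + 1)) \<partial>P)"
    by (rule Suc.IH) (use C' sets_past_mono[of m "m + 1" M] F in auto)
  also have "\<dots> = (\<integral>\<^sup>+\<omega>. indicator C' \<omega> * (\<integral>\<^sup>+t. cylinder_prob n ?F t \<partial>K (\<omega> m)) \<partial>P)"
    using C' F by (intro markov_fun) auto
  also have "\<dots> = (\<integral>\<^sup>+\<omega>. indicator C \<omega> * cylinder_prob (Suc n) F (\<omega> m) \<partial>P)"
    by (intro nn_integral_cong) (simp add: ind mult.assoc)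
  finally show ?case .
qed

lemma cylinder_marginal:
  assumes "\<And>i. F i \<in> sets M"
  shows "(\<integral>\<^sup>+\<omega>. cylinder F n m \<omega> \<partial>P) = (\<integral>\<^sup>+s. cylinder_prob n F s \<partial>\<pi>)"
proof -
  have "(\<integral>\<^sup>+\<omega>. cylinder F n m \<omega> \<partial>P) = (\<integral>\<^sup>+\<omega>. indicator (space (past M m)) \<omega> * cylinder F n m \<omega> \<partial>P)"
    by (intro nn_integral_cong) auto
  also have "\<dots> = (\<integral>\<^sup>+\<omega>. indicator (space (past M m)) \<omega> * cylinder_prob n F (\<omega> m) \<partial>P)"
    by (rule cylinder_given_past[OF sets.top assms])
  also have "\<dots> = (\<integral>\<^sup>+\<omega>. cylinder_prob n F (\<omega> m) \<partial>P)"
    by (intro nn_integral_cong) auto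
  finally show ?thesis using assms by (simp add: nn_integral_marginal)
qed

lemma shift_invariant: "distr P (paths M) (shift_by j) = P"
proof (rule measure_eq_by_cylinders[where M=M])
  show "finite_measure (distr P (paths M) (shift_by j))"
    by (intro prob_space.finite_measure prob_space_distr) simp
  fix F :: "nat \<Rightarrow> 'a set" and n m assume F [measurable]: "\<And>i. F i \<in> sets M"
  show "(\<integral>\<^sup>+\<omega>. cylinder F n m \<omega> \<partial>distr P (paths M) (shift_by j)) = (\<integral>\<^sup>+\<omega>. cylinder F n m \<omega> \<partial>P)"
    by (subst nn_integral_distr) (auto simp: cylinder_shift_by cylinder_marginal F)
qed auto

text \<open>
  The events approximable in this sense form a \<open>\<sigma>\<close>-field that contains all coordinate events:
  a countable union is first approximated by a finite one, and the \<open>\<sigma>\<close>-fields \<open>past M k\<close> increase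
  with \<open>k\<close>.
\<close>

lemma approximable_by_past:
  assumes "A \<in> sets (paths M)" "e > 0"
  shows "\<exists>k. \<exists>C\<in>sets (past M k). measure P ((A - C) \<union> (C - A)) < e"
proof -
  let ?\<Omega> = "\<Pi>\<^sub>E i\<in>UNIV. space M"
  have \<Omega>: "?\<Omega> = space (paths M)" by (auto simp: space_paths)
  have "A \<in> sigma_sets ?\<Omega> {{f\<in>?\<Omega>. f i \<in> A} | i A. i \<in> UNIV \<and> A \<in> sets M}"
    using assms(1) unfolding paths_def sets_PiM_single .
  then show ?thesis using assms(2)
  proof (induction arbitrary: e)
    case (Basic a)
    then obtain i B where a: "a = {f\<in>?\<Omega>. f i \<in> B}" "B \<in> sets M" by blast
    then have "a = (\<lambda>\<omega>. \<omega> i) -` B \<inter> space (past M i)" by (auto simp: \<Omega>)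
    then have "a \<in> sets (past M i)" using measurable_sets[OF measurable_past_coordinate[of i i M]] a by auto
    then show ?case using \<open>0 < e\<close> by (intro exI[of _ i] bexI[of _ a]) auto
  next
    case Empty
    then show ?case by (intro exI[of _ 0] bexI[of _ "{}"]) auto
  next
    case (Compl a)
    then obtain k C where C: "C \<in> sets (past M k)" "measure P ((a - C) \<union> (C - a)) < e" by blast
    have a: "a \<subseteq> space (paths M)" using Compl.hyps sigma_sets_into_sp[OF _ Compl.hyps] by (auto simp: \<Omega>)
    have "C \<subseteq> space (paths M)" using sets.sets_into_space[OF C(1)] by simp
    then have "((?\<Omega> - a) - (space (past M k) - C)) \<union> ((space (past M k) - C) - (?\<Omega> - a)) = (a - C) \<union> (C - a)"
      using a by (auto simp: \<Omega>)
    then show ?case using C sets.compl_sets[OF C(1)]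
      by (intro exI[of _ k] bexI[of _ "space (past M k) - C"]) simp_all
  next
    case (Union a)
    have a [measurable]: "a i \<in> sets (paths M)" for i
      using Union.hyps[of i] unfolding paths_def sets_PiM_single .
    have "(\<lambda>n. measure P (\<Union>i<n. a i)) \<longlonglongrightarrow> measure P (\<Union>n. \<Union>i<n. a i)"
    proof (rule finite_Lim_measure_incseq)
      show "range (\<lambda>n. \<Union>i<n. a i) \<subseteq> events" using a by (intro image_subsetI sets.finite_UN) auto
      show "incseq (\<lambda>n. \<Union>i<n. a i)" by (intro monoI UN_mono) auto
    qed
    also have "(\<Union>n. \<Union>i<n. a i) = (\<Union>i. a i)" by (auto simp: set_eq_iff)
    finally have "eventually (\<lambda>n. dist (measure P (\<Union>i<n. a i)) (measure P (\<Union>i. a i)) < e / 2) sequentially"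
      using \<open>0 < e\<close> by (intro tendstoD) auto
    then obtain n where "dist (measure P (\<Union>i<n. a i)) (measure P (\<Union>i. a i)) < e / 2"
      by (auto simp: eventually_sequentially)
    then have tail: "measure P ((\<Union>i. a i) - (\<Union>i<n. a i)) < e / 2"
      by (subst finite_measure_Diff) (auto simp: dist_real_def abs_if split: if_splits)
    have "\<forall>i. \<exists>k C. C \<in> sets (past M k) \<and> measure P ((a i - C) \<union> (C - a i)) < e / (2 * (n + 1))"
      using Union.IH \<open>0 < e\<close> by (auto simp: Bex_def)
    then obtain k C where C: "\<And>i. C i \<in> sets (past M (k i))"
      and approx: "\<And>i. measure P ((a i - C i) \<union> (C i - a i)) < e / (2 * (n + 1))"
      by metis
    have [measurable]: "C i \<in> sets (paths M)" for i using past_events[OF C] by simp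
    define k' where "k' = Max (k ` {..<Suc n})"
    have "C i \<in> sets (past M k')" if "i < n" for i
      using C[of i] sets_past_mono[of "k i" k' M] that by (auto simp: k'_def)
    then have CU: "(\<Union>i<n. C i) \<in> sets (past M k')" by auto
    have "measure P (((\<Union>i. a i) - (\<Union>i<n. C i)) \<union> ((\<Union>i<n. C i) - (\<Union>i. a i)))
        \<le> measure P (((\<Union>i. a i) - (\<Union>i<n. a i)) \<union> (\<Union>i<n. (a i - C i) \<union> (C i - a i)))"
      by (intro finite_measure_mono) auto
    also have "\<dots> \<le> measure P ((\<Union>i. a i) - (\<Union>i<n. a i)) + measure P (\<Union>i<n. (a i - C i) \<union> (C i - a i))"
      by (intro measure_Un_le) auto
    also have "measure P (\<Union>i<n. (a i - C i) \<union> (C i - a i)) \<le> (\<Sum>i<n. measure P ((a i - C i) \<union> (C i - a i)))"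
      by (intro finite_measure_subadditive_finite) auto
    also have "\<dots> \<le> (\<Sum>i<n. e / (2 * (n + 1)))"
      using approx by (intro sum_mono less_imp_le)
    also have "\<dots> \<le> e / 2" using \<open>0 < e\<close> by (simp add: field_simps)
    finally have "measure P (((\<Union>i. a i) - (\<Union>i<n. C i)) \<union> ((\<Union>i<n. C i) - (\<Union>i. a i))) < e"
      using tail by linarith
    then show ?case using CU by blast
  qed
qed

lemma shift_by_invariant_event:
  assumes B: "B \<in> sets (paths M)" and inv: "shift_by 1 -` B \<inter> space P = B"
  shows "shift_by j -` B \<inter> space P = B"
proof -
  have iff: "\<omega> \<in> B \<longleftrightarrow> shift_by 1 \<omega> \<in> B" if "\<omega> \<in> space P" for \<omega>
    using inv that by auto
  have sp: "shift_by i \<omega> \<in> space P" if "\<omega> \<in> space P" for i \<omega>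
    using that by (auto simp: space_paths)
  have nat: "shift_by (int n) \<omega> \<in> B \<longleftrightarrow> \<omega> \<in> B" if "\<omega> \<in> space P" for n \<omega>
  proof (induction n)
    case (Suc n)
    moreover have "shift_by 1 (shift_by (int n) \<omega>) = shift_by (int (Suc n)) \<omega>"
      by (simp only: shift_by_shift_by) (simp only: of_nat_Suc)
    ultimately show ?case using iff[OF sp[OF that], of "int n"] by metis
  qed simp
  have "shift_by j \<omega> \<in> B \<longleftrightarrow> \<omega> \<in> B" if "\<omega> \<in> space P" for \<omega>
  proof (cases "j \<ge> 0")
    case True then show ?thesis using nat[OF that, of "nat j"] by simp
  next
    case False 
    then have "shift_by (int (nat (- j))) (shift_by j \<omega>) = \<omega>" by simp
    then show ?thesis using nat[OF sp[OF that, of j], of "nat (- j)"] by metis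
  qed
  then show ?thesis using sets.sets_into_space[OF B] by auto
qed

text \<open>
  Shifting a past event moves it to an earlier past, while the invariant event and the measure stay
  where they are. Hence the time up to which the approximating event looks can be prescribed.
\<close>

lemma invariant_event_approximable:
  assumes B: "B \<in> sets (paths M)" and inv: "shift_by 1 -` B \<inter> space P = B" and e: "e > 0"
  shows "\<exists>C\<in>sets (past M m). measure P ((B - C) \<union> (C - B)) < e"
proof -
  obtain k C where C: "C \<in> sets (past M k)" and approx: "measure P ((B - C) \<union> (C - B)) < e"
    using approximable_by_past[OF B e] by blast
  define j where "j = m - k"
  let ?C = "shift_by j -` C \<inter> space (past M (k + j))"
  have [measurable]: "B \<in> sets (paths M)" "C \<in> sets (paths M)" using B past_events[OF C] by auto
  have "?C \<in> sets (past M (k + j))" using measurable_shift_by_past C by (rule measurable_sets)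
  moreover have "measure P ((B - ?C) \<union> (?C - B)) = measure P ((B - C) \<union> (C - B))"
  proof -
    have "measure P ((B - C) \<union> (C - B)) = measure (distr P (paths M) (shift_by j)) ((B - C) \<union> (C - B))"
      by (simp add: shift_invariant)
    also have "\<dots> = measure P (shift_by j -` ((B - C) \<union> (C - B)) \<inter> space P)"
      by (rule measure_distr) auto
    also have "shift_by j -` ((B - C) \<union> (C - B)) \<inter> space P = (B - ?C) \<union> (?C - B)"
      using shift_by_invariant_event[OF B inv, of j] sets.sets_into_space[OF B] by auto
    finally show ?thesis ..
  qed
  ultimately show ?thesis using approx by (intro bexI[of _ ?C]) (simp_all add: j_def)
qed

lemma nn_integral_indicator_approx:
  assumes [measurable]: "A \<in> sets (paths M)" "C \<in> sets (paths M)" "X \<in> borel_measurable P" and "\<And>\<omega>. \<omega> \<in> space P \<Longrightarrow> X \<omega> \<le> 1"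
  shows "(\<integral>\<^sup>+\<omega>. indicator A \<omega> * X \<omega> \<partial>P)
    \<le> (\<integral>\<^sup>+\<omega>. indicator C \<omega> * X \<omega> \<partial>P) + emeasure P ((A - C) \<union> (C - A))"
proof -
  have "(\<integral>\<^sup>+\<omega>. indicator A \<omega> * X \<omega> \<partial>P)
      \<le> (\<integral>\<^sup>+\<omega>. indicator C \<omega> * X \<omega> + indicator ((A - C) \<union> (C - A)) \<omega> \<partial>P)"
    using assms by (intro nn_integral_mono) (auto simp: indicator_def)
  also have "\<dots> = (\<integral>\<^sup>+\<omega>. indicator C \<omega> * X \<omega> \<partial>P) + emeasure P ((A - C) \<union> (C - A))"
    by (subst nn_integral_add) auto
  finally show ?thesis .
qed

text \<open>
  Approximating \<open>B\<close> by events from the past of \<open>m\<close> extends \<open>cylinder_given_past\<close> to \<open>B\<close>: knowing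
  the invariant event does not change the transition probabilities.
\<close>

lemma cylinder_given_invariant_event:
  assumes B: "B \<in> sets (paths M)" and inv: "shift_by 1 -` B \<inter> space P = B" and F [measurable]: "\<And>i. F i \<in> sets M"
  shows "(\<integral>\<^sup>+\<omega>. indicator B \<omega> * cylinder F n m \<omega> \<partial>P) =
    (\<integral>\<^sup>+\<omega>. indicator B \<omega> * cylinder_prob n F (\<omega> m) \<partial>P)"
proof -
  let ?X = "cylinder F n m" and ?h = "\<lambda>\<omega>. cylinder_prob n F (\<omega> m)"
  have X: "?X \<in> borel_measurable P" "?h \<in> borel_measurable P" by (auto simp: measurable_cylinder F)
  have le: "?X \<omega> \<le> 1" "?h \<omega> \<le> 1" if "\<omega> \<in> space P" for \<omega>
    using that by (auto simp: cylinder_le_1 space_paths intro: cylinder_prob_le_1)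
  have "(\<integral>\<^sup>+\<omega>. indicator B \<omega> * U \<omega> \<partial>P) \<le> (\<integral>\<^sup>+\<omega>. indicator B \<omega> * V \<omega> \<partial>P)"
    if U: "U \<in> borel_measurable P" "\<And>\<omega>. \<omega> \<in> space P \<Longrightarrow> U \<omega> \<le> 1"
      and V: "V \<in> borel_measurable P" "\<And>\<omega>. \<omega> \<in> space P \<Longrightarrow> V \<omega> \<le> 1"
      and eq: "\<And>C. C \<in> sets (past M m) \<Longrightarrow>
          (\<integral>\<^sup>+\<omega>. indicator C \<omega> * U \<omega> \<partial>P) = (\<integral>\<^sup>+\<omega>. indicator C \<omega> * V \<omega> \<partial>P)" for U V
  proof (rule ennreal_le_epsilon)
    fix e :: real assume e: "e > 0"
    then obtain C where C: "C \<in> sets (past M m)" and "measure P ((B - C) \<union> (C - B)) < e / 2"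
      using invariant_event_approximable[OF B inv, of "e / 2" m] by auto
    then have small: "emeasure P ((B - C) \<union> (C - B)) \<le> ennreal (e / 2)"
      by (simp add: emeasure_eq_measure ennreal_leI)
    have [measurable]: "B \<in> sets (paths M)" "C \<in> sets (paths M)" using B past_events[OF C] by auto
    have "(\<integral>\<^sup>+\<omega>. indicator B \<omega> * U \<omega> \<partial>P)
        \<le> (\<integral>\<^sup>+\<omega>. indicator C \<omega> * U \<omega> \<partial>P) + emeasure P ((B - C) \<union> (C - B))"
      by (rule nn_integral_indicator_approx) (use U in auto)
    also have "\<dots> = (\<integral>\<^sup>+\<omega>. indicator C \<omega> * V \<omega> \<partial>P) + emeasure P ((B - C) \<union> (C - B))"
      by (simp add: eq[OF C])
    also have "\<dots> \<le> (\<integral>\<^sup>+\<omega>. indicator B \<omega> * V \<omega> \<partial>P) + emeasure P ((C - B) \<union> (B - C)) + emeasure P ((B - C) \<union> (C - B))"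
      by (intro add_right_mono nn_integral_indicator_approx) (use V in auto)
    also have "\<dots> \<le> (\<integral>\<^sup>+\<omega>. indicator B \<omega> * V \<omega> \<partial>P) + ennreal (e / 2) + ennreal (e / 2)"
      using small by (intro add_mono) (auto simp: Un_commute)
    also have "\<dots> = (\<integral>\<^sup>+\<omega>. indicator B \<omega> * V \<omega> \<partial>P) + ennreal e"
      using e by (simp add: add.assoc flip: ennreal_plus)
    finally show "(\<integral>\<^sup>+\<omega>. indicator B \<omega> * U \<omega> \<partial>P) \<le> (\<integral>\<^sup>+\<omega>. indicator B \<omega> * V \<omega> \<partial>P) + ennreal e" .
  qed
  from this[of ?X ?h] this[of ?h ?X] show ?thesis
    using X le cylinder_given_past F by (intro antisym) auto
qed

text \<open>
  Conditioned on \<open>B\<close>, the chain keeps its kernel, by \<open>cylinder_given_invariant_event\<close> for a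
  cylinder of length 2, and it keeps its shift invariance.
\<close>

lemma uniform_marginal_stationary:
  assumes B: "B \<in> sets (paths M)" and inv: "shift_by 1 -` B \<inter> space P = B" and pos: "emeasure P B \<noteq> 0"
  shows "stationary_distribution M K (distr (uniform_measure P B) M (\<lambda>\<omega>. \<omega> m))"
proof -
  have [measurable]: "B \<in> sets (paths M)" by fact
  let ?U = "uniform_measure P B"
  interpret U: prob_space ?U
    using pos by (intro prob_space_uniform_measure) auto
  let ?D = "distr ?U M (\<lambda>\<omega>. \<omega> m)"
  have prob: "?D \<in> space (prob_algebra M)"
    by (auto simp: space_prob_algebra intro!: U.prob_space_distr)
  have "?D \<bind> K = ?D"
  proof (rule measure_eqI)
    show sets: "sets (?D \<bind> K) = sets ?D"
      by (subst sets_bind[where N=M]) (use not_empty in \<open>auto simp: sets_kernel[OF K_subprob] space_paths\<close>)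
    fix A assume "A \<in> sets (?D \<bind> K)"
    then have A [measurable]: "A \<in> sets M" using sets by simp
    define F where "F i = (if i = 0 then space M else A)" for i :: nat
    have F: "F i \<in> sets M" for i by (simp add: F_def)
    have K_A: "emeasure (K s) A = cylinder_prob 2 F s" if "s \<in> space M" for s
    proof -
      have "K s \<in> space (prob_algebra M)" using K_measurable that by (rule measurable_space)
      then have 1: "prob_space (K s)" and 2: "sets (K s) = sets M" by (auto simp: space_prob_algebra)
      have "(\<integral>\<^sup>+t. indicator A t * (\<integral>\<^sup>+u. 1 \<partial>K t) \<partial>K s) = (\<integral>\<^sup>+t. indicator A t \<partial>K s)"
      proof (rule nn_integral_cong)
        fix t assume "t \<in> space (K s)"
        then have "t \<in> space M" using 2 sets_eq_imp_space_eq by blast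
        then have "K t \<in> space (prob_algebra M)" using K_measurable by (rule measurable_space[rotated])
        then have "emeasure (K t) (space (K t)) = 1" by (auto simp: space_prob_algebra prob_space.emeasure_space_1)
        then show "indicator A t * (\<integral>\<^sup>+u. 1 \<partial>K t) = (indicator A t :: ennreal)" by simp
      qed
      then show ?thesis using 2 that by (simp add: numeral_2_eq_2 F_def)
    qed
    have "emeasure (?D \<bind> K) A = (\<integral>\<^sup>+s. emeasure (K s) A \<partial>?D)"
      by (rule emeasure_bind_prob_algebra[OF prob K_measurable A])
    also have "\<dots> = (\<integral>\<^sup>+\<omega>. emeasure (K (\<omega> m)) A \<partial>?U)"
      by (subst nn_integral_distr) auto
    also have "\<dots> = (\<integral>\<^sup>+\<omega>. emeasure (K (\<omega> m)) A * indicator B \<omega> \<partial>P) / emeasure P B"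
      by (rule nn_integral_uniform_measure) auto
    also have "(\<integral>\<^sup>+\<omega>. emeasure (K (\<omega> m)) A * indicator B \<omega> \<partial>P)
        = (\<integral>\<^sup>+\<omega>. indicator B \<omega> * cylinder_prob 2 F (\<omega> m) \<partial>P)"
      by (intro nn_integral_cong) (auto simp: K_A space_paths mult.commute)
    also have "\<dots> = (\<integral>\<^sup>+\<omega>. indicator B \<omega> * cylinder F 2 m \<omega> \<partial>P)"
      by (rule cylinder_given_invariant_event[OF B inv F, symmetric])
    also have "\<dots> = (\<integral>\<^sup>+\<omega>. indicator B \<omega> * indicator A (\<omega> (m + 1)) \<partial>P)"
      by (intro nn_integral_cong) (auto simp: cylinder_def F_def numeral_2_eq_2 space_paths indicator_def)
    also have "\<dots> = (\<integral>\<^sup>+\<omega>. indicator B (shift_by 1 \<omega>) * indicator A (shift_by 1 \<omega> m) \<partial>P)"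
    proof (rule nn_integral_cong)
      fix \<omega> assume "\<omega> \<in> space P"
      then have "\<omega> \<in> B \<longleftrightarrow> shift_by 1 \<omega> \<in> B" using inv by blast
      then show "indicator B \<omega> * indicator A (\<omega> (m + 1)) = (indicator B (shift_by 1 \<omega>) * indicator A (shift_by 1 \<omega> m) :: ennreal)"
        by (simp add: indicator_def)
    qed
    also have "\<dots> = (\<integral>\<^sup>+\<omega>. indicator B \<omega> * indicator A (\<omega> m) \<partial>distr P (paths M) (shift_by 1))"
      by (subst nn_integral_distr) auto
    also have "\<dots> = (\<integral>\<^sup>+\<omega>. indicator A (\<omega> m) * indicator B \<omega> \<partial>P)"
      by (simp add: shift_invariant mult.commute)
    also have "\<dots> / emeasure P B = (\<integral>\<^sup>+\<omega>. indicator A (\<omega> m) \<partial>?U)"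
      by (rule nn_integral_uniform_measure[symmetric]) auto
    also have "\<dots> = (\<integral>\<^sup>+s. indicator A s \<partial>?D)"
      by (subst nn_integral_distr) auto
    finally show "emeasure (?D \<bind> K) A = emeasure ?D A" by simp
  qed
  then show ?thesis using prob by (simp add: stationary_distribution_def)
qed

text \<open>
  Conditioning on an invariant event \<open>B\<close> of positive probability changes neither the kernel nor,
  by uniqueness, the marginal, and these determine the law of the chain. So the conditioned law
  is \<open>P\<close> itself, and it gives \<open>B\<close> probability 1.
\<close>

theorem ergodic_shift:
  assumes unique: "\<And>\<pi>'. stationary_distribution M K \<pi>' \<Longrightarrow> \<pi>' = \<pi>"
  shows "ergodic_map P (shift_by 1)"
proof
  show "shift_by 1 \<in> P \<rightarrow>\<^sub>M P" by measurable
  show "distr P P (shift_by 1) = P"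
    using shift_invariant[of 1] by (metis distr_cong sets_P)
  fix B assume B: "B \<in> sets P" and inv: "shift_by 1 -` B \<inter> space P = B"
  have B': "B \<in> sets (paths M)" using B by simp
  show "emeasure P B = 0 \<or> emeasure P B = 1"
  proof (cases "emeasure P B = 0")
    case False
    let ?U = "uniform_measure P B"
    interpret U: prob_space ?U
      using False by (intro prob_space_uniform_measure) auto
    have "?U = P"
    proof (rule measure_eq_by_cylinders[where M=M])
      fix F :: "nat \<Rightarrow> 'a set" and n m assume F [measurable]: "\<And>i. F i \<in> sets M"
      have "(\<integral>\<^sup>+\<omega>. cylinder F n m \<omega> \<partial>?U) = (\<integral>\<^sup>+\<omega>. cylinder F n m \<omega> * indicator B \<omega> \<partial>P) / emeasure P B"
        using B by (intro nn_integral_uniform_measure) auto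
      also have "(\<integral>\<^sup>+\<omega>. cylinder F n m \<omega> * indicator B \<omega> \<partial>P) =
          (\<integral>\<^sup>+\<omega>. cylinder_prob n F (\<omega> m) * indicator B \<omega> \<partial>P)"
        using cylinder_given_invariant_event[OF B' inv F] by (simp add: mult.commute)
      also have "\<dots> / emeasure P B = (\<integral>\<^sup>+\<omega>. cylinder_prob n F (\<omega> m) \<partial>?U)"
        using B by (intro nn_integral_uniform_measure[symmetric]) auto
      also have "\<dots> = (\<integral>\<^sup>+s. cylinder_prob n F s \<partial>distr ?U M (\<lambda>\<omega>. \<omega> m))"
        by (subst nn_integral_distr) auto
      also have "distr ?U M (\<lambda>\<omega>. \<omega> m) = \<pi>"
        by (intro unique uniform_marginal_stationary B' inv False)
      also have "(\<integral>\<^sup>+s. cylinder_prob n F s \<partial>\<pi>) = (\<integral>\<^sup>+\<omega>. cylinder F n m \<omega> \<partial>P)"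
        by (rule cylinder_marginal[symmetric, OF F])
      finally show "(\<integral>\<^sup>+\<omega>. cylinder F n m \<omega> \<partial>?U) = (\<integral>\<^sup>+\<omega>. cylinder F n m \<omega> \<partial>P)" .
    qed (auto simp: U.finite_measure_axioms)
    then have "emeasure P B = emeasure ?U B" by simp
    also have "\<dots> = 1"
      using B False by (simp add: emeasure_uniform_measure emeasure_eq_measure)
    finally show ?thesis ..
  qed simp
qed

end

lemma ergodic_map_factor:
  assumes "ergodic_map P T" and h [measurable]: "h \<in> P \<rightarrow>\<^sub>M N" and S [measurable]: "S \<in> N \<rightarrow>\<^sub>M N"
    and comm: "\<And>x. x \<in> space P \<Longrightarrow> h (T x) = S (h x)"
  shows "ergodic_map (distr P N h) S"
proof -
  interpret ergodic_map P T by fact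
  interpret N: prob_space "distr P N h" by (rule prob_space_distr) simp
  show ?thesis
  proof
    show "S \<in> distr P N h \<rightarrow>\<^sub>M distr P N h" by simp
    have "distr (distr P N h) (distr P N h) S = distr P N (S \<circ> h)"
      by (subst distr_cong[OF refl sets_distr refl]) (simp add: distr_distr)
    also have "\<dots> = distr P N (h \<circ> T)" by (intro distr_cong) (auto simp: comm)
    also have "\<dots> = distr (distr P P T) N h" by (simp add: distr_distr)
    finally show "distr (distr P N h) (distr P N h) S = distr P N h" by (simp add: T_preserves)
    fix A assume A: "A \<in> sets (distr P N h)" and inv: "S -` A \<inter> space (distr P N h) = A"
    let ?A = "h -` A \<inter> space P"
    have inv_iff: "S y \<in> A \<longleftrightarrow> y \<in> A" if "y \<in> space N" for y using inv that by auto
    have "T -` ?A \<inter> space P = ?A"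
      using inv_iff measurable_space[OF h] measurable_space[OF T_measurable] by (auto simp: comm)
    then have "emeasure P ?A = 0 \<or> emeasure P ?A = 1"
      using A by (intro T_ergodic) auto
    then show "emeasure (distr P N h) A = 0 \<or> emeasure (distr P N h) A = 1"
      using A by (simp add: emeasure_distr)
  qed
qed

lemma ergodic_map_inverse:
  assumes "ergodic_map P T" and S [measurable]: "S \<in> P \<rightarrow>\<^sub>M P"
    and inv: "\<And>x. x \<in> space P \<Longrightarrow> S (T x) = x" "\<And>x. x \<in> space P \<Longrightarrow> T (S x) = x"
  shows "ergodic_map P S"
proof -
  interpret ergodic_map P T by fact
  show ?thesis
  proof
    have "distr P P S = distr (distr P P T) P S" by (simp add: T_preserves)
    also have "\<dots> = distr P P (S \<circ> T)" by (simp add: distr_distr)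
    also have "\<dots> = distr P P (\<lambda>x. x)" by (intro distr_cong) (simp_all add: inv)
    finally show "distr P P S = P" by simp
    fix A assume A: "A \<in> sets P" "S -` A \<inter> space P = A"
    have "T -` A \<inter> space P = A"
      using A sets.sets_into_space[OF A(1)] measurable_space[OF S] measurable_space[OF T_measurable] inv
      by (auto simp: set_eq_iff) (metis Int_iff vimageE vimageI)+
    then show "emeasure P A = 0 \<or> emeasure P A = 1" using A by (intro T_ergodic) auto
  qed simp
qed

section \<open>Forgetting of the initial state\<close>

lemma iter_map_empty [simp]: "s > t \<Longrightarrow> iter_map f y s t x = x"
  by (simp add: iter_map_def)

lemma iter_map_last: "s \<le> t \<Longrightarrow> iter_map f y s t x = f (y t) (iter_map f y s (t - 1) x)"
  by (simp add: iter_map_def upto_rec2)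

lemma iter_map_first: "s \<le> t \<Longrightarrow> iter_map f y s t x = iter_map f y (s + 1) t (f (y s) x)"
  by (simp add: iter_map_def upto_rec1)

lemma iter_map_shift_by: "iter_map f (shift_by j y) s t x = iter_map f y (s + j) (t + j) x"
proof (induction "nat (t - s + 1)" arbitrary: s x)
  case 0 then show ?case by simp
next
  case (Suc n)
  then have "s \<le> t" "n = nat (t - (s + 1) + 1)" by auto
  then show ?case using Suc.hyps(1)[of "s + 1"] by (simp add: iter_map_first add_ac)
qed

lemma sum_int_from_1: "(\<Sum>k=1..int n. f k) = (\<Sum>k<n. f (int k + 1))"
proof (induction n)
  case (Suc n)
  have "{1..int (Suc n)} = insert (int n + 1) {1..int n}" by auto
  then show ?case using Suc by (simp add: add_ac)
qed simp

text \<open>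
  Eventually \<open>u n \<le> - n * ln r / 2\<close>, which leaves the geometric series of ratio \<open>sqrt r\<close>.
\<close>

lemma summable_powr_if_sublinear_log:
  fixes r :: real and u :: "nat \<Rightarrow> real"
  assumes r: "0 < r" "r < 1" and u: "(\<lambda>n. u n / real n) \<longlonglongrightarrow> 0"
  shows "summable (\<lambda>n. r ^ n * exp (u n))"
proof -
  define d where "d = - ln r / 2"
  have d: "d > 0" using r by (simp add: d_def)
  have "eventually (\<lambda>n. u n / real n < d) sequentially" using u d by (rule order_tendstoD)
  moreover have "eventually (\<lambda>n. n > 0) sequentially" by (rule eventually_gt_at_top)
  ultimately have "eventually (\<lambda>n. norm (r ^ n * exp (u n)) \<le> exp (- d) ^ n) sequentially"
  proof eventually_elim
    fix n :: nat assume n: "u n / real n < d" "n > 0"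
    then have "u n \<le> d * real n" by (simp add: field_simps)
    then have "r ^ n * exp (u n) \<le> exp (n * ln r) * exp (d * n)"
      using r by (intro mult_mono) (auto simp: exp_of_nat_mult)
    also have "\<dots> = exp (- d) ^ n"
      by (simp add: d_def exp_of_nat_mult[symmetric] exp_add[symmetric] field_simps)
    finally show "norm (r ^ n * exp (u n)) \<le> exp (- d) ^ n" using r by simp
  qed
  then show ?thesis
    by (rule summable_comparison_test_ev) (use d in \<open>auto intro: summable_geometric\<close>)
qed

lemma eventually_add_const_average:
  fixes a :: "nat \<Rightarrow> real"
  assumes "eventually (\<lambda>n. a n / real n < c) sequentially" "c < c'"
  shows "eventually (\<lambda>n. (a n + A) / real n < c') sequentially"
proof -
  have "(\<lambda>n. A / real n) \<longlonglongrightarrow> 0" by (rule lim_const_over_n)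
  then have "eventually (\<lambda>n. A / real n < c' - c) sequentially"
    using assms(2) by (intro order_tendstoD) auto
  with assms(1) show ?thesis
    by eventually_elim (simp add: add_divide_distrib)
qed

lemma le_exp_ln_plus: "0 \<le> u \<Longrightarrow> u \<le> exp (ln_plus u)"
  by (cases "u = 0") (auto simp: ln_plus_def max_def)

text \<open>
  The hypotheses on the maps and the densities, which are uniform in the parameter. The estimates
  drawn from them hold path by path; the parameter that generates the data only matters for
  which paths are typical, and enters in \<open>stationary_odm\<close> below.
\<close>

locale contractive_odm = dominated_odm \<Theta> \<nu> G g \<psi>
  for \<Theta> :: "'t::metric_space set"
    and \<nu> :: "'y measure"
    and G :: "'t \<Rightarrow> 'x::polish_space \<Rightarrow> 'y measure"
    and g :: "'t \<Rightarrow> 'x \<Rightarrow> 'y \<Rightarrow> real"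
    and \<psi> :: "'t \<Rightarrow> 'y \<Rightarrow> 'x \<Rightarrow> 'x" +
  fixes x1 :: 'x and X1 :: "'x set" and \<rho> C :: real
    and \<psi>bar :: "'x \<Rightarrow> real" and H :: "real \<Rightarrow> real" and \<phi>bar :: "'y \<Rightarrow> real"
  assumes g_continuous: "\<And>y. y \<in> space \<nu> \<Longrightarrow> continuous_on (\<Theta> \<times> UNIV) (\<lambda>(\<theta>, x). g \<theta> x y)"
    and \<psi>_continuous: "\<And>y. y \<in> space \<nu> \<Longrightarrow> continuous_on (\<Theta> \<times> UNIV) (\<lambda>(\<theta>, x). \<psi> \<theta> y x)"
    and X1_closed: "closed X1"
    and \<rho>: "0 < \<rho>" "\<rho> < 1" and C_nonneg: "C \<ge> 0"
    and \<psi>bar_measurable [measurable]: "\<psi>bar \<in> borel_measurable borel"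
    and \<phi>bar_measurable [measurable]: "\<phi>bar \<in> borel_measurable \<nu>"
    and \<phi>bar_nonneg: "\<And>y. y \<in> space \<nu> \<Longrightarrow> \<phi>bar y \<ge> 0"
    and \<psi>_in_X1: "\<And>\<theta> x y. \<theta> \<in> \<Theta> \<Longrightarrow> y \<in> space \<nu> \<Longrightarrow> \<psi> \<theta> y x \<in> X1"
    and g_bounded: "bdd_above ((\<lambda>(\<theta>, x, y). g \<theta> x y) ` (\<Theta> \<times> X1 \<times> space \<nu>))"
    and contraction: "\<And>\<theta> (n::nat) x y. \<theta> \<in> \<Theta> \<Longrightarrow> (\<And>k. k \<in> {1..int n} \<Longrightarrow> y k \<in> space \<nu>) \<Longrightarrow>
          dist (iter_map (\<psi> \<theta>) y 1 (int n) x1) (iter_map (\<psi> \<theta>) y 1 (int n) x) \<le> \<rho> ^ n * \<psi>bar x"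
    and \<psi>bar_\<psi>: "\<And>\<theta> y. \<theta> \<in> \<Theta> \<Longrightarrow> y \<in> space \<nu> \<Longrightarrow> \<psi>bar (\<psi> \<theta> y x1) \<le> \<phi>bar y"
    and ln_g_modulus: "\<And>\<theta> x x' y. \<theta> \<in> \<Theta> \<Longrightarrow> x \<in> X1 \<Longrightarrow> x' \<in> X1 \<Longrightarrow> y \<in> space \<nu> \<Longrightarrow>
          \<bar>ln (g \<theta> x y / g \<theta> x' y)\<bar>
            \<le> H (dist x x') * exp (C * max (dist x1 x) (dist x1 x')) * \<phi>bar y"
    and H_linear: "H \<in> O[at_right 0](\<lambda>u. u)"
begin

lemma path_in_space: "y \<in> space (paths \<nu>) \<Longrightarrow> y k \<in> space \<nu>"
  by (simp add: space_paths)

definition orbit :: "'t \<Rightarrow> (int \<Rightarrow> 'y) \<Rightarrow> int \<Rightarrow> int \<Rightarrow> 'x" where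
  "orbit \<theta> y s t = iter_map (\<psi> \<theta>) y s t x1"

text \<open>
  The state after the observation at time \<open>t\<close> when the recursion is started from \<open>x1\<close> in the
  infinitely remote past.
\<close>

definition limit_state :: "'t \<Rightarrow> (int \<Rightarrow> 'y) \<Rightarrow> int \<Rightarrow> 'x" where
  "limit_state \<theta> y t = lim (\<lambda>m. orbit \<theta> y (t - int m) t)"

text \<open>
  This bounds the distance from \<open>x1\<close> of every state that is reached at time \<open>t\<close> from \<open>x1\<close>, and hence
  of the limiting state; its values at all times control all the estimates of this section.
\<close>

definition past_weight :: "(int \<Rightarrow> 'y) \<Rightarrow> int \<Rightarrow> real" where
  "past_weight y t = (\<Sum>i. \<rho> ^ i * \<phi>bar (y (t - int i)))"

definition tame :: "(int \<Rightarrow> 'y) \<Rightarrow> bool" where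
  "tame y \<longleftrightarrow> y \<in> space (paths \<nu>) \<and> (\<forall>t. summable (\<lambda>i. \<rho> ^ i * \<phi>bar (y (t - int i))))"

lemma tame_space: "tame y \<Longrightarrow> y k \<in> space \<nu>"
  by (simp add: tame_def path_in_space)

lemma tame_summable: "tame y \<Longrightarrow> summable (\<lambda>i. \<rho> ^ i * \<phi>bar (y (t - int i)))"
  by (simp add: tame_def)

lemma tame_shift_by: "tame y \<Longrightarrow> tame (shift_by j y)"
  unfolding tame_def by (auto simp: space_paths algebra_simps dest: spec[of _ "_ + j"])

lemma orbit_shift_by: "orbit \<theta> (shift_by j y) s t = orbit \<theta> y (s + j) (t + j)"
  by (simp add: orbit_def iter_map_shift_by)

lemma limit_state_shift_by: "limit_state \<theta> (shift_by j y) t = limit_state \<theta> y (t + j)"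
  by (simp add: limit_state_def orbit_shift_by algebra_simps)

lemma past_weight_shift_by: "past_weight (shift_by j y) t = past_weight y (t + j)"
  by (simp add: past_weight_def algebra_simps)

lemma orbit_in_X1: "\<theta> \<in> \<Theta> \<Longrightarrow> y \<in> space (paths \<nu>) \<Longrightarrow> s \<le> t \<Longrightarrow> orbit \<theta> y s t \<in> X1"
  by (simp add: orbit_def iter_map_last \<psi>_in_X1 path_in_space)

lemma past_weight_nonneg: "tame y \<Longrightarrow> past_weight y t \<ge> 0"
  unfolding past_weight_def using \<rho> \<phi>bar_nonneg
  by (intro suminf_nonneg tame_summable) (auto simp: tame_space)

lemma past_weight_split:
  assumes "tame y"
  shows "past_weight y t = (\<Sum>i<k. \<rho> ^ i * \<phi>bar (y (t - int i))) + \<rho> ^ k * past_weight y (t - int k)"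
proof -
  have "(\<Sum>i. \<rho> ^ (i + k) * \<phi>bar (y (t - int (i + k)))) = \<rho> ^ k * past_weight y (t - int k)"
    unfolding past_weight_def
    by (subst suminf_mult[OF tame_summable[OF assms], symmetric]) (simp add: power_add mult_ac diff_diff_eq add_ac)
  then show ?thesis
    using suminf_split_initial_segment[OF tame_summable[OF assms], of t k] by (simp add: past_weight_def)
qed

text \<open>
  By \<open>past_weight_split\<close>, the left-hand side is a remainder of the series \<open>past_weight y t\<close>.
\<close>

lemma past_weight_tail:
  assumes "tame y"
  shows "(\<lambda>k. \<rho> ^ k * past_weight y (t - int k)) \<longlonglongrightarrow> 0"
proof -
  have "(\<lambda>k. past_weight y t - (\<Sum>i<k. \<rho> ^ i * \<phi>bar (y (t - int i)))) \<longlonglongrightarrow> past_weight y t - past_weight y t"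
    unfolding past_weight_def by (intro tendsto_intros summable_LIMSEQ tame_summable assms)
  moreover have "past_weight y t - (\<Sum>i<k. \<rho> ^ i * \<phi>bar (y (t - int i))) = \<rho> ^ k * past_weight y (t - int k)" for k
    using past_weight_split[OF assms, of t k] by simp
  ultimately show ?thesis by simp
qed

lemma iter_map_contraction:
  assumes "\<theta> \<in> \<Theta>" "y \<in> space (paths \<nu>)" "s \<le> t + 1"
  shows "dist (orbit \<theta> y s t) (iter_map (\<psi> \<theta>) y s t x) \<le> \<rho> ^ nat (t - s + 1) * \<psi>bar x"
proof -
  have "shift_by (s - 1) y k \<in> space \<nu>" for k using assms by (simp add: path_in_space)
  with contraction[OF assms(1), of "nat (t - s + 1)" "shift_by (s - 1) y" x] assms(3)
  show ?thesis by (simp add: orbit_def iter_map_shift_by)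
qed

text \<open>
  Prepending one observation \<open>z\<close> replaces the starting point \<open>x1\<close> by \<open>\<psi> \<theta> z x1\<close>, whose \<open>\<psi>bar\<close> is at most
  \<open>\<phi>bar z\<close>. The contraction bounds the resulting displacement; summing over the prepended
  observations gives a part of the series \<open>past_weight\<close>. For \<open>s = t + 1\<close> the first orbit is \<open>x1\<close>.
\<close>

lemma dist_orbit_earlier_start:
  assumes \<theta>: "\<theta> \<in> \<Theta>" and y: "tame y" and st: "s \<le> t + 1"
  shows "dist (orbit \<theta> y s t) (orbit \<theta> y (s - int k) t) \<le> \<rho> ^ nat (t - s + 1) * past_weight y (s - 1)"
proof -
  let ?n = "nat (t - s + 1)"
  have yp: "y \<in> space (paths \<nu>)" using y by (simp add: tame_def)
  have "dist (orbit \<theta> y s t) (orbit \<theta> y (s - int k) t) \<le> (\<Sum>i<k. \<rho> ^ (?n + i) * \<phi>bar (y (s - 1 - int i)))"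
  proof (induction k)
    case (Suc k)
    have "orbit \<theta> y (s - int (Suc k)) t = iter_map (\<psi> \<theta>) y (s - int k) t (\<psi> \<theta> (y (s - int (Suc k))) x1)"
      unfolding orbit_def using st by (subst iter_map_first) (auto simp: algebra_simps)
    then have "dist (orbit \<theta> y (s - int k) t) (orbit \<theta> y (s - int (Suc k)) t)
        \<le> \<rho> ^ nat (t - (s - int k) + 1) * \<psi>bar (\<psi> \<theta> (y (s - int (Suc k))) x1)"
      using iter_map_contraction[OF \<theta> yp, of "s - int k" t] st by simp
    also have "\<dots> \<le> \<rho> ^ nat (t - (s - int k) + 1) * \<phi>bar (y (s - int (Suc k)))"
      using \<rho> by (intro mult_left_mono \<psi>bar_\<psi> \<theta> tame_space y) auto
    also have "nat (t - (s - int k) + 1) = ?n + k" using st by simp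
    also have "s - int (Suc k) = s - 1 - int k" by simp
    finally show ?case
      using Suc dist_triangle[of "orbit \<theta> y s t" "orbit \<theta> y (s - int (Suc k)) t" "orbit \<theta> y (s - int k) t"]
      by (simp add: algebra_simps)
  qed simp
  also have "\<dots> = \<rho> ^ ?n * (\<Sum>i<k. \<rho> ^ i * \<phi>bar (y (s - 1 - int i)))"
    by (simp add: sum_distrib_left power_add mult.assoc)
  also have "(\<Sum>i<k. \<rho> ^ i * \<phi>bar (y (s - 1 - int i))) \<le> past_weight y (s - 1)"
    unfolding past_weight_def using \<rho> y
    by (intro sum_le_suminf tame_summable) (auto intro!: mult_nonneg_nonneg \<phi>bar_nonneg tame_space)
  finally show ?thesis using \<rho> by (simp add: mult_left_mono)
qed

text \<open>
  By \<open>dist_orbit_earlier_start\<close>, all orbits started before \<open>t - N\<close> stay within a remainder of the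
  series \<open>past_weight y t\<close> of the orbit started at \<open>t - N\<close>.
\<close>

lemma orbit_tendsto_limit_state:
  assumes \<theta>: "\<theta> \<in> \<Theta>" and y: "tame y"
  shows "(\<lambda>m. orbit \<theta> y (t - int m) t) \<longlonglongrightarrow> limit_state \<theta> y t"
proof -
  have "Cauchy (\<lambda>m. orbit \<theta> y (t - int m) t)"
  proof (rule metric_CauchyI)
    fix e :: real assume e: "e > 0"
    have "eventually (\<lambda>k. \<rho> ^ k * past_weight y (t - int k) < e / 2) sequentially"
      using e by (intro order_tendstoD(2)[OF past_weight_tail[OF y]]) simp
    then obtain N0 where N0: "\<And>k. k \<ge> N0 \<Longrightarrow> \<rho> ^ k * past_weight y (t - int k) < e / 2"
      by (auto simp: eventually_sequentially)
    define N where "N = Suc N0"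
    have near: "dist (orbit \<theta> y (t - int N) t) (orbit \<theta> y (t - int m) t) < e / 2" if "m \<ge> N" for m
    proof -
      have "nat (t - (t - int N) + 1) = Suc N" by simp
      then have "dist (orbit \<theta> y (t - int N) t) (orbit \<theta> y (t - int m) t)
          \<le> \<rho> ^ Suc N * past_weight y (t - int (Suc N))"
        using dist_orbit_earlier_start[OF \<theta> y, of "t - int N" t "m - N"] that
        by (simp add: of_nat_diff algebra_simps)
      also have "\<dots> < e / 2" by (rule N0) (simp add: N_def)
      finally show ?thesis .
    qed
    show "\<exists>N. \<forall>m\<ge>N. \<forall>n\<ge>N. dist (orbit \<theta> y (t - int m) t) (orbit \<theta> y (t - int n) t) < e"
    proof (intro exI allI impI)
      fix m n assume "m \<ge> N" "n \<ge> N"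
      then show "dist (orbit \<theta> y (t - int m) t) (orbit \<theta> y (t - int n) t) < e"
        using near[of m] near[of n] dist_triangle_half_r by blast
    qed
  qed
  then show ?thesis unfolding limit_state_def
    using Cauchy_convergent_iff convergent_LIMSEQ_iff by blast
qed

lemma dist_orbit_limit_state:
  assumes \<theta>: "\<theta> \<in> \<Theta>" and y: "tame y" and st: "s \<le> t + 1"
  shows "dist (orbit \<theta> y s t) (limit_state \<theta> y t) \<le> \<rho> ^ nat (t - s + 1) * past_weight y (s - 1)"
proof (rule LIMSEQ_le_const2)
  let ?n = "nat (t - s + 1)"
  show "(\<lambda>m. dist (orbit \<theta> y s t) (orbit \<theta> y (t - int m) t)) \<longlonglongrightarrow> dist (orbit \<theta> y s t) (limit_state \<theta> y t)"
    by (intro tendsto_intros orbit_tendsto_limit_state \<theta> y)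
  have "dist (orbit \<theta> y s t) (orbit \<theta> y (t - int m) t) \<le> \<rho> ^ ?n * past_weight y (s - 1)" if "m \<ge> ?n" for m
  proof -
    have "t - int m = s - int (m + 1 - ?n)" using that st by (simp add: of_nat_diff)
    then show ?thesis using dist_orbit_earlier_start[OF \<theta> y st, of "m + 1 - ?n"] by simp
  qed
  then show "\<exists>N. \<forall>m\<ge>N. dist (orbit \<theta> y s t) (orbit \<theta> y (t - int m) t) \<le> \<rho> ^ ?n * past_weight y (s - 1)"
    by blast
qed

lemma limit_state_in_X1:
  assumes "\<theta> \<in> \<Theta>" "tame y" shows "limit_state \<theta> y t \<in> X1"
  by (rule closed_sequentially[OF X1_closed _ orbit_tendsto_limit_state[OF assms, of t]])
    (use assms in \<open>auto intro: orbit_in_X1 simp: tame_def\<close>)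

lemma dist_x1_orbit:
  assumes "\<theta> \<in> \<Theta>" "tame y" "s \<le> t + 1"
  shows "dist x1 (orbit \<theta> y s t) \<le> past_weight y t"
  using dist_orbit_earlier_start[OF assms(1,2), of "t + 1" t "nat (t + 1 - s)"] assms(3)
  by (simp add: orbit_def)

lemma dist_x1_limit_state:
  assumes "\<theta> \<in> \<Theta>" "tame y" shows "dist x1 (limit_state \<theta> y t) \<le> past_weight y t"
  using dist_orbit_limit_state[OF assms, of "t + 1" t] by (simp add: orbit_def)

lemma g_continuous_in_state: "\<theta> \<in> \<Theta> \<Longrightarrow> z \<in> space \<nu> \<Longrightarrow> continuous_on UNIV (\<lambda>x. g \<theta> x z)"
proof -
  assume "\<theta> \<in> \<Theta>" and z: "z \<in> space \<nu>"
  then have "continuous_on UNIV (\<lambda>x. (\<lambda>(\<theta>, x). g \<theta> x z) (\<theta>, x))"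
    by (intro continuous_on_compose2[OF g_continuous[OF z]]) (auto intro!: continuous_intros)
  then show ?thesis by simp
qed

lemma orbit_continuous:
  assumes "y \<in> space (paths \<nu>)" shows "continuous_on \<Theta> (\<lambda>\<theta>. orbit \<theta> y s t)"
proof (induction "nat (t - s + 1)" arbitrary: t)
  case 0 then show ?case by (simp add: orbit_def)
next
  case (Suc n)
  then have st: "s \<le> t" and n: "n = nat ((t - 1) - s + 1)" by auto
  have "continuous_on \<Theta> (\<lambda>\<theta>. (\<lambda>(\<theta>, x). \<psi> \<theta> (y t) x) (\<theta>, orbit \<theta> y s (t - 1)))"
    by (rule continuous_on_compose2[OF \<psi>_continuous])
      (use assms Suc.hyps(1)[OF n] in \<open>auto intro!: continuous_intros simp: path_in_space\<close>)
  then show ?case using st by (simp add: orbit_def iter_map_last)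
qed

text \<open>
  The bound of \<open>dist_orbit_limit_state\<close> does not depend on \<open>\<theta>\<close>, so the convergence is uniform.
\<close>

lemma limit_state_continuous:
  assumes y: "tame y" shows "continuous_on \<Theta> (\<lambda>\<theta>. limit_state \<theta> y t)"
proof (rule uniform_limit_theorem)
  show "\<forall>\<^sub>F m in sequentially. continuous_on \<Theta> (\<lambda>\<theta>. orbit \<theta> y (t - int m) t)"
    using y by (auto simp: tame_def intro!: always_eventually orbit_continuous)
  show "uniform_limit \<Theta> (\<lambda>m \<theta>. orbit \<theta> y (t - int m) t) (\<lambda>\<theta>. limit_state \<theta> y t) sequentially"
  proof (rule uniform_limitI)
    fix e :: real assume "e > 0"
    have "(\<lambda>m. \<rho> ^ Suc m * past_weight y (t - int (Suc m))) \<longlonglongrightarrow> 0"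
      using past_weight_tail[OF y, of t] by (rule LIMSEQ_Suc)
    then have "eventually (\<lambda>m. \<rho> ^ Suc m * past_weight y (t - int (Suc m)) < e) sequentially"
      using \<open>e > 0\<close> by (rule order_tendstoD)
    then show "\<forall>\<^sub>F m in sequentially. \<forall>\<theta>\<in>\<Theta>. dist (orbit \<theta> y (t - int m) t) (limit_state \<theta> y t) < e"
    proof eventually_elim
      fix m assume m: "\<rho> ^ Suc m * past_weight y (t - int (Suc m)) < e"
      have "dist (orbit \<theta> y (t - int m) t) (limit_state \<theta> y t) \<le> \<rho> ^ Suc m * past_weight y (t - int (Suc m))"
        if "\<theta> \<in> \<Theta>" for \<theta>
        using dist_orbit_limit_state[OF that y, of "t - int m" t] by (simp add: nat_add_distrib algebra_simps)
      with m show "\<forall>\<theta>\<in>\<Theta>. dist (orbit \<theta> y (t - int m) t) (limit_state \<theta> y t) < e" by fastforce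
    qed
  qed
qed simp

section \<open>Comparison of the likelihood with its stationary version\<close>

text \<open>On tame paths this is \<open>ln p\<^sup>\<theta>(y\<^sub>1 | y\<^bsub>-\<infinity>:0\<^esub>)\<close>, by \<open>pred_density_eq\<close> below.\<close>

definition pred_loglik :: "'t \<Rightarrow> (int \<Rightarrow> 'y) \<Rightarrow> real" where
  "pred_loglik \<theta> y = ln (g \<theta> (limit_state \<theta> y 0) (y 1))"

lemma pred_loglik_shift_by: "pred_loglik \<theta> (shift_by j y) = ln (g \<theta> (limit_state \<theta> y j) (y (j + 1)))"
  by (simp add: pred_loglik_def limit_state_shift_by add.commute)

lemma ln_g_continuous_along:
  assumes y: "z \<in> space \<nu>" and f: "continuous_on \<Theta> f"
  shows "continuous_on \<Theta> (\<lambda>\<theta>. ln (g \<theta> (f \<theta>) z))"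
proof (rule continuous_on_ln)
  have "continuous_on \<Theta> (\<lambda>\<theta>. (\<lambda>(\<theta>, x). g \<theta> x z) (\<theta>, f \<theta>))"
    by (rule continuous_on_compose2[OF g_continuous]) (use y f in \<open>auto intro!: continuous_intros\<close>)
  then show "continuous_on \<Theta> (\<lambda>\<theta>. g \<theta> (f \<theta>) z)" by simp
qed (use dens_pos[OF _ y] less_irrefl in metis)

lemma pred_loglik_continuous: "tame y \<Longrightarrow> continuous_on \<Theta> (\<lambda>\<theta>. pred_loglik \<theta> y)"
  unfolding pred_loglik_def by (intro ln_g_continuous_along limit_state_continuous tame_space)

lemma pred_loglik_bounded_above: "\<exists>b. \<forall>\<theta>\<in>\<Theta>. \<forall>y. tame y \<longrightarrow> pred_loglik \<theta> y \<le> b"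
proof -
  obtain B where B: "\<And>\<theta> x y. \<theta> \<in> \<Theta> \<Longrightarrow> x \<in> X1 \<Longrightarrow> y \<in> space \<nu> \<Longrightarrow> g \<theta> x y \<le> B"
    using g_bounded by (auto simp: bdd_above_def)
  have "pred_loglik \<theta> y \<le> ln B" if "\<theta> \<in> \<Theta>" "tame y" for \<theta> y
  proof -
    have "0 < g \<theta> (limit_state \<theta> y 0) (y 1)" using that by (intro dens_pos) (auto simp: tame_space)
    moreover have "g \<theta> (limit_state \<theta> y 0) (y 1) \<le> B"
      using that by (intro B limit_state_in_X1 tame_space)
    ultimately show ?thesis unfolding pred_loglik_def by simp
  qed
  then show ?thesis by blast
qed

text \<open>
  The numerator bounds the logarithm of the factor that multiplies \<open>H\<close> in the log-Lipschitz bound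
  on \<open>g\<close>; as it is sublinear, this factor cannot undo the geometric decay of the distances.
\<close>

definition regular :: "(int \<Rightarrow> 'y) \<Rightarrow> bool" where
  "regular y \<longleftrightarrow> tame y \<and>
     (\<lambda>n. (C * past_weight y (int n) + ln_plus (\<phi>bar (y (int n + 1)))) / real n) \<longlonglongrightarrow> 0"

text \<open>
  After \<open>n\<close> observations the two states are at distance at most \<open>\<rho>\<^sup>n * past_weight y 0\<close>, and the
  log-Lipschitz bound on \<open>g\<close> turns this into a bound on the log-densities. The linear bound on \<open>H\<close>
  is only valid near 0, which is why finitely many terms are excluded.
\<close>

lemma pred_loglik_approximation:
  assumes y: "regular y"
  shows "\<exists>err N. summable err \<and> (\<forall>n. err n \<ge> 0) \<and> (\<forall>\<theta>\<in>\<Theta>. \<forall>n\<ge>N.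
      \<bar>ln (g \<theta> (orbit \<theta> y 1 (int n)) (y (int n + 1))) - pred_loglik \<theta> (shift_by (int n) y)\<bar> \<le> err n)"
proof -
  have tame: "tame y" using y by (simp add: regular_def)
  obtain c where c: "c > 0" and "eventually (\<lambda>u. norm (H u) \<le> c * norm u) (at_right 0)"
    using H_linear by (elim landau_o.bigE)
  then obtain r where r: "r > 0" and Hr: "\<And>u. 0 < u \<Longrightarrow> u < r \<Longrightarrow> \<bar>H u\<bar> \<le> c * u"
    by (auto simp: eventually_at_right_field)
  let ?u = "\<lambda>n. C * past_weight y (int n) + ln_plus (\<phi>bar (y (int n + 1)))"
  define err where "err n = c * past_weight y 0 * (\<rho> ^ n * exp (?u n))" for n
  have summ: "summable err" unfolding err_def
    by (intro summable_mult summable_powr_if_sublinear_log \<rho>) (use y in \<open>simp add: regular_def\<close>)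
  have err_nonneg: "err n \<ge> 0" for n
    using c \<rho> past_weight_nonneg[OF tame] by (simp add: err_def)
  have "(\<lambda>n. \<rho> ^ n * past_weight y 0) \<longlonglongrightarrow> 0 * past_weight y 0"
    using \<rho> by (intro tendsto_intros LIMSEQ_power_zero) simp
  then have "eventually (\<lambda>n. \<rho> ^ n * past_weight y 0 < r) sequentially"
    using r by (intro order_tendstoD) auto
  then obtain N0 where N0: "\<And>n. n \<ge> N0 \<Longrightarrow> \<rho> ^ n * past_weight y 0 < r"
    by (auto simp: eventually_sequentially)
  have "\<bar>ln (g \<theta> (orbit \<theta> y 1 (int n)) (y (int n + 1))) - pred_loglik \<theta> (shift_by (int n) y)\<bar> \<le> err n"
    if \<theta>: "\<theta> \<in> \<Theta>" and n: "n \<ge> Suc N0" for \<theta> n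
  proof -
    let ?x = "orbit \<theta> y 1 (int n)" and ?x' = "limit_state \<theta> y (int n)" and ?z = "y (int n + 1)"
    have z: "?z \<in> space \<nu>" by (rule tame_space[OF tame])
    have X1: "?x \<in> X1" "?x' \<in> X1"
      using n tame by (auto intro!: orbit_in_X1 limit_state_in_X1 \<theta> simp: tame_def)
    have pos: "0 < g \<theta> ?x ?z" "0 < g \<theta> ?x' ?z" using dens_pos[OF \<theta> z] by auto
    have eq: "ln (g \<theta> ?x ?z) - pred_loglik \<theta> (shift_by (int n) y) = ln (g \<theta> ?x ?z / g \<theta> ?x' ?z)"
      using pos by (simp add: pred_loglik_shift_by ln_div)
    show ?thesis
    \<comment> \<open>The asymptotics of \<open>H\<close> say nothing about \<open>H 0\<close>, so coinciding states are treated apart.\<close>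
    proof (cases "?x = ?x'")
      case True
      then show ?thesis unfolding eq using pos err_nonneg by simp
    next
      case False
      have d: "dist ?x ?x' \<le> \<rho> ^ n * past_weight y 0"
        using dist_orbit_limit_state[OF \<theta> tame, of 1 "int n"] by simp
      have "\<rho> ^ n * past_weight y 0 < r" using n by (intro N0) simp
      then have "\<bar>H (dist ?x ?x')\<bar> \<le> c * dist ?x ?x'" using False d by (intro Hr) auto
      also have "\<dots> \<le> c * (\<rho> ^ n * past_weight y 0)" using d c by simp
      finally have H: "H (dist ?x ?x') \<le> c * (\<rho> ^ n * past_weight y 0)" by simp
      have m: "max (dist x1 ?x) (dist x1 ?x') \<le> past_weight y (int n)"
        using dist_x1_orbit[OF \<theta> tame, of 1 "int n"] dist_x1_limit_state[OF \<theta> tame, of "int n"] by simp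
      have "\<bar>ln (g \<theta> ?x ?z / g \<theta> ?x' ?z)\<bar>
          \<le> H (dist ?x ?x') * exp (C * max (dist x1 ?x) (dist x1 ?x')) * \<phi>bar ?z"
        by (rule ln_g_modulus[OF \<theta> X1 z])
      also have "\<dots> \<le> (c * (\<rho> ^ n * past_weight y 0)) * exp (C * past_weight y (int n)) * exp (ln_plus (\<phi>bar ?z))"
        using c \<rho> past_weight_nonneg[OF tame, of 0] \<phi>bar_nonneg[OF z] C_nonneg m H
        by (intro mult_mono le_exp_ln_plus) (auto intro!: mult_nonneg_nonneg mult_left_mono)
      also have "\<dots> = err n" by (simp add: err_def exp_add)
      finally show ?thesis unfolding eq .
    qed
  qed
  then show ?thesis using summ err_nonneg by blast
qed

lemma loglik_eq_sum:
  "loglik g \<psi> x1 n y \<theta> = (\<Sum>k<n. ln (g \<theta> (orbit \<theta> y 1 (int k)) (y (int k + 1)))) / real n"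
  unfolding loglik_def by (subst sum_int_from_1) (simp add: orbit_def)

text \<open>
  The finitely many terms to which the approximation does not apply are bounded uniformly in \<open>\<theta>\<close>
  by continuity on the compact parameter set, so they and the error series contribute \<open>O(1/n)\<close>.
\<close>

lemma eventually_loglik_less:
  assumes y: "regular y" and S: "S \<subseteq> \<Theta>"
    and w: "\<And>\<theta> k. \<theta> \<in> S \<Longrightarrow> pred_loglik \<theta> (shift_by (int k) y) \<le> w k"
    and avg: "eventually (\<lambda>n. (\<Sum>k<n. w k) / real n < c) sequentially" and "c < c'"
  shows "eventually (\<lambda>n. \<forall>\<theta>\<in>S. loglik g \<psi> x1 n y \<theta> < c') sequentially"
proof -
  have tame: "tame y" using y by (simp add: regular_def)
  obtain err N where err: "summable err" "\<And>n. err n \<ge> 0"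
    and approx: "\<And>\<theta> n. \<theta> \<in> \<Theta> \<Longrightarrow> n \<ge> N \<Longrightarrow>
      \<bar>ln (g \<theta> (orbit \<theta> y 1 (int n)) (y (int n + 1))) - pred_loglik \<theta> (shift_by (int n) y)\<bar> \<le> err n"
    using pred_loglik_approximation[OF y] by blast
  have "\<exists>A. \<forall>\<theta>\<in>\<Theta>. ln (g \<theta> (orbit \<theta> y 1 (int k)) (y (int k + 1))) \<le> A" for k
  proof -
    have "bounded ((\<lambda>\<theta>. ln (g \<theta> (orbit \<theta> y 1 (int k)) (y (int k + 1)))) ` \<Theta>)"
      using tame by (intro compact_imp_bounded compact_continuous_image compact_param
          ln_g_continuous_along orbit_continuous tame_space) (auto simp: tame_def)
    then show ?thesis by (auto simp: bounded_iff abs_le_iff)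
  qed
  then obtain A where A: "\<And>\<theta> k. \<theta> \<in> \<Theta> \<Longrightarrow> ln (g \<theta> (orbit \<theta> y 1 (int k)) (y (int k + 1))) \<le> A k"
    by metis
  let ?D = "(\<Sum>k<N. \<bar>A k - w k\<bar>) + suminf err"
  have bound: "loglik g \<psi> x1 n y \<theta> \<le> ((\<Sum>k<n. w k) + ?D) / real n" if \<theta>: "\<theta> \<in> S" for \<theta> n
  proof -
    have "ln (g \<theta> (orbit \<theta> y 1 (int k)) (y (int k + 1))) \<le> w k + ((if k < N then \<bar>A k - w k\<bar> else 0) + err k)" for k
    proof (cases "k < N")
      case True then show ?thesis using A[of \<theta> k] err(2)[of k] \<theta> S by auto
    next
      case False then show ?thesis using approx[of \<theta> k] w[of \<theta> k] \<theta> S by auto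
    qed
    then have "(\<Sum>k<n. ln (g \<theta> (orbit \<theta> y 1 (int k)) (y (int k + 1))))
        \<le> (\<Sum>k<n. w k + ((if k < N then \<bar>A k - w k\<bar> else 0) + err k))" by (intro sum_mono)
    also have "\<dots> = (\<Sum>k<n. w k) + ((\<Sum>k<n. if k < N then \<bar>A k - w k\<bar> else 0) + (\<Sum>k<n. err k))"
      by (simp only: sum.distrib)
    also have "(\<Sum>k<n. err k) \<le> suminf err" using err by (intro sum_le_suminf) auto
    also have "(\<Sum>k<n. if k < N then \<bar>A k - w k\<bar> else 0) = (\<Sum>k\<in>{..<n} \<inter> {..<N}. \<bar>A k - w k\<bar>)"
      by (simp add: sum.inter_restrict)
    also have "\<dots> \<le> (\<Sum>k<N. \<bar>A k - w k\<bar>)" by (intro sum_mono2) auto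
    finally show ?thesis unfolding loglik_eq_sum by (intro divide_right_mono) auto
  qed
  have "eventually (\<lambda>n. ((\<Sum>k<n. w k) + ?D) / real n < c') sequentially"
    using avg \<open>c < c'\<close> by (rule eventually_add_const_average)
  then show ?thesis
    by eventually_elim (use bound in \<open>auto intro: le_less_trans\<close>)
qed

lemma eventually_loglik_greater:
  assumes y: "regular y" and \<theta>: "\<theta> \<in> \<Theta>"
    and avg: "eventually (\<lambda>n. (\<Sum>k<n. - pred_loglik \<theta> (shift_by (int k) y)) / real n < - c) sequentially" and "c' < c"
  shows "eventually (\<lambda>n. c' < loglik g \<psi> x1 n y \<theta>) sequentially"
proof -
  obtain err N where err: "summable err" "\<And>n. err n \<ge> 0"
    and approx: "\<And>\<theta> n. \<theta> \<in> \<Theta> \<Longrightarrow> n \<ge> N \<Longrightarrow>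
      \<bar>ln (g \<theta> (orbit \<theta> y 1 (int n)) (y (int n + 1))) - pred_loglik \<theta> (shift_by (int n) y)\<bar> \<le> err n"
    using pred_loglik_approximation[OF y] by blast
  let ?a = "\<lambda>k. ln (g \<theta> (orbit \<theta> y 1 (int k)) (y (int k + 1)))"
  let ?p = "\<lambda>k. pred_loglik \<theta> (shift_by (int k) y)"
  let ?D = "(\<Sum>k<N. \<bar>?a k - ?p k\<bar>) + suminf err"
  have bound: "- loglik g \<psi> x1 n y \<theta> \<le> ((\<Sum>k<n. - ?p k) + ?D) / real n" for n
  proof -
    have "- ?a k \<le> - ?p k + ((if k < N then \<bar>?a k - ?p k\<bar> else 0) + err k)" for k
      using approx[of \<theta> k] err(2)[of k] \<theta> by auto
    then have "(\<Sum>k<n. - ?a k) \<le> (\<Sum>k<n. - ?p k + ((if k < N then \<bar>?a k - ?p k\<bar> else 0) + err k))"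
      by (intro sum_mono)
    also have "\<dots> = (\<Sum>k<n. - ?p k) + ((\<Sum>k<n. if k < N then \<bar>?a k - ?p k\<bar> else 0) + (\<Sum>k<n. err k))"
      by (simp only: sum.distrib)
    also have "(\<Sum>k<n. err k) \<le> suminf err" using err by (intro sum_le_suminf) auto
    also have "(\<Sum>k<n. if k < N then \<bar>?a k - ?p k\<bar> else 0) = (\<Sum>k\<in>{..<n} \<inter> {..<N}. \<bar>?a k - ?p k\<bar>)"
      by (simp add: sum.inter_restrict)
    also have "\<dots> \<le> (\<Sum>k<N. \<bar>?a k - ?p k\<bar>)" by (intro sum_mono2) auto
    finally have "- (\<Sum>k<n. ?a k) \<le> (\<Sum>k<n. - ?p k) + ?D"
      unfolding sum_negf by linarith
    then show ?thesis unfolding loglik_eq_sum minus_divide_left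
      by (rule divide_right_mono) simp
  qed
  have "eventually (\<lambda>n. ((\<Sum>k<n. - ?p k) + ?D) / real n < - c') sequentially"
    using avg \<open>c' < c\<close> by (intro eventually_add_const_average) auto
  then show ?thesis
  proof eventually_elim
    fix n assume "((\<Sum>k<n. - ?p k) + ?D) / real n < - c'"
    then show "c' < loglik g \<psi> x1 n y \<theta>" using bound[of n] by linarith
  qed
qed

lemma pred_density_eq:
  assumes \<theta>: "\<theta> \<in> \<Theta>" and y: "tame y" and z: "z \<in> space \<nu>"
  shows "pred_density g \<psi> x1 \<theta> y z = ennreal (g \<theta> (limit_state \<theta> y 0) z)"
proof -
  have "(\<lambda>m. orbit \<theta> y (- int m) 0) \<longlonglongrightarrow> limit_state \<theta> y 0"
    using orbit_tendsto_limit_state[OF \<theta> y, of 0] by simp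
  moreover have "isCont (\<lambda>x. g \<theta> x z) (limit_state \<theta> y 0)"
    using g_continuous_in_state[OF \<theta> z] continuous_on_eq_continuous_at[OF open_UNIV] by blast
  ultimately have "(\<lambda>m. g \<theta> (orbit \<theta> y (- int m) 0) z) \<longlonglongrightarrow> g \<theta> (limit_state \<theta> y 0) z"
    by (rule isCont_tendsto_compose[rotated])
  then show ?thesis
    unfolding pred_density_def Let_def orbit_def by (auto simp: limI convergentI)
qed

end

section \<open>The stationary model\<close>

text \<open>
  Replacing \<open>x\<close> by the first point within \<open>1 / (n + 1)\<close> of it in an enumerated dense set makes the function
  measurable, as only countably many sections occur; by continuity these functions converge to \<open>f\<close>.
\<close>

lemma measurable_continuous_in_first:
  fixes f :: "'x::polish_space \<Rightarrow> 'y \<Rightarrow> real"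
  assumes cont: "\<And>z. z \<in> space N \<Longrightarrow> continuous_on UNIV (\<lambda>x. f x z)"
    and meas [measurable]: "\<And>x. f x \<in> borel_measurable N"
  shows "(\<lambda>(x, z). f x z) \<in> borel_measurable (borel \<Otimes>\<^sub>M N)"
proof -
  obtain D :: "'x set" where D: "countable D" "\<And>X. open X \<Longrightarrow> X \<noteq> {} \<Longrightarrow> \<exists>d\<in>D. d \<in> X"
    using countable_dense_setE by blast
  have "D \<noteq> {}" using D(2)[of UNIV] by auto
  define q where "q = from_nat_into D"
  have dense: "\<exists>k. dist x (q k) < e" if "e > 0" for x e
  proof -
    obtain d where "d \<in> D" "d \<in> ball x e" using D(2)[of "ball x e"] \<open>e > 0\<close> by auto
    moreover obtain k where "q k = d"
      using from_nat_into_surj[OF D(1) \<open>d \<in> D\<close>] by (auto simp: q_def)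
    ultimately show ?thesis by auto
  qed
  define k where "k n x = (LEAST k. dist x (q k) < 1 / Suc n)" for n :: nat and x :: 'x
  have k: "dist x (q (k n x)) < 1 / Suc n" for n x
    unfolding k_def by (rule LeastI_ex) (rule dense, simp)
  have [measurable]: "(\<lambda>p :: 'x \<times> 'y. k n (fst p)) \<in> borel \<Otimes>\<^sub>M N \<rightarrow>\<^sub>M count_space UNIV" for n
    unfolding k_def by measurable
  show ?thesis
  proof (rule borel_measurable_LIMSEQ_metric)
    show "(\<lambda>p. f (q (k n (fst p))) (snd p)) \<in> borel_measurable (borel \<Otimes>\<^sub>M N)" for n
      by (rule measurable_compose_countable[where f="\<lambda>i p. f (q i) (snd p)"]) measurable
    fix p :: "'x \<times> 'y" assume "p \<in> space (borel \<Otimes>\<^sub>M N)"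
    then have z: "snd p \<in> space N" by (auto simp: space_pair_measure)
    have "(\<lambda>n. q (k n (fst p))) \<longlonglongrightarrow> fst p"
    proof (rule metric_LIMSEQ_I)
      fix e :: real assume "e > 0"
      then obtain N where N: "1 / Suc N < e" using nat_approx_posE by blast
      have "dist (q (k n (fst p))) (fst p) < e" if "n \<ge> N" for n
      proof -
        have "1 / real (Suc n) \<le> 1 / real (Suc N)" using that by (intro divide_left_mono) auto
        then show ?thesis using k[of "fst p" n] N by (simp add: dist_commute)
      qed
      then show "\<exists>N. \<forall>n\<ge>N. dist (q (k n (fst p))) (fst p) < e" by blast
    qed
    moreover have "isCont (\<lambda>x. f x (snd p)) (fst p)"
      using cont[OF z] continuous_on_eq_continuous_at[OF open_UNIV] by blast
    ultimately show "(\<lambda>n. f (q (k n (fst p))) (snd p)) \<longlonglongrightarrow> (case p of (x, z) \<Rightarrow> f x z)"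
      unfolding case_prod_beta by (rule isCont_tendsto_compose[rotated])
  qed
qed

text \<open>
  On sequences without a limit, \<open>lim\<close> takes one fixed unspecified value.
\<close>

lemma measurable_lim_polish:
  fixes f :: "nat \<Rightarrow> 'a \<Rightarrow> 'x::polish_space"
  assumes f [measurable]: "\<And>i. f i \<in> borel_measurable N"
  shows "(\<lambda>x. lim (\<lambda>i. f i x)) \<in> borel_measurable N"
proof -
  define a where "a = (THE x :: 'x. False)"
  define h where "h x = (if Cauchy (\<lambda>i. f i x) then lim (\<lambda>i. f i x) else a)" for x
  have "h \<in> borel_measurable N"
  proof (rule borel_measurable_LIMSEQ_metric)
    show "(\<lambda>x. if Cauchy (\<lambda>i. f i x) then f n x else a) \<in> borel_measurable N" for n
      by measurable
    show "(\<lambda>n. if Cauchy (\<lambda>i. f i x) then f n x else a) \<longlonglongrightarrow> h x" for x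
      using Cauchy_convergent_iff[of "\<lambda>i. f i x"] by (auto simp: h_def convergent_LIMSEQ_iff)
  qed
  moreover have "lim (\<lambda>i. f i x) = h x" for x
    using Cauchy_convergent_iff[of "\<lambda>i. f i x"] by (auto simp: h_def a_def lim_def convergent_def)
  ultimately show ?thesis by simp
qed

lemma ln_plus_nonneg: "ln_plus u \<ge> 0"
  by (simp add: ln_plus_def)

lemma ln_plus_le: "0 \<le> u \<Longrightarrow> ln_plus u \<le> u"
  using ln_bound[of u] by (cases "u = 0") (auto simp: ln_plus_def)

lemma dominated_by_mono:
  assumes "dominated_by f V" "\<And>x. f' x \<le> f x" shows "dominated_by f' V"
  using assms unfolding dominated_by_def by (meson order_trans)

lemma measurable_ln_plus [measurable (raw)]:
  "f \<in> borel_measurable N \<Longrightarrow> (\<lambda>x. ln_plus (f x)) \<in> borel_measurable N"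
  unfolding ln_plus_def by measurable

context contractive_odm
begin

lemma g_measurable_pair [measurable (raw)]:
  assumes "\<theta> \<in> \<Theta>" "a \<in> N \<rightarrow>\<^sub>M borel" "b \<in> N \<rightarrow>\<^sub>M \<nu>"
  shows "(\<lambda>x. g \<theta> (a x) (b x)) \<in> borel_measurable N"
proof -
  have "(\<lambda>(x, z). g \<theta> x z) \<in> borel_measurable (borel \<Otimes>\<^sub>M \<nu>)"
    using assms(1) by (intro measurable_continuous_in_first g_continuous_in_state dens_measurable)
  from measurable_compose[OF measurable_Pair[OF assms(2,3)] this] show ?thesis by simp
qed

lemma \<psi>_measurable_pair [measurable (raw)]:
  assumes "\<theta> \<in> \<Theta>" "a \<in> N \<rightarrow>\<^sub>M borel" "b \<in> N \<rightarrow>\<^sub>M \<nu>"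
  shows "(\<lambda>x. \<psi> \<theta> (b x) (a x)) \<in> N \<rightarrow>\<^sub>M borel"
  using measurable_compose[OF measurable_Pair[OF assms(2,3)] map_measurable[OF assms(1)]] by simp

lemma orbit_measurable:
  assumes \<theta>: "\<theta> \<in> \<Theta>" and coord: "\<And>j. j \<le> t \<Longrightarrow> (\<lambda>y. y j) \<in> N \<rightarrow>\<^sub>M \<nu>"
  shows "(\<lambda>y. orbit \<theta> y s t) \<in> borel_measurable N"
  using coord
proof (induction "nat (t - s + 1)" arbitrary: t)
  case 0 then show ?case by (simp add: orbit_def)
next
  case (Suc n)
  then have st: "s \<le> t" and n: "n = nat ((t - 1) - s + 1)" by auto
  have "(\<lambda>y. \<psi> \<theta> (y t) (orbit \<theta> y s (t - 1))) \<in> borel_measurable N"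
    using Suc.hyps(1)[OF n] Suc.prems \<theta> by (intro \<psi>_measurable_pair) auto
  then show ?case using st by (simp add: orbit_def iter_map_last)
qed

lemma orbit_measurable_paths [measurable]:
  "\<theta> \<in> \<Theta> \<Longrightarrow> (\<lambda>y. orbit \<theta> y s t) \<in> borel_measurable (paths \<nu>)"
  by (rule orbit_measurable) auto

lemma limit_state_measurable [measurable]:
  "\<theta> \<in> \<Theta> \<Longrightarrow> (\<lambda>y. limit_state \<theta> y t) \<in> borel_measurable (paths \<nu>)"
  unfolding limit_state_def by (intro measurable_lim_polish) measurable

lemma pred_loglik_measurable [measurable]:
  "\<theta> \<in> \<Theta> \<Longrightarrow> pred_loglik \<theta> \<in> borel_measurable (paths \<nu>)"
  unfolding pred_loglik_def[abs_def] by measurable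

lemma pred_density_measurable:
  assumes \<theta>: "\<theta> \<in> \<Theta>"
  shows "(\<lambda>(y, z). pred_density g \<psi> x1 \<theta> y z) \<in> borel_measurable (past \<nu> 0 \<Otimes>\<^sub>M \<nu>)"
proof -
  have [measurable]: "(\<lambda>y. orbit \<theta> y s 0) \<in> borel_measurable (past \<nu> 0)" for s
    using \<theta> by (intro orbit_measurable measurable_past_coordinate) auto
  let ?a = "\<lambda>p m. g \<theta> (orbit \<theta> (fst p) (- int m) 0) (snd p)"
  have [measurable]: "(\<lambda>p. ?a p m) \<in> borel_measurable (past \<nu> 0 \<Otimes>\<^sub>M \<nu>)" for m
    using \<theta> by measurable
  have [measurable]: "Measurable.pred (past \<nu> 0 \<Otimes>\<^sub>M \<nu>) (\<lambda>p. Cauchy (?a p))"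
    unfolding pred_def by measurable
  have "(\<lambda>p. if Cauchy (?a p) then ennreal (lim (?a p)) else \<infinity>) \<in> borel_measurable (past \<nu> 0 \<Otimes>\<^sub>M \<nu>)"
    by measurable
  then show ?thesis
    unfolding pred_density_def orbit_def Let_def case_prod_beta Cauchy_convergent_iff .
qed

end

text \<open>
  The data are generated by the parameter \<open>\<theta>s\<close>. The projection \<open>Q\<close> of the chain on its observations
  is a factor of an ergodic system, hence ergodic for the shift and for its inverse: the latter
  controls the remote past, the former the growth of the likelihood.
\<close>

locale stationary_odm = contractive_odm \<Theta> \<nu> G g \<psi> x1 X1 \<rho> C \<psi>bar H \<phi>bar
  for \<Theta> :: "'t::metric_space set" and \<nu> :: "'y measure"
    and G :: "'t \<Rightarrow> 'x::polish_space \<Rightarrow> 'y measure" and g \<psi> x1 X1 \<rho> C \<psi>bar H \<phi>bar +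
  fixes \<theta>s :: 't and \<pi> :: "('x \<times> 'y) measure" and P :: "(int \<Rightarrow> 'x \<times> 'y) measure" and Vbar :: "'x \<Rightarrow> real"
  assumes \<theta>s: "\<theta>s \<in> \<Theta>"
    and unique: "unique_stationary_distribution (borel \<Otimes>\<^sub>M \<nu>) (odm_kernel \<nu> (G \<theta>s) (\<psi> \<theta>s)) \<pi>"
    and law: "stationary_chain_law (borel \<Otimes>\<^sub>M \<nu>) (odm_kernel \<nu> (G \<theta>s) (\<psi> \<theta>s)) \<pi> P"
    and Vbar_measurable [measurable]: "Vbar \<in> borel_measurable borel"
    and Vbar_integrable: "(\<integral>\<^sup>+ x. ennreal (Vbar x) \<partial>distr \<pi> borel fst) < \<infinity>"
    and moment: "if C = 0 then dominated_by (\<lambda>x. \<integral>\<^sup>+ y. ennreal (ln_plus (\<phi>bar y)) \<partial>G \<theta>s x) Vbar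
          else dominated_by (\<lambda>x. \<integral>\<^sup>+ y. ennreal (\<phi>bar y) \<partial>G \<theta>s x) Vbar"
begin

abbreviation "M \<equiv> (borel :: 'x measure) \<Otimes>\<^sub>M \<nu>"
abbreviation "K \<equiv> odm_kernel \<nu> (G \<theta>s) (\<psi> \<theta>s)"

lemma G_measurable [measurable]: "G \<theta>s \<in> borel \<rightarrow>\<^sub>M prob_algebra \<nu>"
  by (rule kernel[OF \<theta>s])

lemma sets_G [measurable_cong]: "sets (G \<theta>s x) = sets \<nu>"
  using measurable_space[OF G_measurable, of x] by (simp add: space_prob_algebra)

lemma space_G: "space (G \<theta>s x) = space \<nu>"
  by (rule sets_eq_imp_space_eq[OF sets_G])

lemma prob_space_G: "prob_space (G \<theta>s x)"
  using measurable_space[OF G_measurable, of x] by (simp add: space_prob_algebra)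

text \<open>
  The law of the pair of the new state \<open>x\<close> and its observation. The move to \<open>x\<close> is deterministic, so
  the kernel of the model is this law at the image of the current pair (\<open>K_eq\<close>).
\<close>

definition step_kernel :: "'x \<Rightarrow> ('x \<times> 'y) measure" where
  "step_kernel x = G \<theta>s x \<bind> (\<lambda>y. return M (x, y))"

lemma step_kernel_measurable [measurable]: "step_kernel \<in> borel \<rightarrow>\<^sub>M prob_algebra M"
  unfolding step_kernel_def[abs_def] by measurable

lemma K_eq: "K s = step_kernel (\<psi> \<theta>s (snd s) (fst s))"
  unfolding odm_kernel_def step_kernel_def[symmetric] case_prod_beta
  by (rule bind_return[where N=M]) (auto intro: measurable_prob_algebraD)

lemma K_measurable: "K \<in> M \<rightarrow>\<^sub>M prob_algebra M"
proof -
  have "(\<lambda>s. step_kernel (\<psi> \<theta>s (snd s) (fst s))) \<in> M \<rightarrow>\<^sub>M prob_algebra M"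
    using \<theta>s by measurable
  then show ?thesis by (simp add: K_eq[abs_def])
qed

lemma nn_integral_K:
  assumes [measurable]: "f \<in> borel_measurable M"
  shows "(\<integral>\<^sup>+p. f p \<partial>K s) = (\<integral>\<^sup>+z. f (\<psi> \<theta>s (snd s) (fst s), z) \<partial>G \<theta>s (\<psi> \<theta>s (snd s) (fst s)))"
proof -
  have "(\<integral>\<^sup>+p. f p \<partial>step_kernel x) = (\<integral>\<^sup>+z. f (x, z) \<partial>G \<theta>s x)" for x
    unfolding step_kernel_def
    by (subst nn_integral_bind[where B=M])
      (auto intro!: measurable_prob_algebraD nn_integral_cong nn_integral_return simp: space_pair_measure space_G)
  then show ?thesis by (simp add: K_eq)
qed

sublocale chain: stationary_markov M K \<pi> P
  by unfold_locales (rule K_measurable, rule law)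

lemma chain_ergodic: "ergodic_map P (shift_by 1)"
  using unique by (intro chain.ergodic_shift) (auto simp: unique_stationary_distribution_def)

definition obs :: "(int \<Rightarrow> 'x \<times> 'y) \<Rightarrow> int \<Rightarrow> 'y" where
  "obs \<omega> = (\<lambda>k. snd (\<omega> k))"

lemma obs_apply: "obs \<omega> k = snd (\<omega> k)" by (simp add: obs_def)

lemma obs_measurable [measurable]: "obs \<in> paths M \<rightarrow>\<^sub>M paths \<nu>"
  by (rule measurable_pathsI) (simp add: obs_apply)

abbreviation "Q \<equiv> obs_law \<nu> P"

lemma Q_eq: "Q = distr P (paths \<nu>) obs"
  by (simp add: obs_law_def obs_def[abs_def])

lemma sets_Q [simp, measurable_cong]: "sets Q = sets (paths \<nu>)" by (simp add: Q_eq)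
lemma space_Q [simp]: "space Q = space (paths \<nu>)" by (simp add: Q_eq)

lemma Q_ergodic: "ergodic_map Q (shift_by 1)"
  unfolding Q_eq
  by (rule ergodic_map_factor[OF chain_ergodic]) (auto simp: obs_def shift_by_def)

sublocale fwd: ergodic_map Q "shift_by 1" by (rule Q_ergodic)

sublocale bwd: ergodic_map Q "shift_by (- 1)"
  by (rule ergodic_map_inverse[OF Q_ergodic]) auto

lemma sets_\<pi> [measurable_cong]: "sets \<pi> = sets M"
  using chain.marginal[of 0] by (metis sets_distr)

lemma nn_integral_\<pi>:
  assumes [measurable]: "f \<in> borel_measurable M"
  shows "(\<integral>\<^sup>+s. f s \<partial>\<pi>) = (\<integral>\<^sup>+s. (\<integral>\<^sup>+p. f p \<partial>K s) \<partial>\<pi>)"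
proof -
  have "\<pi> \<bind> K = \<pi>"
    using unique by (simp add: unique_stationary_distribution_def stationary_distribution_def)
  then have "(\<integral>\<^sup>+s. f s \<partial>\<pi>) = (\<integral>\<^sup>+s. f s \<partial>(\<pi> \<bind> K))" by simp
  also have "\<dots> = (\<integral>\<^sup>+s. (\<integral>\<^sup>+p. f p \<partial>K s) \<partial>\<pi>)"
    by (rule nn_integral_bind[where B=M])
      (auto intro: measurable_prob_algebraD K_measurable simp: measurable_cong_sets[OF sets_\<pi> refl])
  finally show ?thesis .
qed

text \<open>
  One step of the chain under the stationary law turns \<open>f\<close> into \<open>G f\<close>, and a second use of
  stationarity turns the bound \<open>c * Vbar\<close> at the new state into \<open>c * Vbar\<close> at the current one.
\<close>

lemma finite_moment:
  assumes f [measurable]: "f \<in> borel_measurable \<nu>" and dom: "dominated_by (\<lambda>x. \<integral>\<^sup>+ y. f y \<partial>G \<theta>s x) Vbar"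
  shows "(\<integral>\<^sup>+y. f (y k) \<partial>Q) < \<infinity>"
proof -
  obtain c where c: "c > 0" "\<And>x. (\<integral>\<^sup>+ y. f y \<partial>G \<theta>s x) \<le> ennreal (c * Vbar x)"
    using dom by (auto simp: dominated_by_def)
  have "(\<integral>\<^sup>+y. f (y k) \<partial>Q) = (\<integral>\<^sup>+\<omega>. f (snd (\<omega> k)) \<partial>P)"
    unfolding Q_eq by (subst nn_integral_distr) (auto simp: obs_apply)
  also have "\<dots> = (\<integral>\<^sup>+s. f (snd s) \<partial>\<pi>)"
    by (rule chain.nn_integral_marginal[of "\<lambda>s. f (snd s)"]) measurable
  also have "\<dots> = (\<integral>\<^sup>+s. (\<integral>\<^sup>+y. f y \<partial>G \<theta>s (\<psi> \<theta>s (snd s) (fst s))) \<partial>\<pi>)"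
    by (subst nn_integral_\<pi>) (auto simp: nn_integral_K)
  also have "\<dots> \<le> (\<integral>\<^sup>+s. ennreal (c * Vbar (\<psi> \<theta>s (snd s) (fst s))) \<partial>\<pi>)"
    by (intro nn_integral_mono c)
  also have "\<dots> = (\<integral>\<^sup>+s. (\<integral>\<^sup>+p. ennreal (c * Vbar (fst p)) \<partial>K s) \<partial>\<pi>)"
    by (simp add: nn_integral_K prob_space.emeasure_space_1[OF prob_space_G])
  also have "\<dots> = (\<integral>\<^sup>+s. ennreal (c * Vbar (fst s)) \<partial>\<pi>)"
    by (rule nn_integral_\<pi>[symmetric]) measurable
  also have "\<dots> = ennreal c * (\<integral>\<^sup>+s. ennreal (Vbar (fst s)) \<partial>\<pi>)"
    using c by (subst nn_integral_cmult[symmetric]) (auto simp: ennreal_mult')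
  also have "(\<integral>\<^sup>+s. ennreal (Vbar (fst s)) \<partial>\<pi>) = (\<integral>\<^sup>+x. ennreal (Vbar x) \<partial>distr \<pi> borel fst)"
    by (subst nn_integral_distr) auto
  finally show ?thesis using Vbar_integrable by (auto simp: ennreal_mult_less_top less_le_trans le_less_trans)
qed

lemma ln_plus_\<phi>bar_integrable: "integrable Q (\<lambda>y. ln_plus (\<phi>bar (y k)))"
proof (rule integrableI_nonneg)
  have "dominated_by (\<lambda>x. \<integral>\<^sup>+ y. ennreal (ln_plus (\<phi>bar y)) \<partial>G \<theta>s x) Vbar"
  proof (cases "C = 0")
    case True then show ?thesis using moment by simp
  next
    case False
    then have "dominated_by (\<lambda>x. \<integral>\<^sup>+ y. ennreal (\<phi>bar y) \<partial>G \<theta>s x) Vbar" using moment by simp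
    then show ?thesis
      by (rule dominated_by_mono)
        (auto intro!: nn_integral_mono ennreal_leI ln_plus_le \<phi>bar_nonneg simp: space_G)
  qed
  then show "(\<integral>\<^sup>+y. ennreal (ln_plus (\<phi>bar (y k))) \<partial>Q) < \<infinity>"
    by (intro finite_moment[where f="\<lambda>y. ennreal (ln_plus (\<phi>bar y))"]) auto
qed (auto simp: ln_plus_nonneg)

lemma \<phi>bar_integrable:
  assumes "C \<noteq> 0" shows "integrable Q (\<lambda>y. \<phi>bar (y k))"
proof (rule integrableI_nonneg)
  show "(\<integral>\<^sup>+y. ennreal (\<phi>bar (y k)) \<partial>Q) < \<infinity>"
    using assms moment by (intro finite_moment[where f="\<lambda>y. ennreal (\<phi>bar y)"]) auto
qed (auto intro!: AE_I2 \<phi>bar_nonneg path_in_space)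

text \<open>
  The inverse shift makes \<open>ln_plus (\<phi>bar (y (t - n)))\<close> sublinear in \<open>n\<close>, which the geometric weights
  absorb.
\<close>

lemma AE_tame: "AE y in Q. tame y"
proof -
  have "AE y in Q. \<forall>t. (\<lambda>n. ln_plus (\<phi>bar ((shift_by (- 1) ^^ n) y t)) / real n) \<longlonglongrightarrow> 0"
    unfolding AE_all_countable
    using bwd.AE_orbit_sublinear[OF ln_plus_\<phi>bar_integrable] by blast
  then show ?thesis using AE_space
  proof eventually_elim
    fix y assume lim: "\<forall>t. (\<lambda>n. ln_plus (\<phi>bar ((shift_by (- 1) ^^ n) y t)) / real n) \<longlonglongrightarrow> 0"
      and "y \<in> space Q"
    then have y: "y \<in> space (paths \<nu>)" by simp
    have "summable (\<lambda>i. \<rho> ^ i * \<phi>bar (y (t - int i)))" for t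
    proof (rule summable_comparison_test')
      show "summable (\<lambda>i. \<rho> ^ i * exp (ln_plus (\<phi>bar (y (t - int i)))))"
        using lim by (intro summable_powr_if_sublinear_log \<rho>) (simp add: funpow_shift_by)
      show "norm (\<rho> ^ i * \<phi>bar (y (t - int i))) \<le> \<rho> ^ i * exp (ln_plus (\<phi>bar (y (t - int i))))" if "i \<ge> 0" for i
        using \<rho> \<phi>bar_nonneg[OF path_in_space[OF y]] le_exp_ln_plus[OF \<phi>bar_nonneg[OF path_in_space[OF y]]]
        by (simp add: abs_mult)
    qed
    then show "tame y" using y by (simp add: tame_def)
  qed
qed

lemma past_weight_integrable:
  assumes "C \<noteq> 0" shows "integrable Q (\<lambda>y. past_weight y t)"
  unfolding past_weight_def
proof (rule integrable_suminf)
  have const: "(\<integral>y. \<phi>bar (y (t - int i)) \<partial>Q) = (\<integral>y. \<phi>bar (y t) \<partial>Q)" for i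
  proof (induction i)
    case (Suc i)
    have "(\<integral>y. \<phi>bar (shift_by (- 1) y (t - int i)) \<partial>Q) = (\<integral>y. \<phi>bar (y (t - int i)) \<partial>Q)"
      by (rule bwd.integral_T) measurable
    then show ?case using Suc by (simp add: algebra_simps)
  qed simp
  have norm: "AE y in Q. norm (\<rho> ^ i * \<phi>bar (y (t - int i))) = \<rho> ^ i * \<phi>bar (y (t - int i))" for i
    using \<rho> by (intro AE_I2) (simp add: abs_mult \<phi>bar_nonneg path_in_space)
  show "integrable Q (\<lambda>y. \<rho> ^ i * \<phi>bar (y (t - int i)))" for i
    using \<phi>bar_integrable[OF assms] by simp
  show "AE y in Q. summable (\<lambda>i. norm (\<rho> ^ i * \<phi>bar (y (t - int i))))"
    using AE_tame
  proof eventually_elim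
    fix y assume y: "tame y"
    then have "norm (\<rho> ^ i * \<phi>bar (y (t - int i))) = \<rho> ^ i * \<phi>bar (y (t - int i))" for i
      using \<rho> by (simp add: abs_mult \<phi>bar_nonneg tame_space)
    then show "summable (\<lambda>i. norm (\<rho> ^ i * \<phi>bar (y (t - int i))))"
      using tame_summable[OF y] by simp
  qed
  have "(\<integral>y. norm (\<rho> ^ i * \<phi>bar (y (t - int i))) \<partial>Q) = \<rho> ^ i * (\<integral>y. \<phi>bar (y t) \<partial>Q)" for i
  proof -
    have "(\<integral>y. norm (\<rho> ^ i * \<phi>bar (y (t - int i))) \<partial>Q) = (\<integral>y. \<rho> ^ i * \<phi>bar (y (t - int i)) \<partial>Q)"
      by (rule integral_cong_AE) (use norm in auto)
    then show ?thesis by (simp add: const)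
  qed
  then show "summable (\<lambda>i. \<integral>y. norm (\<rho> ^ i * \<phi>bar (y (t - int i))) \<partial>Q)"
    using \<rho> by (simp add: summable_mult2 summable_geometric)
qed

text \<open>
  For \<open>C = 0\<close> only \<open>ln_plus \<phi>bar\<close> has to be integrable. Otherwise \<open>\<phi>bar\<close> is integrable, and then so is
  the geometric average \<open>past_weight\<close> of its values.
\<close>

lemma AE_regular: "AE y in Q. regular y"
proof -
  let ?f = "\<lambda>y. C * past_weight y 0 + ln_plus (\<phi>bar (y 1))"
  have "integrable Q (\<lambda>y. C * past_weight y 0)"
    using past_weight_integrable by (cases "C = 0") auto
  then have "integrable Q ?f" using ln_plus_\<phi>bar_integrable by (rule Bochner_Integration.integrable_add)
  then have "AE y in Q. (\<lambda>n. ?f ((shift_by 1 ^^ n) y) / real n) \<longlonglongrightarrow> 0"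
    by (rule fwd.AE_orbit_sublinear)
  with AE_tame show ?thesis
    by eventually_elim (simp add: regular_def funpow_shift_by past_weight_shift_by add.commute)
qed

lemma emeasure_K:
  assumes [measurable]: "A \<in> sets M"
  shows "emeasure (K s) A =
    (\<integral>\<^sup>+z. indicator A (\<psi> \<theta>s (snd s) (fst s), z) \<partial>G \<theta>s (\<psi> \<theta>s (snd s) (fst s)))"
proof -
  have "sets (K s) = sets M"
    unfolding K_eq using measurable_space[OF step_kernel_measurable] by (simp add: space_prob_algebra)
  then have "emeasure (K s) A = (\<integral>\<^sup>+p. indicator A p \<partial>K s)" by simp
  then show ?thesis by (simp add: nn_integral_K)
qed

text \<open>
  The kernel never moves from a pair whose image lies in a basic open set \<open>U\<close> to a state outside
  \<open>U\<close>. Countably many \<open>U\<close> separate the points.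
\<close>

lemma AE_state_recursion: "AE \<omega> in P. fst (\<omega> (k + 1)) = \<psi> \<theta>s (snd (\<omega> k)) (fst (\<omega> k))"
proof -
  obtain B :: "'x set set" where B: "countable B" "topological_basis B"
    using ex_countable_basis by blast
  let ?next = "\<lambda>s. \<psi> \<theta>s (snd s) (fst s)"
  have "AE \<omega> in P. \<not> (?next (\<omega> k) \<in> U \<and> fst (\<omega> (k + 1)) \<notin> U)" if "U \<in> B" for U
  proof -
    have "open U" using B(2) that by (rule topological_basis_open)
    then have U [measurable]: "U \<in> sets borel" by (rule borel_open)
    have next_meas [measurable]: "?next \<in> M \<rightarrow>\<^sub>M borel" using \<theta>s by measurable
    define E where "E = (\<lambda>\<omega>. \<omega> k) -` (?next -` U \<inter> space M) \<inter> space (past M k)"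
    define A where "A = fst -` (- U) \<inter> space M"
    have E: "E \<in> sets (past M k)"
      unfolding E_def
      by (rule measurable_sets[OF measurable_past_coordinate[OF order_refl] measurable_sets[OF next_meas U]])
    have A [measurable]: "A \<in> sets M" unfolding A_def by measurable
    have [measurable]: "E \<in> sets (paths M)" using chain.past_events[OF E] .
    have "(\<integral>\<^sup>+\<omega>. indicator E \<omega> * indicator A (\<omega> (k + 1)) \<partial>P) = (\<integral>\<^sup>+\<omega>. indicator E \<omega> * emeasure (K (\<omega> k)) A \<partial>P)"
      by (rule chain.markov_event[OF E A])
    also have "\<dots> = (\<integral>\<^sup>+\<omega>. 0 \<partial>P)"
    proof (rule nn_integral_cong)
      fix \<omega> assume "\<omega> \<in> space P"
      show "indicator E \<omega> * emeasure (K (\<omega> k)) A = 0"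
      proof (cases "\<omega> \<in> E")
        case True
        then have "?next (\<omega> k) \<in> U" by (simp add: E_def)
        then show ?thesis by (simp add: emeasure_K A_def)
      qed simp
    qed
    finally have "(\<integral>\<^sup>+\<omega>. indicator E \<omega> * indicator A (\<omega> (k + 1)) \<partial>P) = 0" by simp
    then have "AE \<omega> in P. indicator E \<omega> * indicator A (\<omega> (k + 1)) = (0 :: ennreal)"
      by (subst (asm) nn_integral_0_iff_AE) auto
    then show ?thesis using AE_space
    proof eventually_elim
      fix \<omega> assume "indicator E \<omega> * indicator A (\<omega> (k + 1)) = (0 :: ennreal)" "\<omega> \<in> space P"
      then show "\<not> (?next (\<omega> k) \<in> U \<and> fst (\<omega> (k + 1)) \<notin> U)"
        by (auto simp: E_def A_def indicator_def space_paths split: if_splits)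
    qed
  qed
  then have "AE \<omega> in P. \<forall>U\<in>B. \<not> (?next (\<omega> k) \<in> U \<and> fst (\<omega> (k + 1)) \<notin> U)"
    using B(1) by (subst AE_ball_countable) auto
  then show ?thesis
  proof eventually_elim
    fix \<omega> assume sep: "\<forall>U\<in>B. \<not> (?next (\<omega> k) \<in> U \<and> fst (\<omega> (k + 1)) \<notin> U)"
    show "fst (\<omega> (k + 1)) = ?next (\<omega> k)"
    proof (rule ccontr)
      assume "fst (\<omega> (k + 1)) \<noteq> ?next (\<omega> k)"
      then obtain O' where "open O'" "?next (\<omega> k) \<in> O'" "fst (\<omega> (k + 1)) \<notin> O'"
        using t1_space[of "?next (\<omega> k)" "fst (\<omega> (k + 1))"] by auto
      moreover from this obtain U where "U \<in> B" "?next (\<omega> k) \<in> U" "U \<subseteq> O'"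
        by (elim topological_basisE[OF B(2)])
      ultimately show False using sep by blast
    qed
  qed
qed

lemma AE_state_is_iterate:
  "AE \<omega> in P. \<forall>n. fst (\<omega> (t + 1)) = iter_map (\<psi> \<theta>s) (obs \<omega>) (t + 1 - int n) t (fst (\<omega> (t + 1 - int n)))"
proof -
  have "AE \<omega> in P. \<forall>k. fst (\<omega> (k + 1)) = \<psi> \<theta>s (snd (\<omega> k)) (fst (\<omega> k))"
    unfolding AE_all_countable using AE_state_recursion by blast
  then show ?thesis
  proof eventually_elim
    fix \<omega> :: "int \<Rightarrow> 'x \<times> 'y" assume rec: "\<forall>k. fst (\<omega> (k + 1)) = \<psi> \<theta>s (snd (\<omega> k)) (fst (\<omega> k))"
    have "fst (\<omega> (t + 1)) = iter_map (\<psi> \<theta>s) (obs \<omega>) (t + 1 - int n) t (fst (\<omega> (t + 1 - int n)))" for n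
    proof (induction n)
      case (Suc n)
      have "iter_map (\<psi> \<theta>s) (obs \<omega>) (t + 1 - int (Suc n)) t (fst (\<omega> (t + 1 - int (Suc n))))
          = iter_map (\<psi> \<theta>s) (obs \<omega>) (t + 1 - int n) t (fst (\<omega> (t + 1 - int n)))"
        using rec[rule_format, of "t - int n"] by (subst iter_map_first) (auto simp: obs_apply algebra_simps)
      with Suc show ?case by simp
    qed simp
    then show "\<forall>n. fst (\<omega> (t + 1)) = iter_map (\<psi> \<theta>s) (obs \<omega>) (t + 1 - int n) t (fst (\<omega> (t + 1 - int n)))"
      by blast
  qed
qed

lemma AE_tame_obs: "AE \<omega> in P. tame (obs \<omega>)"
  using AE_tame unfolding Q_eq by (rule AE_distrD[rotated]) measurable

text \<open>
  The state is reached from the stationary state \<open>m + 1\<close> steps earlier, so its distance to the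
  orbit started at \<open>x1\<close> at that time is at most \<open>\<rho>\<^bsup>m + 1\<^esup> * \<psi>bar\<close> of a variable of fixed law. This tends to 0 in
  probability, while the orbit converges almost surely to the limiting state. Truncating the
  distances at 1 expresses convergence in probability by expectations.
\<close>

lemma AE_state_is_limit: "AE \<omega> in P. fst (\<omega> (t + 1)) = limit_state \<theta>s (obs \<omega>) t"
proof -
  define D where "D m \<omega> = min 1 (dist (orbit \<theta>s (obs \<omega>) (t - int m) t) (fst (\<omega> (t + 1))))" for m and \<omega> :: "int \<Rightarrow> 'x \<times> 'y"
  define L where "L \<omega> = min 1 (dist (limit_state \<theta>s (obs \<omega>) t) (fst (\<omega> (t + 1))))" for \<omega> :: "int \<Rightarrow> 'x \<times> 'y"
  have [measurable]: "(\<lambda>\<omega>. orbit \<theta>s (obs \<omega>) s t) \<in> borel_measurable (paths M)" for s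
    using measurable_compose[OF obs_measurable orbit_measurable_paths[OF \<theta>s]] by simp
  have [measurable]: "(\<lambda>\<omega>. limit_state \<theta>s (obs \<omega>) t) \<in> borel_measurable (paths M)"
    using measurable_compose[OF obs_measurable limit_state_measurable[OF \<theta>s]] by simp
  have [measurable]: "D m \<in> borel_measurable (paths M)" "L \<in> borel_measurable (paths M)" for m
    unfolding D_def[abs_def] L_def[abs_def] by measurable
  have D_lim: "(\<lambda>m. \<integral>\<omega>. D m \<omega> \<partial>P) \<longlonglongrightarrow> (\<integral>\<omega>. L \<omega> \<partial>P)"
  proof (rule integral_dominated_convergence[where w="\<lambda>_. 1"])
    show "AE \<omega> in P. (\<lambda>m. D m \<omega>) \<longlonglongrightarrow> L \<omega>"
      using AE_tame_obs
      by eventually_elim (auto simp: D_def L_def intro!: tendsto_intros orbit_tendsto_limit_state \<theta>s)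
  qed (auto simp: D_def)
  have "(\<lambda>m. \<integral>s. min 1 (\<rho> ^ Suc m * \<bar>\<psi>bar (fst s)\<bar>) \<partial>\<pi>) \<longlonglongrightarrow> (\<integral>s. 0 \<partial>\<pi>)"
  proof (rule integral_dominated_convergence[where w="\<lambda>_. 1"])
    have "prob_space \<pi>" unfolding chain.marginal[of 0, symmetric] by (rule chain.prob_space_distr) simp
    then interpret \<pi>: prob_space \<pi> .
    show "integrable \<pi> (\<lambda>_. 1 :: real)" by simp
    have "(\<lambda>m. min 1 (\<rho> ^ Suc m * c)) \<longlonglongrightarrow> min 1 (0 * c)" for c
      using \<rho> by (intro tendsto_intros LIMSEQ_Suc LIMSEQ_power_zero) auto
    then show "AE s in \<pi>. (\<lambda>m. min 1 (\<rho> ^ Suc m * \<bar>\<psi>bar (fst s)\<bar>)) \<longlonglongrightarrow> 0" by simp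
  qed (use \<rho> in \<open>auto simp: abs_mult\<close>)
  then have bound_lim: "(\<lambda>m. \<integral>s. min 1 (\<rho> ^ Suc m * \<bar>\<psi>bar (fst s)\<bar>) \<partial>\<pi>) \<longlonglongrightarrow> 0" by simp
  have D_le: "(\<integral>\<omega>. D m \<omega> \<partial>P) \<le> (\<integral>s. min 1 (\<rho> ^ Suc m * \<bar>\<psi>bar (fst s)\<bar>) \<partial>\<pi>)" for m
  proof -
    have "(\<integral>\<omega>. D m \<omega> \<partial>P) \<le> (\<integral>\<omega>. min 1 (\<rho> ^ Suc m * \<bar>\<psi>bar (fst (\<omega> (t - int m)))\<bar>) \<partial>P)"
    proof (rule integral_mono_AE)
      show "integrable P (D m)"
        by (rule chain.integrable_const_bound[where B=1]) (auto simp: D_def)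
      show "integrable P (\<lambda>\<omega>. min 1 (\<rho> ^ Suc m * \<bar>\<psi>bar (fst (\<omega> (t - int m)))\<bar>))"
        using \<rho> by (intro chain.integrable_const_bound[where B=1]) (auto simp: abs_mult)
      show "AE \<omega> in P. D m \<omega> \<le> min 1 (\<rho> ^ Suc m * \<bar>\<psi>bar (fst (\<omega> (t - int m)))\<bar>)"
        using AE_state_is_iterate[of t] AE_space
      proof eventually_elim
        fix \<omega> assume it: "\<forall>n. fst (\<omega> (t + 1)) = iter_map (\<psi> \<theta>s) (obs \<omega>) (t + 1 - int n) t (fst (\<omega> (t + 1 - int n)))"
          and "\<omega> \<in> space P"
        then have "obs \<omega> \<in> space (paths \<nu>)" using measurable_space[OF obs_measurable] by simp
        from iter_map_contraction[OF \<theta>s this, of "t - int m" t "fst (\<omega> (t - int m))"]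
        have "dist (orbit \<theta>s (obs \<omega>) (t - int m) t) (fst (\<omega> (t + 1))) \<le> \<rho> ^ Suc m * \<psi>bar (fst (\<omega> (t - int m)))"
          using it[rule_format, of "Suc m"] by (simp add: nat_add_distrib)
        also have "\<dots> \<le> \<rho> ^ Suc m * \<bar>\<psi>bar (fst (\<omega> (t - int m)))\<bar>"
          using \<rho> by (intro mult_left_mono) auto
        finally show "D m \<omega> \<le> min 1 (\<rho> ^ Suc m * \<bar>\<psi>bar (fst (\<omega> (t - int m)))\<bar>)"
          by (simp add: D_def min.coboundedI2)
      qed
    qed
    also have "\<dots> = (\<integral>s. min 1 (\<rho> ^ Suc m * \<bar>\<psi>bar (fst s)\<bar>) \<partial>distr P M (\<lambda>\<omega>. \<omega> (t - int m)))"
      by (subst integral_distr) auto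
    finally show ?thesis by (simp add: chain.marginal)
  qed
  have "(\<integral>\<omega>. L \<omega> \<partial>P) \<le> 0"
    by (rule LIMSEQ_le[OF D_lim bound_lim]) (use D_le in auto)
  moreover have "integrable P L"
    by (rule chain.integrable_const_bound[where B=1]) (auto simp: L_def)
  moreover have L_nonneg: "AE \<omega> in P. 0 \<le> L \<omega>" by (simp add: L_def)
  ultimately have "AE \<omega> in P. L \<omega> = 0"
    using integral_nonneg_eq_0_iff_AE[of P L] integral_nonneg_AE[OF L_nonneg] by linarith
  then show ?thesis
    by eventually_elim (auto simp: L_def min_def split: if_splits)
qed

lemma emeasure_G_dens: "emeasure (G \<theta>s x) B = (\<integral>\<^sup>+z\<in>B. ennreal (g \<theta>s x z) \<partial>\<nu>)" if "B \<in> sets \<nu>"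
  using that \<theta>s by (simp add: dominated emeasure_density dens_measurable)

text \<open>
  Given the past of the chain, the next observation has density \<open>g \<theta>s x\<close>, where \<open>x\<close> is the
  next state. By \<open>AE_state_is_limit\<close> this state is a function of the past observations alone, so
  conditioning on these gives the same density.
\<close>

lemma pred_density_conditional:
  "conditional_density Q (past \<nu> 0) \<nu> (\<lambda>y. y 1) (pred_density g \<psi> x1 \<theta>s)"
  unfolding conditional_density_def
proof (intro conjI ballI)
  interpret \<nu>: sigma_finite_measure \<nu> by (rule sigma_finite_dom)
  let ?p = "pred_density g \<psi> x1 \<theta>s"
  show pm: "(\<lambda>(y, z). ?p y z) \<in> borel_measurable (past \<nu> 0 \<Otimes>\<^sub>M \<nu>)"
    by (rule pred_density_measurable[OF \<theta>s])
  fix B assume B [measurable]: "B \<in> sets \<nu>"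
  interpret sub: sigma_finite_subalgebra Q "past \<nu> 0"
  proof (rule finite_measure_subalgebra_is_sigma_finite)
    show "finite_measure_subalgebra Q (past \<nu> 0)"
      by (intro finite_measure_subalgebra.intro finite_measure_subalgebra_axioms.intro fwd.finite_measure_axioms)
        (use sets_past_subset in \<open>auto simp: subalgebra_def\<close>)
  qed
  let ?E = "{y \<in> space Q. y 1 \<in> B}"
  let ?f = "\<lambda>y. \<integral>\<^sup>+z\<in>B. ?p y z \<partial>\<nu>"
  have f_past: "?f \<in> borel_measurable (past \<nu> 0)"
    using pm by (intro \<nu>.borel_measurable_nn_integral) (simp add: case_prod_beta)
  have f_paths [measurable]: "?f \<in> borel_measurable (paths \<nu>)"
    using f_past measurable_from_subalg[OF sub.subalg] by (simp add: measurable_cong_sets[OF sets_Q refl])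
  have "AE y in Q. ?f y = nn_cond_exp Q (past \<nu> 0) (indicator ?E) y"
  proof (rule sub.nn_cond_exp_charact)
    show "?f \<in> borel_measurable (past \<nu> 0)" by (rule f_past)
    show "indicator ?E \<in> borel_measurable Q" by measurable
    fix A assume A: "A \<in> sets (past \<nu> 0)"
    then have A' [measurable]: "A \<in> sets (paths \<nu>)" using sets_past_subset by blast
    define D where "D = obs -` A \<inter> space (past M 0)"
    have "obs \<in> past M 0 \<rightarrow>\<^sub>M past \<nu> 0"
      using measurable_space[OF obs_measurable]
      by (intro measurable_to_past) (auto simp: obs_apply intro!: measurable_compose[OF measurable_past_coordinate])
    then have D: "D \<in> sets (past M 0)" unfolding D_def using A by (rule measurable_sets)
    have ind: "indicator A (obs \<omega>) = (indicator D \<omega> :: ennreal)" if "\<omega> \<in> space P" for \<omega>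
      using that by (simp add: D_def indicator_def)
    let ?B = "snd -` B \<inter> space M"
    have B' [measurable]: "?B \<in> sets M" by measurable
    have "(\<integral>\<^sup>+y\<in>A. indicator ?E y \<partial>Q) = (\<integral>\<^sup>+\<omega>. indicator ?E (obs \<omega>) * indicator A (obs \<omega>) \<partial>P)"
      unfolding Q_eq by (subst nn_integral_distr) auto
    also have "\<dots> = (\<integral>\<^sup>+\<omega>. indicator D \<omega> * indicator ?B (\<omega> (0 + 1)) \<partial>P)"
    proof (rule nn_integral_cong)
      fix \<omega> assume \<omega>: "\<omega> \<in> space P"
      then have "obs \<omega> \<in> space (paths \<nu>)" using measurable_space[OF obs_measurable] by simp
      moreover have "\<omega> 1 \<in> space M" using \<omega> by (simp add: space_paths)
      ultimately have "indicator ?E (obs \<omega>) = (indicator ?B (\<omega> (0 + 1)) :: ennreal)"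
        by (simp add: indicator_def obs_apply)
      then show "indicator ?E (obs \<omega>) * indicator A (obs \<omega>) = (indicator D \<omega> * indicator ?B (\<omega> (0 + 1)) :: ennreal)"
        by (simp add: ind[OF \<omega>] mult.commute)
    qed
    also have "\<dots> = (\<integral>\<^sup>+\<omega>. indicator D \<omega> * emeasure (K (\<omega> 0)) ?B \<partial>P)"
      by (rule chain.markov_event[OF D B'])
    also have "\<dots> = (\<integral>\<^sup>+\<omega>. indicator D \<omega> * ?f (obs \<omega>) \<partial>P)"
    proof (rule nn_integral_cong_AE)
      show "AE \<omega> in P. indicator D \<omega> * emeasure (K (\<omega> 0)) ?B = indicator D \<omega> * ?f (obs \<omega>)"
        using AE_state_is_limit[of 0] AE_state_recursion[of 0] AE_tame_obs AE_space
      proof eventually_elim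
        fix \<omega> assume 1: "fst (\<omega> (0 + 1)) = limit_state \<theta>s (obs \<omega>) 0"
          and 2: "fst (\<omega> (0 + 1)) = \<psi> \<theta>s (snd (\<omega> 0)) (fst (\<omega> 0))" and tame: "tame (obs \<omega>)"
        let ?x = "limit_state \<theta>s (obs \<omega>) 0"
        have "emeasure (K (\<omega> 0)) ?B = (\<integral>\<^sup>+z. indicator ?B (?x, z) \<partial>G \<theta>s ?x)"
          using 1 2 by (simp add: emeasure_K)
        also have "\<dots> = (\<integral>\<^sup>+z. indicator B z \<partial>G \<theta>s ?x)"
          by (intro nn_integral_cong) (auto simp: indicator_def space_pair_measure space_G)
        also have "\<dots> = emeasure (G \<theta>s ?x) B" by (simp add: sets_G)
        also have "\<dots> = ?f (obs \<omega>)"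
          unfolding emeasure_G_dens[OF B]
          by (intro nn_integral_cong) (simp add: pred_density_eq[OF \<theta>s tame])
        finally show "indicator D \<omega> * emeasure (K (\<omega> 0)) ?B = indicator D \<omega> * ?f (obs \<omega>)" by simp
      qed
    qed
    also have "\<dots> = (\<integral>\<^sup>+\<omega>. ?f (obs \<omega>) * indicator A (obs \<omega>) \<partial>P)"
      by (intro nn_integral_cong) (simp add: ind mult.commute)
    also have "\<dots> = (\<integral>\<^sup>+y\<in>A. ?f y \<partial>Q)"
      unfolding Q_eq by (subst nn_integral_distr) auto
    finally show "(\<integral>\<^sup>+y\<in>A. indicator ?E y \<partial>Q) = (\<integral>\<^sup>+y\<in>A. ?f y \<partial>Q)" .
  qed
  then show "AE y in Q. nn_cond_exp Q (past \<nu> 0) (indicator ?E) y = ?f y"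
    by eventually_elim simp
qed

lemma AE_pred_density:
  assumes \<theta>: "\<theta> \<in> \<Theta>"
  shows "AE y in Q. prob_density \<nu> (pred_density g \<psi> x1 \<theta> y)"
  using AE_tame
proof eventually_elim
  fix y assume y: "tame y"
  let ?x = "limit_state \<theta> y 0"
  have eq: "pred_density g \<psi> x1 \<theta> y z = ennreal (g \<theta> ?x z)" if "z \<in> space \<nu>" for z
    by (rule pred_density_eq[OF \<theta> y that])
  have "prob_space (G \<theta> ?x)"
    using measurable_space[OF kernel[OF \<theta>], of ?x] by (simp add: space_prob_algebra)
  then have "emeasure (G \<theta> ?x) (space (G \<theta> ?x)) = 1" by (rule prob_space.emeasure_space_1)
  then have "(\<integral>\<^sup>+z. ennreal (g \<theta> ?x z) \<partial>\<nu>) = 1"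
    using \<theta> dens_measurable[OF \<theta>, of ?x] by (simp add: dominated emeasure_density cong: nn_integral_cong)
  moreover have "(\<lambda>z. ennreal (g \<theta> ?x z)) \<in> borel_measurable \<nu>"
    using dens_measurable[OF \<theta>, of ?x] by measurable
  ultimately show "prob_density \<nu> (pred_density g \<psi> x1 \<theta> y)"
    unfolding prob_density_def
    by (auto simp: eq cong: nn_integral_cong measurable_cong)
qed

end

section \<open>Consistency\<close>

lemma ext_expectation_cong_AE:
  assumes "AE x in N. f x = h x" shows "ext_expectation N f = ext_expectation N h"
proof -
  have "(\<integral>\<^sup>+x. e2ennreal (f x) \<partial>N) = (\<integral>\<^sup>+x. e2ennreal (h x) \<partial>N)"
    "(\<integral>\<^sup>+x. e2ennreal (- f x) \<partial>N) = (\<integral>\<^sup>+x. e2ennreal (- h x) \<partial>N)"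
    using assms by (intro nn_integral_cong_AE; eventually_elim; simp)+
  then show ?thesis by (simp add: ext_expectation_def)
qed

lemma ext_expectation_integrable:
  fixes f :: "'a \<Rightarrow> real"
  assumes "integrable N f" shows "ext_expectation N (\<lambda>x. ereal (f x)) = ereal (\<integral>x. f x \<partial>N)"
proof -
  have fin: "(\<integral>\<^sup>+x. ennreal (f x) \<partial>N) \<noteq> \<infinity>" "(\<integral>\<^sup>+x. ennreal (- f x) \<partial>N) \<noteq> \<infinity>"
    using assms by (auto simp: real_integrable_def)
  have "enn2ereal u = ereal (enn2real u)" if "u \<noteq> \<infinity>" for u
    using that by (cases u) auto
  then show ?thesis
    using fin real_lebesgue_integral_def[OF assms] by (simp add: ext_expectation_def e2ennreal_ereal)
qed

lemma ext_expectation_not_integrable: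
  fixes f :: "'a \<Rightarrow> real"
  assumes "finite_measure N" and f: "f \<in> borel_measurable N" and b: "AE x in N. f x \<le> b" and "\<not> integrable N f"
  shows "ext_expectation N (\<lambda>x. ereal (f x)) = - \<infinity>"
proof -
  interpret finite_measure N by fact
  have "(\<integral>\<^sup>+x. ennreal (f x) \<partial>N) \<le> (\<integral>\<^sup>+x. ennreal b \<partial>N)"
    using b by (intro nn_integral_mono_AE) (auto intro: ennreal_leI)
  also have "\<dots> < \<infinity>" using emeasure_finite[of "space N"]
    by (simp add: ennreal_mult_eq_top_iff less_top[symmetric])
  finally have fin: "(\<integral>\<^sup>+x. ennreal (f x) \<partial>N) \<noteq> \<infinity>" by simp
  then have inf: "(\<integral>\<^sup>+x. ennreal (- f x) \<partial>N) = \<infinity>"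
    using assms(4) f by (auto simp: real_integrable_def)
  have "enn2ereal u - \<infinity> = - \<infinity>" if "u \<noteq> \<infinity>" for u
    using that by (cases u) auto
  then show ?thesis using fin inf by (simp add: ext_expectation_def e2ennreal_ereal)
qed

lemma mem_argmax_set: "\<theta> \<in> argmax_set S f \<longleftrightarrow> \<theta> \<in> S \<and> (\<forall>\<theta>'\<in>S. f \<theta>' \<le> f \<theta>)"
  for f :: "'b \<Rightarrow> 'c::linorder"
  by (auto simp: argmax_set_def is_arg_max_def not_less)

lemma compact_finite_ball_cover:
  fixes S :: "'a::metric_space set"
  assumes "compact S" and "\<And>x. x \<in> S \<Longrightarrow> 0 < r x"
  shows "\<exists>F. F \<subseteq> S \<and> finite F \<and> S \<subseteq> (\<Union>x\<in>F. ball x (r x))"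
proof (rule compactE_image[OF assms(1), of S "\<lambda>x. ball x (r x)"])
  show "S \<subseteq> (\<Union>x\<in>S. ball x (r x))" using assms(2) by auto
qed blast+

lemma compact_countable_dense:
  fixes S :: "'a::metric_space set"
  assumes "compact S"
  shows "\<exists>D. countable D \<and> D \<subseteq> S \<and> (\<forall>x\<in>S. \<forall>e>0. \<exists>d\<in>D. dist d x < e)"
proof -
  have "\<forall>n::nat. \<exists>F. F \<subseteq> S \<and> finite F \<and> S \<subseteq> (\<Union>x\<in>F. ball x (1 / Suc n))"
    by (intro allI compact_finite_ball_cover assms) simp
  from choice[OF this] obtain F where F: "\<And>n::nat. F n \<subseteq> S" "\<And>n. finite (F n)"
    "\<And>n. S \<subseteq> (\<Union>x\<in>F n. ball x (1 / Suc n))"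
    by blast
  have "\<exists>d\<in>(\<Union>n. F n). dist d x < e" if "x \<in> S" "e > 0" for x e
  proof -
    obtain n where "1 / Suc n < e" using \<open>e > 0\<close> nat_approx_posE by blast
    moreover obtain d where "d \<in> F n" "dist d x < 1 / Suc n" using F(3)[of n] \<open>x \<in> S\<close> by auto
    ultimately show ?thesis by (intro bexI[of _ d]) auto
  qed
  moreover have "countable (\<Union>n. F n)" "(\<Union>n. F n) \<subseteq> S"
    using F by (auto intro!: countable_UN intro: countable_finite)
  ultimately show ?thesis by blast
qed

context stationary_odm
begin

lemma prob_Q [simp]: "measure Q (space (paths \<nu>)) = 1"
  using fwd.prob_space by simp

definition objective :: "'t \<Rightarrow> ereal" where
  "objective \<theta> = ext_expectation Q (\<lambda>y. ext_ln (pred_density g \<psi> x1 \<theta> y (y 1)))"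

lemma objective_eq:
  assumes \<theta>: "\<theta> \<in> \<Theta>" shows "objective \<theta> = ext_expectation Q (\<lambda>y. ereal (pred_loglik \<theta> y))"
  unfolding objective_def
proof (rule ext_expectation_cong_AE)
  show "AE y in Q. ext_ln (pred_density g \<psi> x1 \<theta> y (y 1)) = ereal (pred_loglik \<theta> y)"
    using AE_tame
  proof eventually_elim
    fix y assume y: "tame y"
    have "g \<theta> (limit_state \<theta> y 0) (y 1) > 0" by (intro dens_pos \<theta> tame_space y)
    then show "ext_ln (pred_density g \<psi> x1 \<theta> y (y 1)) = ereal (pred_loglik \<theta> y)"
      by (simp add: pred_density_eq[OF \<theta> y tame_space[OF y]] ext_ln_def pred_loglik_def)
  qed
qed

lemma objective_integrable:
  "\<theta> \<in> \<Theta> \<Longrightarrow> integrable Q (pred_loglik \<theta>) \<Longrightarrow> objective \<theta> = ereal (\<integral>y. pred_loglik \<theta> y \<partial>Q)"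
  by (simp add: objective_eq ext_expectation_integrable)

lemma objective_not_integrable:
  assumes \<theta>: "\<theta> \<in> \<Theta>" and "\<not> integrable Q (pred_loglik \<theta>)"
  shows "objective \<theta> = - \<infinity>"
proof -
  obtain b where b: "\<forall>\<theta>\<in>\<Theta>. \<forall>y. tame y \<longrightarrow> pred_loglik \<theta> y \<le> b"
    using pred_loglik_bounded_above by blast
  have "AE y in Q. pred_loglik \<theta> y \<le> b" using AE_tame by eventually_elim (use b \<theta> in blast)
  then show ?thesis
    unfolding objective_eq[OF \<theta>]
    using assms by (intro ext_expectation_not_integrable fwd.finite_measure_axioms) auto
qed

text \<open>
  Let \<open>b\<close> bound the log-densities from above. As the ball shrinks, the infimum of \<open>b - pred_loglik\<close> over
  its points increases to the value at the centre, by continuity; so by monotone convergence its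
  expectation eventually exceeds \<open>b - c\<close>, even after truncation at the integer \<open>j\<close>. The
  truncation makes the envelope \<open>w\<close> integrable also when the log-density itself is not, and taking the
  infimum over a countable dense set makes it measurable.
\<close>

lemma local_envelope:
  assumes \<theta>0: "\<theta>0 \<in> \<Theta>" and less: "objective \<theta>0 < ereal c"
  shows "\<exists>r>0. \<exists>w. integrable Q w \<and> (\<integral>y. w y \<partial>Q) < c \<and>
    (\<forall>\<theta>\<in>\<Theta> \<inter> ball \<theta>0 r. \<forall>y. tame y \<longrightarrow> pred_loglik \<theta> y \<le> w y)"
proof -
  obtain b where b: "\<And>\<theta> y. \<theta> \<in> \<Theta> \<Longrightarrow> tame y \<Longrightarrow> pred_loglik \<theta> y \<le> b"
    using pred_loglik_bounded_above by blast
  show ?thesis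
  proof (cases "c \<le> b")
    case False
    then show ?thesis using b
      by (intro exI[of _ 1] conjI exI[of _ "\<lambda>_. b"]) (auto simp: fwd.prob_space)
  next
    case cb: True
    obtain D where D: "countable D" "D \<subseteq> \<Theta>"
      and dense: "\<And>\<theta> e. \<theta> \<in> \<Theta> \<Longrightarrow> e > 0 \<Longrightarrow> \<exists>d\<in>D. dist d \<theta> < e"
      using compact_countable_dense[OF compact_param] by blast
    define r where "r j = 1 / real (Suc j)" for j
    have r_pos: "r j > 0" for j by (simp add: r_def)
    have r_decr: "r k \<le> r j" if "j \<le> k" for j k
      unfolding r_def using that by (intro divide_left_mono) auto
    define J where "J j y = min (of_nat j) (INF \<theta>\<in>D \<inter> ball \<theta>0 (r j). ennreal (b - pred_loglik \<theta> y))"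
      for j :: nat and y
    have pl [measurable]: "pred_loglik \<theta> \<in> borel_measurable (paths \<nu>)" if "\<theta> \<in> D" for \<theta>
      using that D by auto
    have J_meas [measurable]: "J j \<in> borel_measurable (paths \<nu>)" for j
      unfolding J_def[abs_def] using D(1)
      by (intro borel_measurable_min borel_measurable_INF) (auto intro!: measurable_compose[OF _ measurable_ennreal] borel_measurable_diff pl)
    have J_mono: "incseq J"
      unfolding incseq_def le_fun_def J_def using r_decr
      by (intro allI impI min.mono INF_superset_mono) (auto simp: less_le_trans)
    have SUP_J: "ennreal (b - pred_loglik \<theta>0 y) \<le> (SUP j. J j y)" if y: "tame y" for y
    proof (rule ennreal_le_epsilon)
      fix e :: real assume e: "e > 0"
      have "continuous_on \<Theta> (\<lambda>\<theta>. pred_loglik \<theta> y)" using y by (rule pred_loglik_continuous)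
      then obtain d where d: "d > 0"
        "\<And>\<theta>. \<theta> \<in> \<Theta> \<Longrightarrow> dist \<theta> \<theta>0 < d \<Longrightarrow> dist (pred_loglik \<theta> y) (pred_loglik \<theta>0 y) < e"
        using \<theta>0 e unfolding continuous_on_iff by metis
      obtain j1 where j1: "r j1 < d" using d(1) nat_approx_posE[of d] by (auto simp: r_def)
      obtain j2 :: nat where j2: "b - pred_loglik \<theta>0 y \<le> real j2" using real_arch_simple by blast
      define j where "j = max j1 j2"
      have "ennreal (b - pred_loglik \<theta>0 y - e) \<le> J j y"
        unfolding J_def
      proof (intro min.boundedI INF_greatest)
        show "ennreal (b - pred_loglik \<theta>0 y - e) \<le> of_nat j"
          unfolding ennreal_of_nat_eq_real_of_nat using j2 e by (intro ennreal_leI) (simp add: j_def)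
        fix \<theta> assume "\<theta> \<in> D \<inter> ball \<theta>0 (r j)"
        then have "\<theta> \<in> \<Theta>" "dist \<theta> \<theta>0 < d"
          using D j1 r_decr[of j1 j] by (auto simp: dist_commute j_def)
        from d(2)[OF this] show "ennreal (b - pred_loglik \<theta>0 y - e) \<le> ennreal (b - pred_loglik \<theta> y)"
          by (intro ennreal_leI) (auto simp: dist_real_def)
      qed
      also have "\<dots> \<le> (SUP j. J j y)" by (rule SUP_upper) simp
      finally have "ennreal (b - pred_loglik \<theta>0 y - e) + ennreal e \<le> (SUP j. J j y) + ennreal e"
        by (rule add_right_mono)
      moreover have "ennreal (b - pred_loglik \<theta>0 y) \<le> ennreal (b - pred_loglik \<theta>0 y - e) + ennreal e"
      proof (cases "b - pred_loglik \<theta>0 y \<le> e")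
        case True
        then show ?thesis by (intro add_increasing ennreal_leI) auto
      next
        case False
        then show ?thesis using e by (simp flip: ennreal_plus)
      qed
      ultimately show "ennreal (b - pred_loglik \<theta>0 y) \<le> (SUP j. J j y) + ennreal e" by (rule order_trans[rotated])
    qed
    have "ennreal (b - c) < (\<integral>\<^sup>+y. ennreal (b - pred_loglik \<theta>0 y) \<partial>Q)"
    proof (rule ccontr)
      assume "\<not> ?thesis"
      then have le: "(\<integral>\<^sup>+y. ennreal (b - pred_loglik \<theta>0 y) \<partial>Q) \<le> ennreal (b - c)" by simp
      have nonneg: "AE y in Q. 0 \<le> b - pred_loglik \<theta>0 y"
        using AE_tame by eventually_elim (use b \<theta>0 in fastforce)
      have int: "integrable Q (\<lambda>y. b - pred_loglik \<theta>0 y)"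
        using \<theta>0 nonneg le by (intro integrableI_nonneg) (auto simp: le_less_trans)
      then have int0: "integrable Q (pred_loglik \<theta>0)"
        using Bochner_Integration.integrable_diff[OF _ int, of "\<lambda>_. b"] by simp
      have "ennreal (\<integral>y. b - pred_loglik \<theta>0 y \<partial>Q) \<le> ennreal (b - c)"
        using le nn_integral_eq_integral[OF int nonneg] by simp
      then have "(\<integral>y. b - pred_loglik \<theta>0 y \<partial>Q) \<le> b - c" using cb by (simp add: ennreal_le_iff)
      then have "c \<le> (\<integral>y. pred_loglik \<theta>0 y \<partial>Q)" using int0 by (simp add: fwd.prob_space)
      then show False using less objective_integrable[OF \<theta>0 int0] by simp
    qed
    also have "\<dots> \<le> (\<integral>\<^sup>+y. (SUP j. J j y) \<partial>Q)"
    proof (rule nn_integral_mono_AE)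
      show "AE y in Q. ennreal (b - pred_loglik \<theta>0 y) \<le> (SUP j. J j y)"
        using AE_tame by eventually_elim (rule SUP_J)
    qed
    also have "\<dots> = (SUP j. \<integral>\<^sup>+y. J j y \<partial>Q)"
      by (rule nn_integral_monotone_convergence_SUP[OF J_mono]) measurable
    finally obtain j where j: "ennreal (b - c) < (\<integral>\<^sup>+y. J j y \<partial>Q)" by (auto simp: less_SUP_iff)
    define w where "w y = b - enn2real (J j y)" for y
    have J_le: "J j y \<le> of_nat j" for y by (simp add: J_def)
    then have J_fin: "J j y < \<infinity>" for y by (rule le_less_trans) (simp add: of_nat_less_top)
    have J_real_le: "enn2real (J j y) \<le> j" for y
      using J_le by (intro enn2real_leI) (simp_all add: ennreal_of_nat_eq_real_of_nat)
    have J_int: "integrable Q (\<lambda>y. enn2real (J j y))"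
      using J_real_le by (intro fwd.integrable_const_bound[where B="real j"]) auto
    have "ennreal (\<integral>y. enn2real (J j y) \<partial>Q) = (\<integral>\<^sup>+y. ennreal (enn2real (J j y)) \<partial>Q)"
      using J_int by (intro nn_integral_eq_integral[symmetric]) auto
    also have "\<dots> = (\<integral>\<^sup>+y. J j y \<partial>Q)" using J_fin by (intro nn_integral_cong) simp
    finally have "b - c < (\<integral>y. enn2real (J j y) \<partial>Q)" using j cb by (metis ennreal_less_iff diff_ge_0_iff_ge)
    then have "(\<integral>y. w y \<partial>Q) < c" using J_int by (simp add: w_def fwd.prob_space)
    moreover have "integrable Q w" unfolding w_def[abs_def] using J_int by simp
    moreover have "pred_loglik \<theta> y \<le> w y" if \<theta>: "\<theta> \<in> \<Theta> \<inter> ball \<theta>0 (r j)" and y: "tame y" for \<theta> y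
    proof (rule ccontr)
      assume "\<not> pred_loglik \<theta> y \<le> w y"
      then have pos: "pred_loglik \<theta> y - w y > 0" by simp
      have "continuous_on \<Theta> (\<lambda>\<theta>. pred_loglik \<theta> y)" using y by (rule pred_loglik_continuous)
      then obtain d where d: "d > 0"
        "\<And>\<theta>'. \<theta>' \<in> \<Theta> \<Longrightarrow> dist \<theta>' \<theta> < d \<Longrightarrow> dist (pred_loglik \<theta>' y) (pred_loglik \<theta> y) < pred_loglik \<theta> y - w y"
        using \<theta> pos unfolding continuous_on_iff by (metis IntD1)
      obtain \<theta>' where \<theta>': "\<theta>' \<in> D" "dist \<theta>' \<theta> < min d (r j - dist \<theta>0 \<theta>)"
        using dense[of \<theta> "min d (r j - dist \<theta>0 \<theta>)"] \<theta> d(1) by auto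
      have in_ball: "\<theta>' \<in> D \<inter> ball \<theta>0 (r j)"
        using \<theta>' dist_triangle[of \<theta>0 \<theta>' \<theta>] by (auto simp: dist_commute)
      have "J j y \<le> ennreal (b - pred_loglik \<theta>' y)"
        unfolding J_def by (rule min.coboundedI2) (rule INF_lower[OF in_ball])
      then have "enn2real (J j y) \<le> b - pred_loglik \<theta>' y"
        using b[of \<theta>' y] in_ball D y by (intro enn2real_leI) auto
      then have "pred_loglik \<theta>' y \<le> w y" by (simp add: w_def)
      moreover have "w y < pred_loglik \<theta>' y"
        using d(2)[of \<theta>'] \<theta>' D by (auto simp: dist_real_def abs_if split: if_splits)
      ultimately show False by simp
    qed
    ultimately show ?thesis using r_pos[of j] by blast
  qed
qed

lemma objective_cases:
  assumes "\<theta> \<in> \<Theta>"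
  obtains "objective \<theta> = - \<infinity>"
  | "integrable Q (pred_loglik \<theta>)" "objective \<theta> = ereal (\<integral>y. pred_loglik \<theta> y \<partial>Q)"
  using assms objective_integrable objective_not_integrable by blast

lemma objective_upper_semicontinuous:
  assumes "\<theta>0 \<in> \<Theta>" and "objective \<theta>0 < ereal c"
  shows "\<exists>r>0. \<forall>\<theta>\<in>\<Theta> \<inter> ball \<theta>0 r. objective \<theta> < ereal c"
proof -
  obtain r w where r: "r > 0" and w: "integrable Q w" "(\<integral>y. w y \<partial>Q) < c"
    and env: "\<And>\<theta> y. \<theta> \<in> \<Theta> \<inter> ball \<theta>0 r \<Longrightarrow> tame y \<Longrightarrow> pred_loglik \<theta> y \<le> w y"
    using local_envelope[OF assms] by blast
  have "objective \<theta> < ereal c" if \<theta>: "\<theta> \<in> \<Theta> \<inter> ball \<theta>0 r" for \<theta>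
  proof (cases rule: objective_cases[OF IntD1[OF \<theta>]])
    case 2
    have "(\<integral>y. pred_loglik \<theta> y \<partial>Q) \<le> (\<integral>y. w y \<partial>Q)"
    proof (rule integral_mono_AE[OF 2(1) w(1)])
      show "AE y in Q. pred_loglik \<theta> y \<le> w y"
        using AE_tame by eventually_elim (rule env[OF \<theta>])
    qed
    then show ?thesis using 2 w by simp
  qed simp
  then show ?thesis using r by blast
qed

abbreviation "maximizers \<equiv> argmax_set \<Theta> objective"

text \<open>
  If every parameter \<open>\<theta>\<close> had a better one \<open>up \<theta>\<close>, with a number \<open>c \<theta>\<close> in between, then finitely many
  balls on which the objective stays below \<open>c \<theta>\<close> would cover the parameter set. The improvement of the
  centre with the largest \<open>c \<theta>\<close> lies in none of them.
\<close>

lemma maximizers_nonempty: "maximizers \<noteq> {}"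
proof
  assume "maximizers = {}"
  then have "\<forall>\<theta>\<in>\<Theta>. \<exists>\<theta>'\<in>\<Theta>. objective \<theta> < objective \<theta>'"
    unfolding set_eq_iff mem_argmax_set by (auto simp: not_le)
  then have "\<forall>\<theta>\<in>\<Theta>. \<exists>\<theta>' c r. \<theta>' \<in> \<Theta> \<and> ereal c < objective \<theta>' \<and> r > 0 \<and> (\<forall>\<eta>\<in>\<Theta> \<inter> ball \<theta> r. objective \<eta> < ereal c)"
  proof (intro ballI)
    fix \<theta> assume \<theta>: "\<theta> \<in> \<Theta>" and "\<forall>\<theta>\<in>\<Theta>. \<exists>\<theta>'\<in>\<Theta>. objective \<theta> < objective \<theta>'"
    then obtain \<theta>' where \<theta>': "\<theta>' \<in> \<Theta>" "objective \<theta> < objective \<theta>'" by blast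
    then obtain c where "objective \<theta> < ereal c" "ereal c < objective \<theta>'" using ereal_dense2 by blast
    then show "\<exists>\<theta>' c r. \<theta>' \<in> \<Theta> \<and> ereal c < objective \<theta>' \<and> r > 0 \<and> (\<forall>\<eta>\<in>\<Theta> \<inter> ball \<theta> r. objective \<eta> < ereal c)"
      using objective_upper_semicontinuous[OF \<theta>] \<theta>' by blast
  qed
  then obtain up c r where up: "\<And>\<theta>. \<theta> \<in> \<Theta> \<Longrightarrow> up \<theta> \<in> \<Theta>"
    and c: "\<And>\<theta>. \<theta> \<in> \<Theta> \<Longrightarrow> ereal (c \<theta>) < objective (up \<theta>)"
    and r: "\<And>\<theta>. \<theta> \<in> \<Theta> \<Longrightarrow> r \<theta> > 0"
    and below: "\<And>\<theta> \<eta>. \<theta> \<in> \<Theta> \<Longrightarrow> \<eta> \<in> \<Theta> \<Longrightarrow> \<eta> \<in> ball \<theta> (r \<theta>) \<Longrightarrow> objective \<eta> < ereal (c \<theta>)"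
    by (metis IntI)
  obtain F where F: "F \<subseteq> \<Theta>" "finite F" "\<Theta> \<subseteq> (\<Union>\<theta>\<in>F. ball \<theta> (r \<theta>))"
    using compact_finite_ball_cover[OF compact_param, of r] r by blast
  have "F \<noteq> {}" using F(3) \<theta>s by auto
  then have "Max (c ` F) \<in> c ` F" using F(2) by (intro Max_in) auto
  then obtain \<theta> where "\<theta> \<in> F" and Max_eq: "Max (c ` F) = c \<theta>" by blast
  moreover have "c \<eta> \<le> c \<theta>" if "\<eta> \<in> F" for \<eta>
    unfolding Max_eq[symmetric] using F(2) that by (intro Max_ge) auto
  ultimately have \<theta>: "\<theta> \<in> F" "\<And>\<eta>. \<eta> \<in> F \<Longrightarrow> c \<eta> \<le> c \<theta>" by blast+
  have \<theta>\<Theta>: "\<theta> \<in> \<Theta>" using \<theta> F by auto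
  obtain \<eta> where \<eta>: "\<eta> \<in> F" "up \<theta> \<in> ball \<eta> (r \<eta>)" using up[OF \<theta>\<Theta>] F(3) by blast
  have "objective (up \<theta>) < ereal (c \<eta>)" using \<eta> F up[OF \<theta>\<Theta>] by (intro below) auto
  also have "\<dots> \<le> ereal (c \<theta>)" using \<theta>(2)[OF \<eta>(1)] by simp
  also have "\<dots> < objective (up \<theta>)" by (rule c[OF \<theta>\<Theta>])
  finally show False .
qed

text \<open>
  The envelope around \<open>\<theta>0\<close> has mean below \<open>c\<close> and the log-density at the maximizer has mean
  above \<open>c''\<close>; the remaining gap absorbs the difference between the likelihood and its stationary version.
\<close>

lemma loglik_separates_locally:
  assumes \<theta>m: "\<theta>m \<in> \<Theta>" and \<theta>0: "\<theta>0 \<in> \<Theta>" and less: "objective \<theta>0 < objective \<theta>m"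
  shows "\<exists>r>0. AE y in Q. eventually (\<lambda>n. \<forall>\<theta>\<in>\<Theta> \<inter> ball \<theta>0 r.
    loglik g \<psi> x1 n y \<theta> < loglik g \<psi> x1 n y \<theta>m) sequentially"
proof -
  from less have "objective \<theta>m \<noteq> - \<infinity>" by auto
  then have int: "integrable Q (pred_loglik \<theta>m)" and obj: "objective \<theta>m = ereal (\<integral>y. pred_loglik \<theta>m y \<partial>Q)"
    using objective_cases[OF \<theta>m] by metis+
  let ?l = "\<integral>y. pred_loglik \<theta>m y \<partial>Q"
  obtain c where c: "objective \<theta>0 < ereal c" "c < ?l"
    using less ereal_dense2 unfolding obj by (metis ereal_less_eq(3) less_ereal.simps(1))
  obtain c' where c': "c < c'" "c' < ?l" using c(2) dense by blast
  obtain c'' where c'': "c' < c''" "c'' < ?l" using c'(2) dense by blast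
  obtain r w where r: "r > 0" and w: "integrable Q w" "(\<integral>y. w y \<partial>Q) < c"
    and env: "\<And>\<theta> y. \<theta> \<in> \<Theta> \<inter> ball \<theta>0 r \<Longrightarrow> tame y \<Longrightarrow> pred_loglik \<theta> y \<le> w y"
    using local_envelope[OF \<theta>0 c(1)] by blast
  have 1: "AE y in Q. eventually (\<lambda>n. (\<Sum>k<n. w ((shift_by 1 ^^ k) y)) / real n < c) sequentially"
    by (rule fwd.AE_averages_less[OF w])
  have 2: "AE y in Q. eventually (\<lambda>n. (\<Sum>k<n. - pred_loglik \<theta>m ((shift_by 1 ^^ k) y)) / real n < - c'') sequentially"
    using int c'' by (intro fwd.AE_averages_less[of "\<lambda>y. - pred_loglik \<theta>m y"]) auto
  have "AE y in Q. eventually (\<lambda>n. \<forall>\<theta>\<in>\<Theta> \<inter> ball \<theta>0 r.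
    loglik g \<psi> x1 n y \<theta> < loglik g \<psi> x1 n y \<theta>m) sequentially"
    using AE_regular 1 2
  proof eventually_elim
    fix y assume y: "regular y"
      and 1: "eventually (\<lambda>n. (\<Sum>k<n. w ((shift_by 1 ^^ k) y)) / real n < c) sequentially"
      and 2: "eventually (\<lambda>n. (\<Sum>k<n. - pred_loglik \<theta>m ((shift_by 1 ^^ k) y)) / real n < - c'') sequentially"
    have "tame y" using y by (simp add: regular_def)
    then have "pred_loglik \<theta> (shift_by (int k) y) \<le> w (shift_by (int k) y)" if "\<theta> \<in> \<Theta> \<inter> ball \<theta>0 r" for \<theta> k
      by (intro env[OF that] tame_shift_by)
    then have "eventually (\<lambda>n. \<forall>\<theta>\<in>\<Theta> \<inter> ball \<theta>0 r. loglik g \<psi> x1 n y \<theta> < c') sequentially"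
      using 1 c' unfolding funpow_shift_by mult_1_right
      by (intro eventually_loglik_less[OF y, where w="\<lambda>k. w (shift_by (int k) y)" and c=c]) auto
    moreover have "eventually (\<lambda>n. c' < loglik g \<psi> x1 n y \<theta>m) sequentially"
      using 2 c'' unfolding funpow_shift_by mult_1_right
      by (intro eventually_loglik_greater[OF y \<theta>m]) auto
    ultimately show "eventually (\<lambda>n. \<forall>\<theta>\<in>\<Theta> \<inter> ball \<theta>0 r.
        loglik g \<psi> x1 n y \<theta> < loglik g \<psi> x1 n y \<theta>m) sequentially"
      by eventually_elim force
  qed
  then show ?thesis using r by blast
qed

lemma loglik_separates:
  assumes \<theta>m: "\<theta>m \<in> maximizers" and e: "e > 0"
  shows "AE y in Q. eventually (\<lambda>n. \<forall>\<theta>\<in>\<Theta>. e \<le> infdist \<theta> maximizers \<longrightarrow>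
    loglik g \<psi> x1 n y \<theta> < loglik g \<psi> x1 n y \<theta>m) sequentially"
proof -
  let ?N = "{\<theta> \<in> \<Theta>. e \<le> infdist \<theta> maximizers}"
  have "?N = \<Theta> \<inter> {\<theta>. e \<le> infdist \<theta> maximizers}" by auto
  moreover have "closed {\<theta>. e \<le> infdist \<theta> maximizers}" by (intro closed_Collect_le continuous_intros)
  ultimately have compact: "compact ?N" using compact_param by (simp add: compact_Int_closed)
  have \<theta>m': "\<theta>m \<in> \<Theta>" "\<And>\<theta>. \<theta> \<in> \<Theta> \<Longrightarrow> objective \<theta> \<le> objective \<theta>m"
    using \<theta>m by (auto simp: mem_argmax_set)
  have "objective \<theta> < objective \<theta>m" if "\<theta> \<in> ?N" for \<theta>
  proof (rule ccontr)
    assume "\<not> objective \<theta> < objective \<theta>m"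
    then have "\<theta> \<in> maximizers" using that \<theta>m' by (auto simp: mem_argmax_set not_less intro: order_trans)
    then show False using that e by simp
  qed
  then have "\<forall>\<theta>0\<in>?N. \<exists>r>0. AE y in Q. eventually (\<lambda>n. \<forall>\<theta>\<in>\<Theta> \<inter> ball \<theta>0 r.
      loglik g \<psi> x1 n y \<theta> < loglik g \<psi> x1 n y \<theta>m) sequentially"
    using loglik_separates_locally[OF \<theta>m'(1)] by blast
  from bchoice[OF this] obtain r where r: "\<And>\<theta>0. \<theta>0 \<in> ?N \<Longrightarrow> r \<theta>0 > 0"
    and sep: "\<And>\<theta>0. \<theta>0 \<in> ?N \<Longrightarrow> AE y in Q. eventually (\<lambda>n. \<forall>\<theta>\<in>\<Theta> \<inter> ball \<theta>0 (r \<theta>0).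
      loglik g \<psi> x1 n y \<theta> < loglik g \<psi> x1 n y \<theta>m) sequentially"
    by blast
  obtain F where F: "F \<subseteq> ?N" "finite F" "?N \<subseteq> (\<Union>\<theta>\<in>F. ball \<theta> (r \<theta>))"
    using compact_finite_ball_cover[OF compact, of r] r by blast
  have "AE y in Q. \<forall>\<theta>0\<in>F. eventually (\<lambda>n. \<forall>\<theta>\<in>\<Theta> \<inter> ball \<theta>0 (r \<theta>0).
      loglik g \<psi> x1 n y \<theta> < loglik g \<psi> x1 n y \<theta>m) sequentially"
    using F sep by (intro AE_finite_allI) auto
  then show ?thesis
  proof eventually_elim
    fix y assume "\<forall>\<theta>0\<in>F. eventually (\<lambda>n. \<forall>\<theta>\<in>\<Theta> \<inter> ball \<theta>0 (r \<theta>0).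
      loglik g \<psi> x1 n y \<theta> < loglik g \<psi> x1 n y \<theta>m) sequentially"
    then have "eventually (\<lambda>n. \<forall>\<theta>0\<in>F. \<forall>\<theta>\<in>\<Theta> \<inter> ball \<theta>0 (r \<theta>0).
      loglik g \<psi> x1 n y \<theta> < loglik g \<psi> x1 n y \<theta>m) sequentially"
      using F(2) by (simp add: eventually_ball_finite_distrib)
    then show "eventually (\<lambda>n. \<forall>\<theta>\<in>\<Theta>. e \<le> infdist \<theta> maximizers \<longrightarrow>
        loglik g \<psi> x1 n y \<theta> < loglik g \<psi> x1 n y \<theta>m) sequentially"
    proof eventually_elim
      fix n assume less: "\<forall>\<theta>0\<in>F. \<forall>\<theta>\<in>\<Theta> \<inter> ball \<theta>0 (r \<theta>0). loglik g \<psi> x1 n y \<theta> < loglik g \<psi> x1 n y \<theta>m"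
      show "\<forall>\<theta>\<in>\<Theta>. e \<le> infdist \<theta> maximizers \<longrightarrow> loglik g \<psi> x1 n y \<theta> < loglik g \<psi> x1 n y \<theta>m"
      proof (intro ballI impI)
        fix \<theta> assume "\<theta> \<in> \<Theta>" "e \<le> infdist \<theta> maximizers"
        then obtain \<theta>0 where "\<theta>0 \<in> F" "\<theta> \<in> ball \<theta>0 (r \<theta>0)" using F(3) by auto
        then show "loglik g \<psi> x1 n y \<theta> < loglik g \<psi> x1 n y \<theta>m" using less \<open>\<theta> \<in> \<Theta>\<close> by blast
      qed
    qed
  qed
qed

text \<open>
  The estimator maximizes the likelihood, so it cannot lie where the likelihood is smaller than at
  \<open>\<theta>m\<close>. If the objective is identically \<open>-\<infinity>\<close>, then every parameter is a maximizer and the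
  distance is 0 anyway.
\<close>

theorem mle_consistent:
  assumes mle: "\<And>n y. n \<ge> 1 \<Longrightarrow> y \<in> space Q \<Longrightarrow> \<theta>hat n y \<in> argmax_set \<Theta> (loglik g \<psi> x1 n y)"
  shows "AE y in Q. (\<lambda>n. infdist (\<theta>hat n y) maximizers) \<longlonglongrightarrow> 0"
proof -
  obtain \<theta>m where \<theta>m: "\<theta>m \<in> maximizers" using maximizers_nonempty by blast
  have "AE y in Q. \<forall>j::nat. eventually (\<lambda>n. \<forall>\<theta>\<in>\<Theta>. 1 / Suc j \<le> infdist \<theta> maximizers \<longrightarrow>
    loglik g \<psi> x1 n y \<theta> < loglik g \<psi> x1 n y \<theta>m) sequentially"
    unfolding AE_all_countable using loglik_separates[OF \<theta>m] by simp
  then show ?thesis using AE_space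
  proof eventually_elim
    fix y assume sep: "\<forall>j::nat. eventually (\<lambda>n. \<forall>\<theta>\<in>\<Theta>. 1 / Suc j \<le> infdist \<theta> maximizers \<longrightarrow>
      loglik g \<psi> x1 n y \<theta> < loglik g \<psi> x1 n y \<theta>m) sequentially" and y: "y \<in> space Q"
    show "(\<lambda>n. infdist (\<theta>hat n y) maximizers) \<longlonglongrightarrow> 0"
    proof (rule tendstoI)
      fix e :: real assume "e > 0"
      then obtain j where j: "1 / Suc j < e" using nat_approx_posE by blast
      show "eventually (\<lambda>n. dist (infdist (\<theta>hat n y) maximizers) 0 < e) sequentially"
        using sep[rule_format, of j] eventually_ge_at_top[of 1]
      proof eventually_elim
        fix n :: nat assume less: "\<forall>\<theta>\<in>\<Theta>. 1 / Suc j \<le> infdist \<theta> maximizers \<longrightarrow>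
          loglik g \<psi> x1 n y \<theta> < loglik g \<psi> x1 n y \<theta>m" and n: "1 \<le> n"
        have "\<theta>hat n y \<in> \<Theta>" "loglik g \<psi> x1 n y \<theta>m \<le> loglik g \<psi> x1 n y (\<theta>hat n y)"
          using mle[OF n y] \<theta>m by (auto simp: mem_argmax_set)
        then have "infdist (\<theta>hat n y) maximizers < 1 / Suc j"
          using less by (meson not_le)
        then show "dist (infdist (\<theta>hat n y) maximizers) 0 < e"
          using j infdist_nonneg[of "\<theta>hat n y" maximizers] by (simp add: dist_real_def)
      qed
    qed
  qed
qed

end

theorem theorem3:
  fixes \<Theta> :: "'t::metric_space set"
    and \<nu> :: "'y measure"
    and G :: "'t \<Rightarrow> 'x::polish_space \<Rightarrow> 'y measure"
    and g :: "'t \<Rightarrow> 'x \<Rightarrow> 'y \<Rightarrow> real"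
    and \<psi> :: "'t \<Rightarrow> 'y \<Rightarrow> 'x \<Rightarrow> 'x"
    and \<pi> :: "'t \<Rightarrow> ('x \<times> 'y) measure"
    and P :: "'t \<Rightarrow> (int \<Rightarrow> 'x \<times> 'y) measure"
    and Vbar :: "'x \<Rightarrow> real"
    and x1 :: 'x and X1 :: "'x set" and \<rho> C :: real
    and \<psi>bar :: "'x \<Rightarrow> real" and H :: "real \<Rightarrow> real" and \<phi>bar :: "'y \<Rightarrow> real"
  assumes model: "dominated_odm \<Theta> \<nu> G g \<psi>"
    and a: "\<And>\<theta>. \<theta> \<in> \<Theta> \<Longrightarrow>
          unique_stationary_distribution (borel \<Otimes>\<^sub>M \<nu>) (odm_kernel \<nu> (G \<theta>) (\<psi> \<theta>)) (\<pi> \<theta>)"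
    and law: "\<And>\<theta>. \<theta> \<in> \<Theta> \<Longrightarrow>
          stationary_chain_law (borel \<Otimes>\<^sub>M \<nu>) (odm_kernel \<nu> (G \<theta>) (\<psi> \<theta>)) (\<pi> \<theta>) (P \<theta>)"
    and b: "Vbar \<in> borel_measurable borel" "\<And>x. Vbar x \<ge> 0"
      "\<And>\<theta>. \<theta> \<in> \<Theta> \<Longrightarrow> (\<integral>\<^sup>+ x. ennreal (Vbar x) \<partial>distr (\<pi> \<theta>) borel fst) < \<infinity>"
    and c: "\<And>y. y \<in> space \<nu> \<Longrightarrow> continuous_on (\<Theta> \<times> UNIV) (\<lambda>(\<theta>, x). g \<theta> x y)"
      "\<And>y. y \<in> space \<nu> \<Longrightarrow> continuous_on (\<Theta> \<times> UNIV) (\<lambda>(\<theta>, x). \<psi> \<theta> y x)"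
    and d: "closed X1" "0 < \<rho>" "\<rho> < 1" "C \<ge> 0"
      "\<psi>bar \<in> borel_measurable borel" "\<And>x. \<psi>bar x \<ge> 0"
      "H \<in> borel_measurable (restrict_space borel {0..})" "\<And>u. u \<ge> 0 \<Longrightarrow> H u \<ge> 0"
      "\<phi>bar \<in> borel_measurable \<nu>" "\<And>y. y \<in> space \<nu> \<Longrightarrow> \<phi>bar y \<ge> 0"
    and d_i: "\<And>\<theta> x y. \<theta> \<in> \<Theta> \<Longrightarrow> y \<in> space \<nu> \<Longrightarrow> \<psi> \<theta> y x \<in> X1"
    and d_ii: "bdd_above ((\<lambda>(\<theta>, x, y). g \<theta> x y) ` (\<Theta> \<times> X1 \<times> space \<nu>))"
    and d_iii: "\<And>\<theta> (n::nat) x y. \<theta> \<in> \<Theta> \<Longrightarrow> (\<And>k. k \<in> {1..int n} \<Longrightarrow> y k \<in> space \<nu>) \<Longrightarrow>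
          dist (iter_map (\<psi> \<theta>) y 1 (int n) x1) (iter_map (\<psi> \<theta>) y 1 (int n) x) \<le> \<rho> ^ n * \<psi>bar x"
    and d_iv: "locally_bounded \<psi>bar"
    and d_v: "\<And>\<theta> y. \<theta> \<in> \<Theta> \<Longrightarrow> y \<in> space \<nu> \<Longrightarrow> \<psi>bar (\<psi> \<theta> y x1) \<le> \<phi>bar y"
    and d_vi: "\<And>\<theta> x x' y. \<theta> \<in> \<Theta> \<Longrightarrow> x \<in> X1 \<Longrightarrow> x' \<in> X1 \<Longrightarrow> y \<in> space \<nu> \<Longrightarrow>
          \<bar>ln (g \<theta> x y / g \<theta> x' y)\<bar>
            \<le> H (dist x x') * exp (C * max (dist x1 x) (dist x1 x')) * \<phi>bar y"
    and d_vii: "H \<in> O[at_right 0](\<lambda>u. u)"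
    and d_viii: "\<And>\<theta>. \<theta> \<in> \<Theta> \<Longrightarrow>
          if C = 0 then dominated_by (\<lambda>x. \<integral>\<^sup>+ y. ennreal (ln_plus (\<phi>bar y)) \<partial>G \<theta> x) Vbar
          else dominated_by (\<lambda>x. \<integral>\<^sup>+ y. ennreal (\<phi>bar y) \<partial>G \<theta> x) Vbar"
  shows
    "(\<forall>\<theta>\<in>\<Theta>. \<forall>\<theta>s\<in>\<Theta>.
        (\<theta> \<noteq> \<theta>s \<longrightarrow>
          (AE y in obs_law \<nu> (P \<theta>s). prob_density \<nu> (pred_density g \<psi> x1 \<theta> y))) \<and>
        conditional_density (obs_law \<nu> (P \<theta>s)) (past \<nu> 0) \<nu> (\<lambda>y. y 1) (pred_density g \<psi> x1 \<theta>s))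
     \<and>
     (\<forall>\<theta>s\<in>\<Theta>.
        let \<Theta>s = argmax_set \<Theta> (\<lambda>\<theta>. ext_expectation (obs_law \<nu> (P \<theta>s))
                                      (\<lambda>y. ext_ln (pred_density g \<psi> x1 \<theta> y (y 1))))
        in \<comment> \<open>the infimum of distances to the empty set is \<open>\<infinity>\<close>, whereas \<open>infdist\<close> to it is 0\<close>
           \<Theta>s \<noteq> {} \<and>
           (\<forall>\<theta>hat :: nat \<Rightarrow> (int \<Rightarrow> 'y) \<Rightarrow> 't.
              (\<forall>n\<ge>1. \<forall>y\<in>space (obs_law \<nu> (P \<theta>s)). \<theta>hat n y \<in> argmax_set \<Theta> (loglik g \<psi> x1 n y)) \<longrightarrow>
              (AE y in obs_law \<nu> (P \<theta>s). (\<lambda>n. infdist (\<theta>hat n y) \<Theta>s) \<longlonglongrightarrow> 0)))"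
proof -
  have chain: "stationary_odm \<Theta> \<nu> G g \<psi> x1 X1 \<rho> C \<psi>bar H \<phi>bar \<theta>s (\<pi> \<theta>s) (P \<theta>s) Vbar"
    if \<theta>s: "\<theta>s \<in> \<Theta>" for \<theta>s
  proof (rule stationary_odm.intro)
    show "contractive_odm \<Theta> \<nu> G g \<psi> x1 X1 \<rho> C \<psi>bar H \<phi>bar"
      by (rule contractive_odm.intro[OF model], rule contractive_odm_axioms.intro;
          fact c d d_i d_ii d_iii d_v d_vi d_vii)
    show "stationary_odm_axioms \<Theta> \<nu> G \<psi> C \<phi>bar \<theta>s (\<pi> \<theta>s) (P \<theta>s) Vbar"
      by (rule stationary_odm_axioms.intro; fact \<theta>s a[OF \<theta>s] law[OF \<theta>s] b(1) b(3)[OF \<theta>s] d_viii[OF \<theta>s])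
  qed
  show ?thesis
  proof (intro conjI ballI impI, goal_cases)
    case (1 \<theta> \<theta>s)
    then show ?case by (intro stationary_odm.AE_pred_density[OF chain])
  next
    case (2 \<theta> \<theta>s)
    then show ?case by (intro stationary_odm.pred_density_conditional[OF chain])
  next
    case (3 \<theta>s)
    interpret stationary_odm \<Theta> \<nu> G g \<psi> x1 X1 \<rho> C \<psi>bar H \<phi>bar \<theta>s "\<pi> \<theta>s" "P \<theta>s" Vbar
      by (rule chain[OF 3])
    show ?case
      unfolding Let_def objective_def[abs_def, symmetric]
      using maximizers_nonempty mle_consistent by blast
  qed
qed

end
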